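(* Let $n\ge 1$ and work in type $B$ or in type $C$ (fixed throughout). Let $(\mathbf T_1,\mathbf T_2)$ and $(\mathbf T_1',\mathbf T_2')$ be two pairs of domino tableaux of rank $n$ of that type, such that the two tableaux in each pair have the same shape and $\mathbf T_2=\mathbf T_2'$. Then there is a finite sequence $\Sigma$ of operators, each of one of the forms $T_{\alpha\beta}$, $U^L_{\alpha\beta}$, $S_k$, $S_k'$, ${}^tS_k$, ${}^tS_k'$, such that $(\mathbf T_1',\mathbf T_2')$ is one of the pairs in $T_\Sigma(\mathbf T_1,\mathbf T_2)$.
   Context: **Domino tableaux.** $S_{i,j}$ denotes the square in row $i$, column $j$ ($i,j\ge1$, rows numbered downward). A domino is a pair of horizontally or vertically adjacent squares. A domino tableau of rank $n$ of type $C$ is a Young diagram with $2n$ squares tiled by $n$ dominos labelled $1,\dots,n$, each label used once, with labels weakly increasing along rows and down columns. In type $B$ the Young diagram has $2n+1$ squares, $S_{1,1}$ is a single square labelled $0$, and the remaining squares are tiled by dominos labelled $1,\dots,n$, again with labels weakly increasing along rows and down columns. $D(k)$ is the domino labelled $k$. Transposing a tableau interchanges rows and columns, keeping labels. **Roots and $\tau$-invariants.** Let $\alpha_1,\dots,\alpha_n$ be the simple roots, $\alpha_i$ being adjacent to $\alpha_{i+1}$; $\alpha_2,\dots,\alpha_n$ have the same length, while $\alpha_1$ has a different length (long in type $C$, short in type $B$). For a tableau $\mathbf T$: $\alpha_1\in\tau(\mathbf T)$ iff $D(1)$ is vertical; for $i\ge2$, $\alpha_i\in\tau(\mathbf T)$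 iff $D(i)$ lies below $D(i-1)$ (all its squares lie in strictly lower rows). **Operators $T_{\alpha\beta}$ (equal lengths).** Let $\{\alpha,\beta\}=\{\alpha_i,\alpha_{i+1}\}$ with $i\ge2$. $T_{\alpha\beta}$ is defined on tableaux $\mathbf T$ with $\beta\in\tau(\mathbf T)$, $\alpha\notin\tau(\mathbf T)$. If $D(i-1),D(i),D(i+1)$ together fill a $2\times3$ or $3\times2$ rectangle, $T_{\alpha\beta}(\mathbf T)$ is obtained by replacing the tiling and labelling of this rectangle by the only other one with labels $i-1,i,i+1$ that gives a tableau having $\alpha$ but not $\beta$ in its $\tau$-invariant (an $F$-type interchange; in a $2\times 3$ rectangle, "$i-1,i$ horizontal and stacked with $i+1$ vertical on their right" is exchanged with "$i-1$ vertical with $i,i+1$ horizontal and stacked on its right"; transpose for $3\times2$). Otherwise $T_{\alpha\beta}(\mathbf T)$ is the unique tableau having $\alpha$ but not $\beta$ in its $\tau$-invariant obtained from $\mathbf T$ by interchanging either the labels $i-1,i$ or the labels $i,i+1$. On pairs, $T_{\alpha\beta}(\mathbf T_1,\mathbf T_2)=(T_{\alpha\beta}(\mathbf T_1),\mathbf T_2)$. **Cycles.** In both types call $S_{i,j}$ fixed if $i+j$ is odd and variable if $i+j$ is even; each domino has exactly one fixed square. Extend labels by setting the label of $S_{i,j}$ to be $0$ if $i\le0$ or $j\le0$, and $\infty$ if $i,j\ge1$ but $S_{i,j}\notin\mathbf T$. For a domino $D(k)$ with fixed square $S_{i,j}$ define $D'(k)$: if $D(k)$ is $\{S_{i,j},S_{i+1,j}\}$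 or $\{S_{i,j-1},S_{i,j}\}$, then $D'(k)=\{S_{i,j},S_{i-1,j}\}$ if $k$ is less than the label of $S_{i-1,j+1}$, and $\{S_{i,j},S_{i,j+1}\}$ if $k$ is greater; if $D(k)$ is $\{S_{i,j},S_{i-1,j}\}$ or $\{S_{i,j},S_{i,j+1}\}$, then $D'(k)=\{S_{i,j},S_{i,j-1}\}$ if $k$ is less than the label of $S_{i+1,j-1}$, and $\{S_{i,j},S_{i+1,j}\}$ if $k$ is greater. Cycles are the classes of labels for the equivalence relation generated by $k\sim l$ whenever $D(k)\cap D'(l)\neq\emptyset$. Moving through a cycle $c$ means replacing $D(k)$ by $D'(k)$ for all $k\in c$. The cycle is closed if this leaves the shape of the tableau (including the square $S_{1,1}$ labelled $0$ in type $B$) unchanged. **Operators $U^L_{\alpha\beta}$ (different lengths).** Let $\{\alpha,\beta\}=\{\alpha_1,\alpha_2\}$. $U^L_{\alpha\beta}$ acts on pairs $(\mathbf T_1,\mathbf T_2)$ of the same shape with $\beta\in\tau(\mathbf T_1)$, $\alpha\notin\tau(\mathbf T_1)$ and yields a set of pairs with right tableau $\mathbf T_2$. In type $C$, call $\mathbf T_1$ basic if $D(1)\cup D(2)$ is the $2\times2$ box $\{S_{1,1},S_{1,2},S_{2,1},S_{2,2}\}$; in type $B$, call it basic if $\{D(1),D(2)\}=\{\{S_{1,2},S_{1,3}\},\{S_{2,1},S_{3,1}\}\}$ (a hook). If $\mathbf T_1$ is basic, let $\mathbf T_1'$ be obtained by replacing the positions of $D(1)$ and $D(2)$ by their transposes.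 Then $(\mathbf T_1',\mathbf T_2)\in U^L_{\alpha\beta}(\mathbf T_1,\mathbf T_2)$; if in addition $2$ lies in a closed cycle of $\mathbf T_1'$, and $\mathbf T_1''$ is obtained from $\mathbf T_1'$ by moving through this closed cycle, then also $(\mathbf T_1'',\mathbf T_2)\in U^L_{\alpha\beta}(\mathbf T_1,\mathbf T_2)$; there are no other elements. If $\mathbf T_1$ is not basic, $U^L_{\alpha\beta}(\mathbf T_1,\mathbf T_2)$ consists of the pairs $(\mathbf T_1^*,\mathbf T_2)$ with $\mathbf T_1^*$ basic and $(\mathbf T_1,\mathbf T_2)\in U^L_{\beta\alpha}(\mathbf T_1^*,\mathbf T_2)$ (so $U^L_{\alpha\beta}$ is undefined if there are none). **Quasi-staircase operators.** For every $k\ge2$ consider two shapes, with positions $V$ (vertical, at the end of the two equal rows) and $H$ (horizontal, at the end of the row just above these two). Type $C$: - $\lambda_k=(2k+1,\dots,k+3,k+1,k+1,k-1,k-2,\dots,1)$, tiled by $k^2+k$ dominos; $V=\{S_{k,k+1},S_{k+1,k+1}\}$, $H=\{S_{k-1,k+2},S_{k-1,k+3}\}$. - $\mu_k=(2k+2,\dots,k+4,k+3,k+1,k+1,k-1,k-2,\dots,1)$, tiled by $(k+1)^2$ dominos; $V=\{S_{k+1,k+1},S_{k+2,k+1}\}$, $H=\{S_{k,k+2},S_{k,k+3}\}$. Type $B$: - $\lambda_k=(2k+1,\dots,k+3,k+2,k,k,k-2,k-3,\dots,1)$, tiled by $k^2+k$ dominos (besides the square $S_{1,1}$); $V=\{S_{k+1,k},S_{k+2,k}\}$,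 $H=\{S_{k,k+1},S_{k,k+2}\}$. - $\mu_k=(2k+2,\dots,k+5,k+4,k+2,k+2,k,k-1,\dots,1)$, tiled by $k^2+2k$ dominos (besides $S_{1,1}$); $V=\{S_{k,k+2},S_{k+1,k+2}\}$, $H=\{S_{k-1,k+3},S_{k-1,k+4}\}$. For every $k\ge2$ fix domino tableaux $\tilde{\mathbf T}_k,\tilde{\mathbf T}_k'$ of shapes $\lambda_k,\mu_k$ respectively, in which the largest domino is in position $V$ and the next largest in position $H$; let $\mathbf U_k,\mathbf U_k'$ be obtained from them by interchanging the two largest labels. $S_k$ (resp. $S_k'$) is defined on pairs $(\mathbf T_1,\mathbf T_2)$ of the same shape such that the dominos of $\mathbf T_1$ with labels at most $N$, where $N$ is the number of dominos tiling $\lambda_k$ (resp. $\mu_k$), form the tableau $\tilde{\mathbf T}_k$ or $\mathbf U_k$ (resp. $\tilde{\mathbf T}_k'$ or $\mathbf U_k'$); it interchanges the labels $N$ and $N-1$ in $\mathbf T_1$ and leaves everything else in $\mathbf T_1$ and $\mathbf T_2$ unchanged. ${}^tS_k$, ${}^tS_k'$ are the transposed operators: they send the transpose of a pair in the domain of $S_k$, $S_k'$ to the transpose of its image. **Compositions.** For a finite sequence $\Sigma$ of such operators (with $\alpha,\beta$ adjacent of equal length for $T_{\alpha\beta}$, and $\{\alpha,\beta\}=\{\alpha_1,\alpha_2\}$ for $U^L_{\alpha\beta}$), $T_\Sigma(\mathbf T_1,\mathbf T_2)$ is the set of all pairs obtained from $(\mathbf T_1,\mathbf T_2)$ by applying the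 operators of $\Sigma$ successively, at each step choosing one of the values of the (possibly multivalued) operator on a pair in its domain. *)

theory Defs
  imports Main "HOL-Library.Extended_Nat" "HOL-Combinatorics.Transposition"
begin

datatype cartan_type = TypeB | TypeC

text \<open>The pair \<open>(i, j)\<close> is the square in row \<open>i\<close> and column \<open>j\<close>. Integer coordinates
  are used because the conventions on labels also refer to squares outside the positive quadrant.
  A tableau is the partial map sending each square of its shape to its label; since each domino
  label is used for exactly one domino, the labelling determines the tiling.\<close>

type_synonym square = "int \<times> int"
type_synonym tableau = "square \<rightharpoonup> nat"

definition young_diagram :: "square set \<Rightarrow> bool" where
  "young_diagram A \<longleftrightarrow> finite A \<and> (\<forall>(i, j)\<in>A. 1 \<le> i \<and> 1 \<le> j) \<and>
     (\<forall>i j i' j'. (i, j) \<in> A \<longrightarrow> 1 \<le> i' \<longrightarrow> i' \<le> i \<longrightarrow> 1 \<le> j' \<longrightarrow> j' \<le> j \<longrightarrow> (i', j') \<in> A)"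

definition diagram_of_rows :: "nat list \<Rightarrow> square set" where
  "diagram_of_rows rs =
     {(i, j). 1 \<le> i \<and> i \<le> int (length rs) \<and> 1 \<le> j \<and> j \<le> int (rs ! nat (i - 1))}"

definition horizontal :: "square set \<Rightarrow> bool" where
  "horizontal d \<longleftrightarrow> (\<exists>i j. d = {(i, j), (i, j + 1)})"

definition vertical :: "square set \<Rightarrow> bool" where
  "vertical d \<longleftrightarrow> (\<exists>i j. d = {(i, j), (i + 1, j)})"

definition is_domino :: "square set \<Rightarrow> bool" where
  "is_domino d \<longleftrightarrow> horizontal d \<or> vertical d"

abbreviation shape :: "tableau \<Rightarrow> square set" where
  "shape T \<equiv> dom T"

definition domino :: "tableau \<Rightarrow> nat \<Rightarrow> square set" where
  "domino T k = {s. T s = Some k}"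

definition weakly_increasing :: "tableau \<Rightarrow> bool" where
  "weakly_increasing T \<longleftrightarrow>
     (\<forall>i j j' a b. T (i, j) = Some a \<longrightarrow> T (i, j') = Some b \<longrightarrow> j \<le> j' \<longrightarrow> a \<le> b) \<and>
     (\<forall>i i' j a b. T (i, j) = Some a \<longrightarrow> T (i', j) = Some b \<longrightarrow> i \<le> i' \<longrightarrow> a \<le> b)"

text \<open>That the shape has \<open>2n\<close> (type C) or \<open>2n + 1\<close> (type B) squares follows from
  the other conditions.\<close>

definition domino_tableau :: "cartan_type \<Rightarrow> nat \<Rightarrow> tableau \<Rightarrow> bool" where
  "domino_tableau X n T \<longleftrightarrow>
     young_diagram (shape T) \<and> weakly_increasing T \<and>
     (\<forall>k\<in>{1..n}. is_domino (domino T k)) \<and>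
     (case X of
        TypeC \<Rightarrow> ran T = {1..n}
      | TypeB \<Rightarrow> ran T = {0..n} \<and> domino T 0 = {(1, 1)})"

definition tableau_pairs :: "cartan_type \<Rightarrow> nat \<Rightarrow> (tableau \<times> tableau) set" where
  "tableau_pairs X n =
     {(T1, T2). domino_tableau X n T1 \<and> domino_tableau X n T2 \<and> shape T1 = shape T2}"

definition transpose_tableau :: "tableau \<Rightarrow> tableau" where
  "transpose_tableau T = T \<circ> prod.swap"

definition transpose_pair :: "tableau \<times> tableau \<Rightarrow> tableau \<times> tableau" where
  "transpose_pair p = map_prod transpose_tableau transpose_tableau p"

definition interchange :: "nat \<Rightarrow> nat \<Rightarrow> tableau \<Rightarrow> tableau" where
  "interchange a b T = map_option (Transposition.transpose a b) \<circ> T"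

definition lies_below :: "square set \<Rightarrow> square set \<Rightarrow> bool" where
  "lies_below d e \<longleftrightarrow> (\<forall>s\<in>d. \<forall>t\<in>e. fst t < fst s)"

text \<open>The simple root \<open>\<alpha>\<^sub>i\<close> is represented by its index \<open>i \<in> {1..n}\<close>.\<close>

definition tau :: "nat \<Rightarrow> tableau \<Rightarrow> nat set" where
  "tau n T = {i\<in>{1..n}. if i = 1 then vertical (domino T 1) else lies_below (domino T i) (domino T (i - 1))}"

definition rectangle_2x3_or_3x2 :: "square set \<Rightarrow> bool" where
  "rectangle_2x3_or_3x2 R \<longleftrightarrow>
     (\<exists>i j. R = {i..i + 1} \<times> {j..j + 2} \<or> R = {i..i + 2} \<times> {j..j + 1})"

definition three_dominos :: "tableau \<Rightarrow> nat \<Rightarrow> square set" where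
  "three_dominos T i = domino T (i - 1) \<union> domino T i \<union> domino T (i + 1)"

definition F_type_candidates ::
    "cartan_type \<Rightarrow> nat \<Rightarrow> nat \<Rightarrow> nat \<Rightarrow> nat \<Rightarrow> tableau \<Rightarrow> tableau set" where
  "F_type_candidates X n i a b T =
     {T'. domino_tableau X n T' \<and> a \<in> tau n T' \<and> b \<notin> tau n T' \<and>
          three_dominos T' i = three_dominos T i \<and> T' \<noteq> T \<and>
          (\<forall>s. s \<notin> three_dominos T i \<longrightarrow> T' s = T s)}"

definition interchange_candidates ::
    "cartan_type \<Rightarrow> nat \<Rightarrow> nat \<Rightarrow> nat \<Rightarrow> nat \<Rightarrow> tableau \<Rightarrow> tableau set" where
  "interchange_candidates X n i a b T =
     {T'. domino_tableau X n T' \<and> a \<in> tau n T' \<and> b \<notin> tau n T' \<and>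
          (T' = interchange (i - 1) i T \<or> T' = interchange i (i + 1) T)}"

text \<open>The set of values (at most one) of \<open>T\<^sub>\<alpha>\<^sub>\<beta>\<close> on a tableau, for
  \<open>\<alpha> = \<alpha>\<^sub>a\<close> and \<open>\<beta> = \<alpha>\<^sub>b\<close>. The equation with a singleton says
  that the value is the unique candidate.\<close>

definition T_op :: "cartan_type \<Rightarrow> nat \<Rightarrow> nat \<Rightarrow> nat \<Rightarrow> tableau \<Rightarrow> tableau set" where
  "T_op X n a b T =
     {T'. domino_tableau X n T \<and> b \<in> tau n T \<and> a \<notin> tau n T \<and>
        (\<exists>i. 2 \<le> i \<and> i + 1 \<le> n \<and> {a, b} = {i, i + 1} \<and>
           (if rectangle_2x3_or_3x2 (three_dominos T i)
            then F_type_candidates X n i a b T = {T'}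
            else interchange_candidates X n i a b T = {T'}))}"

definition label :: "tableau \<Rightarrow> square \<Rightarrow> enat" where
  "label T s = (if fst s \<le> 0 \<or> snd s \<le> 0 then 0
                else case T s of None \<Rightarrow> \<infinity> | Some k \<Rightarrow> enat k)"

definition fixed_square_of :: "square set \<Rightarrow> square" where
  "fixed_square_of d = (THE s. s \<in> d \<and> odd (fst s + snd s))"

definition moved_domino :: "tableau \<Rightarrow> nat \<Rightarrow> square set" where
  "moved_domino T k =
     (case fixed_square_of (domino T k) of (i, j) \<Rightarrow>
        if domino T k = {(i, j), (i + 1, j)} \<or> domino T k = {(i, j - 1), (i, j)}
        then (if enat k < label T (i - 1, j + 1) then {(i, j), (i - 1, j)} else {(i, j), (i, j + 1)})
        else (if enat k < label T (i + 1, j - 1) then {(i, j), (i, j - 1)} else {(i, j), (i + 1, j)}))"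

definition linked :: "nat \<Rightarrow> tableau \<Rightarrow> nat \<Rightarrow> nat \<Rightarrow> bool" where
  "linked n T k l \<longleftrightarrow> k \<in> {1..n} \<and> l \<in> {1..n} \<and> domino T k \<inter> moved_domino T l \<noteq> {}"

definition cycle_of :: "nat \<Rightarrow> tableau \<Rightarrow> nat \<Rightarrow> nat set" where
  "cycle_of n T k = {l. equivclp (linked n T) k l}"

definition move_through :: "tableau \<Rightarrow> nat set \<Rightarrow> tableau" where
  "move_through T c = (\<lambda>s.
     if \<exists>k\<in>c. s \<in> moved_domino T k then Some (THE k. k \<in> c \<and> s \<in> moved_domino T k)
     else if \<exists>k\<in>c. s \<in> domino T k then None
     else T s)"

text \<open>The second conjunct is relevant in type B only: the square labelled \<open>0\<close> must
  not be covered by a moved domino. In type C it reads \<open>{} = {}\<close>.\<close>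

definition closed_cycle :: "tableau \<Rightarrow> nat set \<Rightarrow> bool" where
  "closed_cycle T c \<longleftrightarrow>
     shape (move_through T c) = shape T \<and> domino (move_through T c) 0 = domino T 0"

definition basic :: "cartan_type \<Rightarrow> tableau \<Rightarrow> bool" where
  "basic X T = (case X of
     TypeC \<Rightarrow> domino T 1 \<union> domino T 2 = {(1, 1), (1, 2), (2, 1), (2, 2)}
   | TypeB \<Rightarrow> {domino T 1, domino T 2} = {{(1, 2), (1, 3)}, {(2, 1), (3, 1)}})"

text \<open>For basic tableaux, the squares covered by the dominos 1 and 2 together are stable under
  transposition, so that the remaining dominos are not affected.\<close>

definition transpose_12 :: "tableau \<Rightarrow> tableau" where
  "transpose_12 T = (\<lambda>s. if prod.swap s \<in> domino T 1 then Some 1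
                         else if prod.swap s \<in> domino T 2 then Some 2 else T s)"

definition U_on_basic ::
    "cartan_type \<Rightarrow> nat \<Rightarrow> nat \<Rightarrow> nat \<Rightarrow> tableau \<times> tableau \<Rightarrow> (tableau \<times> tableau) set" where
  "U_on_basic X n a b p =
     {(T', T2) | T1 T2 T'. p = (T1, T2) \<and> p \<in> tableau_pairs X n \<and> basic X T1 \<and>
        b \<in> tau n T1 \<and> a \<notin> tau n T1 \<and>
        (T' = transpose_12 T1 \<or>
         closed_cycle (transpose_12 T1) (cycle_of n (transpose_12 T1) 2) \<and>
         T' = move_through (transpose_12 T1) (cycle_of n (transpose_12 T1) 2))}"

definition U_op ::
    "cartan_type \<Rightarrow> nat \<Rightarrow> nat \<Rightarrow> nat \<Rightarrow> tableau \<times> tableau \<Rightarrow> (tableau \<times> tableau) set" where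
  "U_op X n a b p =
     (if p \<in> tableau_pairs X n \<and> 2 \<le> n \<and> {a, b} = {1, 2} \<and>
         b \<in> tau n (fst p) \<and> a \<notin> tau n (fst p)
      then if basic X (fst p) then U_on_basic X n a b p
           else {(T', snd p) | T'. basic X T' \<and> p \<in> U_on_basic X n b a (T', snd p)}
      else {})"

definition lambda_shape :: "cartan_type \<Rightarrow> nat \<Rightarrow> square set" where
  "lambda_shape X k = diagram_of_rows (case X of
     TypeC \<Rightarrow> rev [k + 3..<2 * k + 2] @ [k + 1, k + 1] @ rev [1..<k]
   | TypeB \<Rightarrow> rev [k + 2..<2 * k + 2] @ [k, k] @ rev [1..<k - 1])"

definition mu_shape :: "cartan_type \<Rightarrow> nat \<Rightarrow> square set" where
  "mu_shape X k = diagram_of_rows (case X of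
     TypeC \<Rightarrow> rev [k + 3..<2 * k + 3] @ [k + 1, k + 1] @ rev [1..<k]
   | TypeB \<Rightarrow> rev [k + 4..<2 * k + 3] @ [k + 2, k + 2] @ rev [1..<k + 1])"

definition lambda_size :: "nat \<Rightarrow> nat" where
  "lambda_size k = k ^ 2 + k"

definition mu_size :: "cartan_type \<Rightarrow> nat \<Rightarrow> nat" where
  "mu_size X k = (case X of TypeC \<Rightarrow> (k + 1) ^ 2 | TypeB \<Rightarrow> k ^ 2 + 2 * k)"

definition lambda_V :: "cartan_type \<Rightarrow> nat \<Rightarrow> square set" where
  "lambda_V X k = (let k = int k in case X of
     TypeC \<Rightarrow> {(k, k + 1), (k + 1, k + 1)}
   | TypeB \<Rightarrow> {(k + 1, k), (k + 2, k)})"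

definition lambda_H :: "cartan_type \<Rightarrow> nat \<Rightarrow> square set" where
  "lambda_H X k = (let k = int k in case X of
     TypeC \<Rightarrow> {(k - 1, k + 2), (k - 1, k + 3)}
   | TypeB \<Rightarrow> {(k, k + 1), (k, k + 2)})"

definition mu_V :: "cartan_type \<Rightarrow> nat \<Rightarrow> square set" where
  "mu_V X k = (let k = int k in case X of
     TypeC \<Rightarrow> {(k + 1, k + 1), (k + 2, k + 1)}
   | TypeB \<Rightarrow> {(k, k + 2), (k + 1, k + 2)})"

definition mu_H :: "cartan_type \<Rightarrow> nat \<Rightarrow> square set" where
  "mu_H X k = (let k = int k in case X of
     TypeC \<Rightarrow> {(k, k + 2), (k, k + 3)}
   | TypeB \<Rightarrow> {(k - 1, k + 3), (k - 1, k + 4)})"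

definition quasi_staircase_choice ::
    "cartan_type \<Rightarrow> (nat \<Rightarrow> tableau) \<Rightarrow> (nat \<Rightarrow> tableau) \<Rightarrow> bool" where
  "quasi_staircase_choice X Q Q' \<longleftrightarrow>
     (\<forall>k\<ge>2.
        domino_tableau X (lambda_size k) (Q k) \<and> shape (Q k) = lambda_shape X k \<and>
        domino (Q k) (lambda_size k) = lambda_V X k \<and> domino (Q k) (lambda_size k - 1) = lambda_H X k \<and>
        domino_tableau X (mu_size X k) (Q' k) \<and> shape (Q' k) = mu_shape X k \<and>
        domino (Q' k) (mu_size X k) = mu_V X k \<and> domino (Q' k) (mu_size X k - 1) = mu_H X k)"

definition restrict_labels :: "nat \<Rightarrow> tableau \<Rightarrow> tableau" where
  "restrict_labels N T = T |` {s. \<exists>l\<le>N. T s = Some l}"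

definition S_op ::
    "cartan_type \<Rightarrow> nat \<Rightarrow> nat \<Rightarrow> tableau \<Rightarrow> tableau \<times> tableau \<Rightarrow> (tableau \<times> tableau) set" where
  "S_op X n N Q p =
     (if p \<in> tableau_pairs X n \<and>
         restrict_labels N (fst p) \<in> {Q, interchange (N - 1) N Q}
      then {(interchange (N - 1) N (fst p), snd p)} else {})"

definition transposed_op ::
    "(tableau \<times> tableau \<Rightarrow> (tableau \<times> tableau) set) \<Rightarrow>
      tableau \<times> tableau \<Rightarrow> (tableau \<times> tableau) set" where
  "transposed_op F p = transpose_pair ` F (transpose_pair p)"

text \<open>The arguments of \<open>Op_T\<close> and \<open>Op_U\<close> are the indices of \<open>\<alpha>\<close> and
  \<open>\<beta>\<close>.\<close>

datatype operator =
    Op_T nat nat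
  | Op_U nat nat
  | Op_S nat
  | Op_S' nat
  | Op_tS nat
  | Op_tS' nat

fun admissible :: "nat \<Rightarrow> operator \<Rightarrow> bool" where
  "admissible n (Op_T a b) \<longleftrightarrow> (\<exists>i. 2 \<le> i \<and> i + 1 \<le> n \<and> {a, b} = {i, i + 1})"
| "admissible n (Op_U a b) \<longleftrightarrow> 2 \<le> n \<and> {a, b} = {1, 2}"
| "admissible n (Op_S k) \<longleftrightarrow> 2 \<le> k"
| "admissible n (Op_S' k) \<longleftrightarrow> 2 \<le> k"
| "admissible n (Op_tS k) \<longleftrightarrow> 2 \<le> k"
| "admissible n (Op_tS' k) \<longleftrightarrow> 2 \<le> k"

text \<open>The set of values of an operator on a pair; it is empty outside the domain.\<close>

fun apply_op ::
    "cartan_type \<Rightarrow> nat \<Rightarrow> (nat \<Rightarrow> tableau) \<Rightarrow> (nat \<Rightarrow> tableau) \<Rightarrow> operator \<Rightarrow>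
      tableau \<times> tableau \<Rightarrow> (tableau \<times> tableau) set" where
  "apply_op X n Q Q' (Op_T a b) p =
     (if p \<in> tableau_pairs X n then (\<lambda>T'. (T', snd p)) ` T_op X n a b (fst p) else {})"
| "apply_op X n Q Q' (Op_U a b) p = U_op X n a b p"
| "apply_op X n Q Q' (Op_S k) p = S_op X n (lambda_size k) (Q k) p"
| "apply_op X n Q Q' (Op_S' k) p = S_op X n (mu_size X k) (Q' k) p"
| "apply_op X n Q Q' (Op_tS k) p = transposed_op (S_op X n (lambda_size k) (Q k)) p"
| "apply_op X n Q Q' (Op_tS' k) p = transposed_op (S_op X n (mu_size X k) (Q' k)) p"

fun T_seq ::
    "cartan_type \<Rightarrow> nat \<Rightarrow> (nat \<Rightarrow> tableau) \<Rightarrow> (nat \<Rightarrow> tableau) \<Rightarrow> operator list \<Rightarrow>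
      tableau \<times> tableau \<Rightarrow> (tableau \<times> tableau) set" where
  "T_seq X n Q Q' [] p = {p}"
| "T_seq X n Q Q' (\<sigma> # \<Sigma>) p = (\<Union>q\<in>apply_op X n Q Q' \<sigma> p. T_seq X n Q Q' \<Sigma> q)"

end

theory Submission
  imports Defs
begin

text \<open>A Young diagram is encoded by its boundary, read from the lower left to the upper right as a
  word of east and north steps. A removable domino is an east step at some position \<open>s\<close> with a
  north step at \<open>s + 2\<close>, and removing it exchanges the two steps; \<open>s\<close> is the content of the domino
  up to a shift, and for \<open>i \<ge> 2\<close> the root \<open>\<alpha>\<^sub>i\<close> lies in the \<open>\<tau>\<close>-invariant exactly when the domino \<open>i\<close> has a smaller
  position than the domino \<open>i - 1\<close>.

  By induction on the rank, all tableaux of a given shape with the same position of the largest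
  domino are joined. It remains to join the possible positions \<open>s\<close> of the largest domino. Two
  positions with a removable position in between after their removal are joined by interchanging
  the two largest labels, which covers all pairs of the same parity; overlapping positions are
  joined by an \<open>F\<close>-type interchange unless their box touches further squares on both sides. If no two
  positions of different parity are joined in this way, then the boundary word is almost
  alternating, and the 2-core (which fixes the number of north steps of each parity) leaves only
  the quasi-staircases, where the operators \<open>S\<^sub>k\<close> apply by definition, and six shapes of rank at
  most 4, where one application of \<open>U\<^sup>L\<close> suffices.\<close>

section \<open>Young diagrams and their boundary words\<close>

text \<open>The boundary word is the 2-abacus of the shape: north steps are beads, the even and the
  odd positions are its two runners, and removing a domino pushes one bead back by one place on its
  runner. This is where parity enters. On one runner, an east step with a north step somewhere
  behind it forces an adjacent pair of this kind in between, and that pair supplies the third domino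
  which an interchange of the two largest labels needs. Between different runners nothing is forced,
  so the whole difficulty is to find a single bridge between the two parities; once there is one,
  all positions are connected. \<open>T_op\<close> looks at three consecutive labels, here the three
  largest, so it uses only the boundary. \<open>U_op\<close> starts from the labels 1 and 2 and
  reaches further labels only through a cycle, so it is used where 2 is itself the largest label or
  shares a box with it. The induction moves back and forth between arbitrary witnesses, hence every
  step is established in both directions. Operators must also act in the presence of larger dominos,
  so conditions on neighbouring squares have to survive every extension of the tableau.\<close>

text \<open>The diagram is extended by all squares outside the positive quadrant, so that every diagonal
  \<open>j - i = c\<close> meets it in the rows up to \<open>depth A c\<close>. The boundary passes from the diagonal \<open>t\<close> to the
  diagonal \<open>t + 1\<close> by a north step if the depth decreases and by an east step otherwise.\<close>

definition filled :: "square set \<Rightarrow> int \<Rightarrow> int \<Rightarrow> bool" where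
  "filled A i j \<longleftrightarrow> i \<le> 0 \<or> j \<le> 0 \<or> (i, j) \<in> A"

definition depth :: "square set \<Rightarrow> int \<Rightarrow> int" where
  "depth A c = Max (insert (max 0 (- c)) {i. (i, i + c) \<in> A})"

definition north :: "square set \<Rightarrow> int \<Rightarrow> bool" where
  "north A t \<longleftrightarrow> depth A (t + 1) < depth A t"

definition removable :: "square set \<Rightarrow> int \<Rightarrow> bool" where
  "removable A s \<longleftrightarrow> \<not> north A s \<and> north A (s + 2)"

text \<open>A removable domino at \<open>s\<close> covers the last squares of the diagonals
  \<open>s + 1\<close> and \<open>s + 2\<close>, the only ones whose depth drops when the steps at
  \<open>s\<close> and \<open>s + 2\<close> are exchanged. The untouched step at
  \<open>s + 1\<close> determines its orientation.\<close>

definition rim :: "square set \<Rightarrow> int \<Rightarrow> square set" where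
  "rim A s = {(depth A (s + 1), depth A (s + 1) + s + 1), (depth A (s + 2), depth A (s + 2) + s + 2)}"

lemma young_finite: "young_diagram A \<Longrightarrow> finite A"
  by (simp add: young_diagram_def)

lemma young_pos: "young_diagram A \<Longrightarrow> (i, j) \<in> A \<Longrightarrow> 1 \<le> i \<and> 1 \<le> j"
  unfolding young_diagram_def by fast

lemma young_down:
  "young_diagram A \<Longrightarrow> (i, j) \<in> A \<Longrightarrow> 1 \<le> i' \<Longrightarrow> i' \<le> i \<Longrightarrow> 1 \<le> j' \<Longrightarrow> j' \<le> j \<Longrightarrow> (i', j') \<in> A"
  unfolding young_diagram_def by meson

lemma filled_mono:
  assumes "young_diagram A" "filled A i j" "i' \<le> i" "j' \<le> j"
  shows "filled A i' j'"
  using assms young_down[OF assms(1), of i j i' j'] unfolding filled_def by linarith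

lemma finite_diagonal: "finite A \<Longrightarrow> finite {i. (i, i + c) \<in> (A :: square set)}"
  by (rule finite_subset[of _ "fst ` A"]) force+

lemma filled_iff_depth:
  assumes "young_diagram A"
  shows "filled A i (i + c) \<longleftrightarrow> i \<le> depth A c"
proof -
  let ?S = "insert (max 0 (- c)) {i. (i, i + c) \<in> A}"
  have fin: "finite ?S" using finite_diagonal[OF young_finite[OF assms]] by simp
  have mem: "depth A c \<in> ?S" unfolding depth_def by (rule Max_in[OF fin]) simp
  have ge: "x \<le> depth A c" if "x \<in> ?S" for x unfolding depth_def using Max_ge[OF fin that] .
  show ?thesis
  proof
    assume "filled A i (i + c)"
    then consider "i \<le> max 0 (- c)" | "(i, i + c) \<in> A" unfolding filled_def by fastforce
    then show "i \<le> depth A c"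
      using ge[of "max 0 (- c)"] ge[of i] by cases auto
  next
    assume le: "i \<le> depth A c"
    have "filled A (depth A c) (depth A c + c)"
      using mem unfolding filled_def by (auto simp: max_def split: if_splits)
    then show "filled A i (i + c)" using filled_mono[OF assms] le by simp
  qed
qed

lemma filled_iff: "young_diagram A \<Longrightarrow> filled A i j \<longleftrightarrow> i \<le> depth A (j - i)"
  using filled_iff_depth[of A i "j - i"] by simp

lemma mem_iff_depth:
  "young_diagram A \<Longrightarrow> (i, j) \<in> A \<longleftrightarrow> 1 \<le> i \<and> 1 \<le> j \<and> i \<le> depth A (j - i)"
  using filled_iff[of A i j] young_pos[of A i j] unfolding filled_def by auto

lemma depth_eqI:
  assumes "young_diagram A" "filled A d (d + c)" "\<not> filled A (d + 1) (d + 1 + c)"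
  shows "depth A c = d"
  using assms filled_iff_depth[OF assms(1)] by (metis add_diff_cancel_left' order.antisym zless_add1_eq not_less zle_add1_eq_le)

lemma depth_bounds: "young_diagram A \<Longrightarrow> 0 \<le> depth A c \<and> - c \<le> depth A c"
  using filled_iff_depth[of A 0 c] filled_iff_depth[of A "- c" c] by (simp add: filled_def)

lemma depth_step:
  assumes "young_diagram A"
  shows "depth A (c + 1) = depth A c \<or> depth A (c + 1) = depth A c - 1"
proof -
  let ?d = "depth A c"
  have "filled A ?d (?d + c)" using filled_iff_depth[OF assms] by simp
  then have "filled A (?d - 1) (?d - 1 + (c + 1))" using filled_mono[OF assms] by simp
  then have 1: "?d - 1 \<le> depth A (c + 1)" using filled_iff_depth[OF assms] by metis
  have "\<not> filled A (?d + 1) (?d + 1 + c)" using filled_iff_depth[OF assms, of "?d + 1" c] by simp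
  then have "\<not> filled A (?d + 1) (?d + 1 + (c + 1))"
    using filled_mono[OF assms, of "?d + 1" "?d + 1 + (c + 1)" "?d + 1" "?d + 1 + c"] by auto
  then have "depth A (c + 1) < ?d + 1" using filled_iff_depth[OF assms] by (metis not_le)
  with 1 show ?thesis by linarith
qed

lemma depth_Suc:
  "young_diagram A \<Longrightarrow> depth A (t + 1) = depth A t - (if north A t then 1 else 0)"
  using depth_step[of A t] unfolding north_def by auto

lemma depth_add_2:
  "young_diagram A \<Longrightarrow>
    depth A (s + 2) = depth A (s + 1) - (if north A (s + 1) then 1 else 0)"
  using depth_Suc[of A "s + 1"] by (simp add: add.assoc)

lemma profile_antimono:
  fixes D :: "int \<Rightarrow> int"
  assumes "\<And>c. D (c + 1) = D c \<or> D (c + 1) = D c - 1" and "a \<le> b"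
  shows "D b \<le> D a \<and> D a - (b - a) \<le> D b"
  using assms(2)
proof (induction b rule: int_ge_induct)
  case (step i)
  then show ?case using assms(1)[of i] by linarith
qed simp

lemma depth_antimono: "young_diagram A \<Longrightarrow> a \<le> b \<Longrightarrow> depth A b \<le> depth A a"
  using profile_antimono[of "depth A" a b, OF depth_step] by blast

text \<open>When one moves up and to the left from (i, j) to (i', j'), either the content j - i does
  not increase, and then the depth does not drop, or it increases by at most i - i', and then the
  depth drops by at most that much. This makes it possible to describe a diagram by prescribing its
  depths.\<close>

lemma young_of_profile:
  fixes D :: "int \<Rightarrow> int"
  assumes steps: "\<And>c. D (c + 1) = D c \<or> D (c + 1) = D c - 1"
    and fin: "finite {(i, j). 1 \<le> i \<and> 1 \<le> j \<and> i \<le> D (j - i)}"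
  shows "young_diagram {(i, j). 1 \<le> i \<and> 1 \<le> j \<and> i \<le> D (j - i)}"
proof -
  have "i' \<le> D (j' - i')" if "i \<le> D (j - i)" "i' \<le> i" "j' \<le> j" for i j i' j'
  proof (cases "j' - i' \<le> j - i")
    case True
    then show ?thesis using profile_antimono[of D, OF steps True] that by linarith
  next
    case False
    then have "j - i \<le> j' - i'" by simp
    from profile_antimono[of D, OF steps this] that show ?thesis by linarith
  qed
  then show ?thesis using fin unfolding young_diagram_def by fast
qed

lemma depth_of_profile:
  fixes D :: "int \<Rightarrow> int"
  assumes y: "young_diagram {(i, j). 1 \<le> i \<and> 1 \<le> j \<and> i \<le> D (j - i)}"
    and ge: "0 \<le> D c" "- c \<le> D c"
  shows "depth {(i, j). 1 \<le> i \<and> 1 \<le> j \<and> i \<le> D (j - i)} c = D c"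
  using ge by (intro depth_eqI[OF y]) (auto simp: filled_def)

lemma depth_eventually:
  assumes "young_diagram A"
  obtains M where "M > 0" "\<And>c. c \<ge> M \<Longrightarrow> depth A c = 0" "\<And>c. c \<le> - M \<Longrightarrow> depth A c = - c"
proof -
  let ?M = "Max (insert 1 ((\<lambda>s. fst s + snd s) ` A))"
  have fin: "finite (insert 1 ((\<lambda>s. fst s + snd s) ` A))" using young_finite[OF assms] by simp
  have bound: "i + j \<le> ?M" if "(i, j) \<in> A" for i j
    using Max_ge[OF fin, of "i + j"] that by force
  have pos: "?M \<ge> 1" using Max_ge[OF fin, of 1] by simp
  show ?thesis
  proof (rule that[of ?M])
    show "?M > 0" using pos by simp
    fix c
    show "depth A c = 0" if "c \<ge> ?M"
      using that pos bound[of 1 "1 + c"] by (intro depth_eqI[OF assms]) (auto simp: filled_def)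
    show "depth A c = - c" if "c \<le> - ?M"
      using that pos bound[of "1 - c" 1] by (intro depth_eqI[OF assms]) (auto simp: filled_def)
  qed
qed

lemma north_eventually:
  assumes "young_diagram A"
  obtains M where "M > 0" "\<And>t. t \<ge> M \<Longrightarrow> \<not> north A t" "\<And>t. t \<le> - M \<Longrightarrow> north A t"
proof -
  obtain M where M: "M > 0" "\<And>c. c \<ge> M \<Longrightarrow> depth A c = 0" "\<And>c. c \<le> - M \<Longrightarrow> depth A c = - c"
    using depth_eventually[OF assms] by blast
  show ?thesis
    using M by (intro that[of "M + 1"]) (auto simp: north_def)
qed

text \<open>Far to the right both depths are 0, and from there the steps recover them by descending
  induction on the diagonal.\<close>

lemma young_eqI:
  assumes A: "young_diagram A" and B: "young_diagram B" and eq: "\<And>t. north A t = north B t"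
  shows "A = B"
proof -
  obtain M where M: "\<And>c. c \<ge> M \<Longrightarrow> depth A c = 0" using depth_eventually[OF A] by metis
  obtain M' where M': "\<And>c. c \<ge> M' \<Longrightarrow> depth B c = 0" using depth_eventually[OF B] by metis
  have "depth A c = depth B c" for c
  proof (cases "c \<ge> max M M'")
    case True
    then show ?thesis using M M' by simp
  next
    case False
    then have "c \<le> max M M'" by linarith
    then show ?thesis
    proof (induction c rule: int_le_induct)
      case base
      then show ?case using M M' by simp
    next
      case (step i)
      then show ?case using depth_Suc[OF A, of "i - 1"] depth_Suc[OF B, of "i - 1"] eq by simp
    qed
  qed
  then show ?thesis using mem_iff_depth[OF A] mem_iff_depth[OF B] by (intro set_eqI) auto
qed

text \<open>A north step at \<open>t\<close> is the right end of a row \<open>i\<close> at column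
  \<open>i + t\<close>; rows below the diagram end at column 0. In this form the word can be read
  off from row lengths.\<close>

lemma north_iff:
  assumes "young_diagram A"
  shows "north A t \<longleftrightarrow> (\<exists>i. filled A i (i + t) \<and> \<not> filled A i (i + t + 1))"
proof -
  have "filled A i (i + t + 1) \<longleftrightarrow> i \<le> depth A (t + 1)" for i
    using filled_iff_depth[OF assms, of i "t + 1"] by (simp add: add.assoc)
  then show ?thesis unfolding north_def
    using filled_iff_depth[OF assms, of _ t] by (auto simp: not_le intro: exI[of _ "depth A t"])
qed

section \<open>Removable dominos and the effect of removing them\<close>

lemma removable_depth:
  assumes "young_diagram A" "removable A s"
  shows "depth A (s + 1) = depth A s" "depth A (s + 3) = depth A (s + 2) - 1"
  using depth_Suc[OF assms(1), of s] depth_Suc[OF assms(1), of "s + 2"] assms(2)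
  by (auto simp: removable_def add.assoc)

lemma rim_cases:
  assumes "young_diagram A"
  obtains d where "depth A (s + 1) = d" "depth A (s + 2) = d" "\<not> north A (s + 1)"
      "rim A s = {(d, d + s + 1), (d, d + s + 2)}"
  | d where "depth A (s + 1) = d" "depth A (s + 2) = d - 1" "north A (s + 1)"
      "rim A s = {(d, d + s + 1), (d - 1, d + s + 1)}"
  using depth_add_2[OF assms, of s] unfolding rim_def
  by (cases "north A (s + 1)") (auto simp: algebra_simps)

lemma horizontal_pair: "horizontal {(i, j), (i, j + 1)}"
  unfolding horizontal_def by blast

lemma vertical_pair: "vertical {(i, j), (i + 1, j)}"
  unfolding vertical_def by blast

lemma not_horizontal_pair: "\<not> horizontal {(i, j), (i + 1, j)}"
  unfolding horizontal_def by (auto simp: doubleton_eq_iff)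

lemma not_vertical_pair: "\<not> vertical {(i, j), (i, j + 1)}"
  unfolding vertical_def by (auto simp: doubleton_eq_iff)

lemma
  assumes "young_diagram A"
  shows horizontal_rim: "horizontal (rim A s) \<longleftrightarrow> \<not> north A (s + 1)"
    and vertical_rim: "vertical (rim A s) \<longleftrightarrow> north A (s + 1)"
proof -
  have "(horizontal (rim A s) \<longleftrightarrow> \<not> north A (s + 1)) \<and> (vertical (rim A s) \<longleftrightarrow> north A (s + 1))"
  proof (rule rim_cases[OF assms, of s])
    fix d assume *: "\<not> north A (s + 1)" "rim A s = {(d, d + s + 1), (d, d + s + 2)}"
    then have "rim A s = {(d, d + s + 1), (d, d + s + 1 + 1)}" by (simp add: add.assoc)
    then show ?thesis using * horizontal_pair not_vertical_pair by metis
  next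
    fix d assume *: "north A (s + 1)" "rim A s = {(d, d + s + 1), (d - 1, d + s + 1)}"
    then have "rim A s = {(d - 1, d + s + 1), (d - 1 + 1, d + s + 1)}" by auto
    then show ?thesis using * vertical_pair not_horizontal_pair by metis
  qed
  then show "horizontal (rim A s) \<longleftrightarrow> \<not> north A (s + 1)"
    and "vertical (rim A s) \<longleftrightarrow> north A (s + 1)" by simp_all
qed

lemma is_domino_rim: "young_diagram A \<Longrightarrow> is_domino (rim A s)"
  using horizontal_rim vertical_rim unfolding is_domino_def by blast

context
  fixes A s
  assumes young: "young_diagram A" and rem: "removable A s"
begin

lemma rim_bounds:
  "1 \<le> depth A (s + 1)" "1 \<le> depth A (s + 1) + s + 1"
  "1 \<le> depth A (s + 2)" "1 \<le> depth A (s + 2) + s + 2"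
  using removable_depth[OF young rem] depth_bounds[OF young, of s] depth_bounds[OF young, of "s + 3"]
    depth_add_2[OF young, of s] by (auto split: if_splits)

lemma rim_subset: "rim A s \<subseteq> A"
  using rim_bounds mem_iff_depth[OF young] unfolding rim_def by auto

text \<open>\<open>removable\<close> says that the depth is constant from \<open>s\<close> to
  \<open>s + 1\<close> and drops from \<open>s + 2\<close> to \<open>s + 3\<close>, so lowering it
  by one on the two diagonals in between yields a profile again.\<close>

lemma
  young_remove: "young_diagram (A - rim A s)" and
  depth_remove: "depth (A - rim A s) c = depth A c - (if c = s + 1 \<or> c = s + 2 then 1 else 0)"
proof -
  define D where "D c = depth A c - (if c = s + 1 \<or> c = s + 2 then 1 else 0)" for c
  have set: "A - rim A s = {(i, j). 1 \<le> i \<and> 1 \<le> j \<and> i \<le> D (j - i)}"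
    using mem_iff_depth[OF young] unfolding D_def rim_def by (auto split: if_splits)
  have s0: "depth A (s + 1 + 1) = depth A (s + 2)" "depth A (s + 2 + 1) = depth A (s + 3)"
    by (simp_all add: add.assoc)
  have steps: "D (c + 1) = D c \<or> D (c + 1) = D c - 1" for c
    using depth_step[OF young, of c] removable_depth[OF young rem] s0 unfolding D_def by auto
  have fin: "finite {(i, j). 1 \<le> i \<and> 1 \<le> j \<and> i \<le> D (j - i)}"
    unfolding set[symmetric] using young_finite[OF young] by simp
  show y: "young_diagram (A - rim A s)" unfolding set by (rule young_of_profile[OF steps fin])
  have "0 \<le> D c" "- c \<le> D c"
    using depth_bounds[OF young, of c] rim_bounds unfolding D_def by auto
  then show "depth (A - rim A s) c = depth A c - (if c = s + 1 \<or> c = s + 2 then 1 else 0)"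
    using depth_of_profile[of D c] y unfolding set by (simp add: D_def)
qed

lemma north_remove:
  "north (A - rim A s) t \<longleftrightarrow> (if t = s then True else if t = s + 2 then False else north A t)"
proof -
  have s0: "depth A (s + 1 + 1) = depth A (s + 2)" "depth A (s + 2 + 1) = depth A (s + 3)"
    by (simp_all add: add.assoc)
  show ?thesis
  proof (cases "t \<in> {s, s + 1, s + 2}")
    case True
    then show ?thesis
      using removable_depth[OF young rem] s0 unfolding north_def depth_remove by fastforce
  next
    case False
    then show ?thesis unfolding north_def depth_remove by auto
  qed
qed

end

text \<open>Converse of \<open>young_remove\<close>. Any square weakly below and to the right of the
  domino lies outside the diagram, which pins the depth on the four diagonals from \<open>s\<close>
  to \<open>s + 3\<close>.\<close>

lemma removable_domino:
  assumes A: "young_diagram A" and P: "is_domino P" "P \<subseteq> A" and AP: "young_diagram (A - P)"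
  obtains s where "removable A s" "P = rim A s"
proof -
  have out: "\<not> filled A i' j'" if "(i, j) \<in> P" "i \<le> i'" "j \<le> j'" "(i', j') \<notin> P" for i j i' j'
  proof
    assume "filled A i' j'"
    moreover have p: "1 \<le> i" "1 \<le> j" using that P young_pos[OF A] by blast+
    ultimately have "(i', j') \<in> A - P" using that unfolding filled_def by auto
    from young_down[OF AP this p(1) that(2) p(2) that(3)] that show False by simp
  qed
  have inA: "filled A i j" if "(i, j) \<in> P" for i j using that P unfolding filled_def by auto
  note eq = depth_eqI[OF A]
  from P(1) consider i j where "P = {(i, j), (i, j + 1)}" | i j where "P = {(i, j), (i + 1, j)}"
    unfolding is_domino_def horizontal_def vertical_def by blast
  then show ?thesis
  proof cases
    case 1
    \<comment> \<open>The diagonals j - i and j - i + 1 of the two squares have to be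
      \<open>s + 1\<close> and \<open>s + 2\<close>; in the vertical case they are j - i - 1 and j -
      i.\<close>
    let ?s = "j - i - 1"
    have d0: "depth A ?s = i"
      using filled_mono[OF A inA[of i j]] out[of i j "i + 1" j] 1 by (intro eq) auto
    have d1: "depth A (?s + 1) = i"
      using inA[of i j] out[of i j "i + 1" "j + 1"] 1 by (intro eq) (auto simp: ac_simps)
    have d2: "depth A (?s + 2) = i"
      using inA[of i "j + 1"] out[of i "j + 1" "i + 1" "j + 2"] 1 by (intro eq) (auto simp: algebra_simps)
    have d3: "depth A (?s + 3) < i"
      using out[of i "j + 1" i "j + 2"] filled_iff[OF A, of i "j + 2"] 1 by (simp add: algebra_simps)
    show ?thesis
      using d0 d1 d2 d3 1 by (intro that[of ?s]) (auto simp: removable_def north_def rim_def algebra_simps)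
  next
    case 2
    let ?s = "j - i - 2"
    have d0: "depth A ?s = i + 1"
      using filled_mono[OF A inA[of "i + 1" j]] out[of "i + 1" j "i + 2" j] 2 by (intro eq) (auto simp: algebra_simps)
    have d1: "depth A (?s + 1) = i + 1"
      using inA[of "i + 1" j] out[of "i + 1" j "i + 2" "j + 1"] 2 by (intro eq) (auto simp: algebra_simps)
    have d2: "depth A (?s + 2) = i"
      using inA[of i j] out[of "i + 1" j "i + 1" "j + 1"] 2 by (intro eq) (auto simp: algebra_simps)
    have d3: "depth A (?s + 3) < i"
      using out[of i j i "j + 1"] filled_iff[OF A, of i "j + 1"] 2 by (simp add: algebra_simps)
    show ?thesis
      using d0 d1 d2 d3 2 by (intro that[of ?s]) (auto simp: removable_def north_def rim_def algebra_simps)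
  qed
qed

lemma removable_remove:
  assumes "young_diagram A" "removable A s" "removable A t" "s \<noteq> t"
  shows "removable (A - rim A s) t"
  using assms north_remove[OF assms(1,2)] unfolding removable_def by auto

lemma rim_remove:
  assumes "young_diagram A" "removable A s" "t \<notin> {s - 1, s, s + 1}"
  shows "rim (A - rim A s) t = rim A t"
proof -
  have "depth (A - rim A s) (t + 1) = depth A (t + 1)" "depth (A - rim A s) (t + 2) = depth A (t + 2)"
    using assms(3) unfolding depth_remove[OF assms(1,2)] by auto
  then show ?thesis unfolding rim_def[of _ t] by simp
qed

text \<open>The two exchanges concern the pairs {s, s + 2} and {t, t + 2}, which are disjoint since
  a north step at \<open>s + 2\<close> cannot be the east step at \<open>t\<close>. The second rim
  is taken in the smaller diagram because the two rims of the original one may overlap.\<close>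

lemma remove_commute:
  assumes A: "young_diagram A" and s: "removable A s" and t: "removable A t" and st: "s \<noteq> t"
  shows "A - rim A s - rim (A - rim A s) t = A - rim A t - rim (A - rim A t) s"
proof (rule young_eqI)
  note As = young_remove[OF A s] and At = young_remove[OF A t]
  note st' = removable_remove[OF A s t st] and ts' = removable_remove[OF A t s st[symmetric]]
  show "young_diagram (A - rim A s - rim (A - rim A s) t)" by (rule young_remove[OF As st'])
  show "young_diagram (A - rim A t - rim (A - rim A t) s)" by (rule young_remove[OF At ts'])
  have "t \<noteq> s + 2" "s \<noteq> t + 2" using s t unfolding removable_def by auto
  then show "north (A - rim A s - rim (A - rim A s) t) x = north (A - rim A t - rim (A - rim A t) s) x" for x
    unfolding north_remove[OF As st'] north_remove[OF At ts'] north_remove[OF A s] north_remove[OF A t]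
    using st by auto
qed

text \<open>This translates \<tau>-invariants into positions. Depth decreases weakly along the
  diagonals. For \<open>s < r\<close> the comparison of rows becomes strict because removing the
  first domino lowered the depth at \<open>s + 2\<close>; for \<open>r < s\<close> the square of the
  second rim on the diagonal \<open>r + 1\<close> is at least as low as a square of the
  first.\<close>

lemma lies_below_rim:
  assumes A: "young_diagram A" and s: "removable A s" and r: "removable (A - rim A s) r"
  shows "lies_below (rim A s) (rim (A - rim A s) r) \<longleftrightarrow> s < r"
proof -
  let ?A = "A - rim A s"
  note y = young_remove[OF A s]
  note D = depth_remove[OF A s]
  note mono = depth_antimono[OF y]
  have "r \<noteq> s" using r north_remove[OF A s] unfolding removable_def by auto
  then consider "s < r" | "r < s" by linarith
  then show ?thesis
  proof cases
    case 1
    have "depth ?A (r + 2) \<le> depth ?A (r + 1)" "depth ?A (r + 1) \<le> depth ?A (s + 2)"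
      using 1 by (intro mono; simp)+
    moreover have "depth A (s + 2) \<le> depth A (s + 1)" by (intro depth_antimono[OF A]) simp
    ultimately have "lies_below (rim A s) (rim ?A r)"
      using D[of "s + 2"] unfolding lies_below_def rim_def by auto
    then show ?thesis using 1 by simp
  next
    case 2
    have "depth A s \<le> depth ?A (r + 1)" using mono[of "r + 1" s] D[of s] 2 by simp
    then have "depth A (s + 1) \<le> depth ?A (r + 1)" using removable_depth[OF A s] by simp
    then have "\<not> lies_below (rim A s) (rim ?A r)" unfolding lies_below_def rim_def by force
    then show ?thesis using 2 by simp
  qed
qed

lemma rim_disjoint:
  assumes "young_diagram A" "s + 3 \<le> t"
  shows "rim A s \<inter> rim A t = {}"
  using assms(2) unfolding rim_def by auto

section \<open>Tableaux, restriction and extension\<close>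

lemma tableau_young: "domino_tableau X n T \<Longrightarrow> young_diagram (shape T)"
  by (simp add: domino_tableau_def)

lemma tableau_mono:
  assumes T: "domino_tableau X n T" and a: "T (i, j) = Some a" and b: "T (i', j') = Some b"
    and le: "i \<le> i'" "j \<le> j'"
  shows "a \<le> b"
proof -
  have y: "young_diagram (shape T)" and w: "weakly_increasing T" using T by (auto simp: domino_tableau_def)
  have "(i, j) \<in> shape T" "(i', j') \<in> shape T" using a b by auto
  then have "(i, j') \<in> shape T" using young_down[OF y] young_pos[OF y] le by blast
  then obtain c where c: "T (i, j') = Some c" by auto
  from w have "a \<le> c" "c \<le> b" using a b c le unfolding weakly_increasing_def by blast+
  then show ?thesis by simp
qed

lemma weakly_increasingI:
  assumes "\<And>i j i' j' a b. T (i, j) = Some a \<Longrightarrow> T (i', j') = Some b \<Longrightarrow> i \<le> i' \<Longrightarrow> j \<le> j' \<Longrightarrow> a \<le> b"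
  shows "weakly_increasing T"
  unfolding weakly_increasing_def
  using assms[OF _ _ order_refl] assms[OF _ _ _ order_refl] by simp

lemma tableau_ran: "domino_tableau X n T \<Longrightarrow> ran T = (if X = TypeC then {1..n} else {0..n})"
  by (cases X) (auto simp: domino_tableau_def)

lemma tableau_label_le: "domino_tableau X n T \<Longrightarrow> T s = Some k \<Longrightarrow> k \<le> n"
  using tableau_ran[of X n T] ranI[of T s k] by (auto split: if_splits)

lemma tableau_domino: "domino_tableau X n T \<Longrightarrow> 1 \<le> k \<Longrightarrow> k \<le> n \<Longrightarrow> is_domino (domino T k)"
  by (simp add: domino_tableau_def)

lemma tableau_zero:
  "domino_tableau X n T \<Longrightarrow> domino T 0 = (case X of TypeC \<Rightarrow> {} | TypeB \<Rightarrow> {(1, 1)})"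
proof (cases X)
  case TypeC
  assume "domino_tableau X n T"
  then have "0 \<notin> ran T" using TypeC by (simp add: domino_tableau_def)
  then show ?thesis using TypeC by (auto simp: domino_def ran_def)
qed (simp add: domino_tableau_def)

lemma is_domino_nonempty: "is_domino P \<Longrightarrow> P \<noteq> {}"
  by (auto simp: is_domino_def horizontal_def vertical_def)

lemma shape_eq_Union:
  assumes "domino_tableau X n T"
  shows "shape T = (\<Union>k\<le>n. domino T k)"
  using tableau_label_le[OF assms] by (auto simp: domino_def)

lemma domino_subset: "domino T k \<subseteq> shape T"
  by (auto simp: domino_def)

lemma domino_disjoint: "k \<noteq> l \<Longrightarrow> domino T k \<inter> domino T l = {}"
  by (auto simp: domino_def)

lemma mem_domino: "s \<in> domino T k \<longleftrightarrow> T s = Some k"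
  by (simp add: domino_def)

lemma tableau_eqI: "(\<And>k. domino T k = domino T' k) \<Longrightarrow> T = T'"
proof (rule ext)
  fix s assume "\<And>k. domino T k = domino T' k"
  then have "T s = Some k \<longleftrightarrow> T' s = Some k" for k by (metis mem_domino)
  then show "T s = T' s" by (metis not_None_eq)
qed

lemma tableauI:
  assumes "young_diagram (shape T)" "weakly_increasing T"
    and "\<And>k. 1 \<le> k \<Longrightarrow> k \<le> n \<Longrightarrow> is_domino (domino T k)"
    and "\<And>s k. T s = Some k \<Longrightarrow> k \<le> n"
    and "domino T 0 = (case X of TypeC \<Rightarrow> {} | TypeB \<Rightarrow> {(1, 1)})"
  shows "domino_tableau X n T"
proof -
  have ran: "k \<in> ran T \<longleftrightarrow> domino T k \<noteq> {}" for k by (auto simp: ran_def domino_def)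
  have ran': "k \<in> ran T \<longleftrightarrow> k \<le> n \<and> (k = 0 \<longrightarrow> X = TypeB)" for k
  proof (cases "k = 0")
    case True
    then show ?thesis using assms(5) by (cases X) (auto simp: ran)
  next
    case False
    moreover have "domino T k \<noteq> {} \<Longrightarrow> k \<le> n" using assms(4) by (auto simp: domino_def)
    moreover have "k \<le> n \<Longrightarrow> domino T k \<noteq> {}" using False assms(3)[of k] is_domino_nonempty by simp
    ultimately show ?thesis unfolding ran by blast
  qed
  then show ?thesis using assms unfolding domino_tableau_def by (cases X) auto
qed

section \<open>Restriction to small labels and placing a further domino\<close>

lemma restrict_labels_apply:
  "restrict_labels m T s = (if \<exists>l\<le>m. T s = Some l then T s else None)"
  by (simp add: restrict_labels_def restrict_map_def)

lemma shape_restrict: "shape (restrict_labels m T) = {s. \<exists>l\<le>m. T s = Some l}"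
  by (auto simp: restrict_labels_apply split: if_splits)

lemma restrict_labels_eq_Some: "restrict_labels m T s = Some k \<longleftrightarrow> T s = Some k \<and> k \<le> m"
  by (auto simp: restrict_labels_apply)

lemma restrict_restrict: "m \<le> n \<Longrightarrow> restrict_labels m (restrict_labels n T) = restrict_labels m T"
  by (rule ext) (auto simp: restrict_labels_apply dest: le_trans)

lemma restrict_all: "domino_tableau X n T \<Longrightarrow> restrict_labels n T = T"
proof (rule ext)
  fix s assume "domino_tableau X n T"
  then show "restrict_labels n T s = T s"
    using tableau_label_le[of X n T s] by (cases "T s") (auto simp: restrict_labels_apply)
qed

lemma domino_restrict: "k \<le> m \<Longrightarrow> domino (restrict_labels m T) k = domino T k"
  by (auto simp: domino_def restrict_labels_eq_Some)

lemma restrict_tableau: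
  assumes T: "domino_tableau X n T" and m: "m \<le> n"
  shows "domino_tableau X m (restrict_labels m T)"
proof (rule tableauI)
  note y = tableau_young[OF T]
  show "young_diagram (shape (restrict_labels m T))"
    unfolding young_diagram_def
  proof (intro conjI ballI allI impI)
    have sub: "shape (restrict_labels m T) \<subseteq> shape T" by (auto simp: shape_restrict)
    then show "finite (shape (restrict_labels m T))" using young_finite[OF y] finite_subset by blast
    fix s assume "s \<in> shape (restrict_labels m T)"
    then show "case s of (i, j) \<Rightarrow> 1 \<le> i \<and> 1 \<le> j" using sub young_pos[OF y] by auto
  next
    fix i j i' j' assume s: "(i, j) \<in> shape (restrict_labels m T)" and le: "1 \<le> i'" "i' \<le> i" "1 \<le> j'" "j' \<le> j"
    then obtain l where l: "T (i, j) = Some l" "l \<le> m" by (auto simp: restrict_labels_eq_Some)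
    then have "(i', j') \<in> shape T" using young_down[OF y _ le] by blast
    then obtain l' where l': "T (i', j') = Some l'" by auto
    then have "l' \<le> l" using tableau_mono[OF T l' l(1)] le by simp
    then show "(i', j') \<in> shape (restrict_labels m T)" using l l' by (auto simp: shape_restrict)
  qed
  show "weakly_increasing (restrict_labels m T)"
    by (rule weakly_increasingI) (use tableau_mono[OF T] in \<open>auto simp: restrict_labels_eq_Some\<close>)
qed (use assms tableau_domino[OF T] tableau_zero[OF T] in \<open>auto simp: domino_restrict restrict_labels_eq_Some\<close>)

definition place :: "tableau \<Rightarrow> square set \<Rightarrow> nat \<Rightarrow> tableau" where
  "place B P k = (\<lambda>s. if s \<in> P then Some k else B s)"

lemma shape_place: "shape (place B P k) = shape B \<union> P"
  by (auto simp: place_def split: if_splits)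

lemma domino_place_new: "domino_tableau X n B \<Longrightarrow> n < k \<Longrightarrow> domino (place B P k) k = P"
  using tableau_label_le[of X n B] by (force simp: domino_def place_def)

lemma domino_place_old:
  "P \<inter> shape B = {} \<Longrightarrow> l \<noteq> k \<Longrightarrow> domino (place B P k) l = domino B l"
  by (auto simp: domino_def place_def)

lemma place_tableau:
  assumes B: "domino_tableau X n B" and P: "is_domino P" and dis: "P \<inter> shape B = {}"
    and y: "young_diagram (shape B \<union> P)"
  shows "domino_tableau X (Suc n) (place B P (Suc n))"
proof (rule tableauI)
  show "young_diagram (shape (place B P (Suc n)))" using y by (simp add: shape_place)
  have mono: "a \<le> b" if s: "place B P (Suc n) (i, j) = Some a" "place B P (Suc n) (i', j') = Some b"
    and le: "i \<le> i'" "j \<le> j'" for i j i' j' a b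
  proof (cases "(i', j') \<in> P")
    case True
    then show ?thesis using s tableau_label_le[OF B, of "(i, j)" a]
      by (auto simp: place_def split: if_splits)
  next
    case False
    then have b: "B (i', j') = Some b" using s by (simp add: place_def)
    moreover have "(i, j) \<in> shape B \<union> P" using s by (auto simp: place_def split: if_splits)
    then have "1 \<le> i \<and> 1 \<le> j" using young_pos[OF y] by blast
    ultimately have "(i, j) \<in> shape B" using young_down[OF tableau_young[OF B], of i' j' i j] le by blast
    then have "B (i, j) = Some a" using s dis by (auto simp: place_def split: if_splits)
    then show ?thesis using tableau_mono[OF B _ b le] by simp
  qed
  then show "weakly_increasing (place B P (Suc n))" by (rule weakly_increasingI)
  show "is_domino (domino (place B P (Suc n)) k)" if "1 \<le> k" "k \<le> Suc n" for k
  proof (cases "k = Suc n")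
    case True
    then show ?thesis using domino_place_new[OF B, of "Suc n" P] P by simp
  next
    case False
    then show ?thesis using that domino_place_old[OF dis] tableau_domino[OF B, of k] by simp
  qed
  show "k \<le> Suc n" if "place B P (Suc n) s = Some k" for s k
    using that tableau_label_le[OF B, of s k] by (auto simp: place_def split: if_splits)
  show "domino (place B P (Suc n)) 0 = (case X of TypeC \<Rightarrow> {} | TypeB \<Rightarrow> {(1, 1)})"
    using domino_place_old[OF dis, of 0 "Suc n"] tableau_zero[OF B] by simp
qed

lemma restrict_place:
  assumes B: "domino_tableau X n B" and dis: "P \<inter> shape B = {}"
  shows "restrict_labels n (place B P (Suc n)) = B"
proof (rule ext)
  fix s
  show "restrict_labels n (place B P (Suc n)) s = B s"
  proof (cases "s \<in> P")
    case True
    then have "B s = None" using dis by auto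
    then show ?thesis using True by (simp add: restrict_labels_apply place_def)
  next
    case False
    then show ?thesis using tableau_label_le[OF B, of s]
      by (cases "B s") (auto simp: restrict_labels_apply place_def)
  qed
qed

lemma shape_restrict_top:
  assumes T: "domino_tableau X (Suc n) T"
  shows "shape (restrict_labels n T) = shape T - domino T (Suc n)"
  using tableau_label_le[OF T] by (auto simp: shape_restrict mem_domino le_Suc_eq) force

lemma top_domino:
  assumes T: "domino_tableau X (Suc n) T"
  obtains s where "removable (shape T) s" "domino T (Suc n) = rim (shape T) s"
    "shape (restrict_labels n T) = shape T - rim (shape T) s"
proof -
  have "young_diagram (shape T - domino T (Suc n))"
    using tableau_young[OF restrict_tableau[OF T, of n]] shape_restrict_top[OF T] by simp
  then obtain s where "removable (shape T) s" "domino T (Suc n) = rim (shape T) s"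
    using removable_domino[OF tableau_young[OF T] tableau_domino[OF T, of "Suc n"] domino_subset] by auto
  then show ?thesis using that shape_restrict_top[OF T] by metis
qed

lemma shape_rank_0:
  assumes "domino_tableau X 0 T" shows "shape T = (case X of TypeC \<Rightarrow> {} | TypeB \<Rightarrow> {(1, 1)})"
  using shape_eq_Union[OF assms] tableau_zero[OF assms] by simp

lemma not_removable_rank_0:
  assumes T: "domino_tableau X 0 T" shows "\<not> removable (shape T) s"
proof
  assume s: "removable (shape T) s"
  have "rim (shape T) s \<subseteq> {(1, 1)}"
    using rim_subset[OF tableau_young[OF T] s] shape_rank_0[OF T] by (cases X) auto
  then show False unfolding rim_def by auto
qed

lemma place_rim:
  assumes A: "young_diagram A" and s: "removable A s"
    and B: "domino_tableau X n B" "shape B = A - rim A s"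
  shows "domino_tableau X (Suc n) (place B (rim A s) (Suc n))" "shape (place B (rim A s) (Suc n)) = A"
    "domino (place B (rim A s) (Suc n)) (Suc n) = rim A s"
    "restrict_labels n (place B (rim A s) (Suc n)) = B"
proof -
  have un: "shape B \<union> rim A s = A" and dis: "rim A s \<inter> shape B = {}"
    using B(2) rim_subset[OF A s] by auto
  show "domino_tableau X (Suc n) (place B (rim A s) (Suc n))"
    using place_tableau[OF B(1) is_domino_rim[OF A] dis] A un by simp
  show "shape (place B (rim A s) (Suc n)) = A" by (simp only: shape_place un)
  show "domino (place B (rim A s) (Suc n)) (Suc n) = rim A s" using domino_place_new[OF B(1)] by simp
  show "restrict_labels n (place B (rim A s) (Suc n)) = B" by (rule restrict_place[OF B(1) dis])
qed

text \<open>If the largest domino sits elsewhere, the removal of the two dominos commutes, even if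
  they overlap and fill a box together.\<close>

lemma remove_tileable:
  assumes "domino_tableau X n T" "removable (shape T) s"
  shows "\<exists>m B. n = Suc m \<and> domino_tableau X m B \<and> shape B = shape T - rim (shape T) s"
  using assms
proof (induction n arbitrary: T s)
  case 0
  then show ?case using not_removable_rank_0 by blast
next
  case (Suc n)
  let ?A = "shape T"
  note A = tableau_young[OF Suc.prems(1)]
  have B: "domino_tableau X n (restrict_labels n T)" using restrict_tableau[OF Suc.prems(1)] by simp
  obtain t where t: "removable ?A t" "shape (restrict_labels n T) = ?A - rim ?A t"
    using top_domino[OF Suc.prems(1)] by metis
  show ?case
  proof (cases "s = t")
    case True
    then show ?thesis using B t by blast
  next
    case False
    have s: "removable (?A - rim ?A t) s" and t': "removable (?A - rim ?A s) t"
      using removable_remove[OF A] t(1) Suc.prems(2) False by auto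
    obtain m C where C: "n = Suc m" "domino_tableau X m C" "shape C = ?A - rim ?A t - rim (?A - rim ?A t) s"
      using Suc.IH[OF B] s unfolding t(2) by blast
    have "shape C = ?A - rim ?A s - rim (?A - rim ?A s) t"
      using C(3) remove_commute[OF A Suc.prems(2) t(1) False] by simp
    from place_rim(1,2)[OF young_remove[OF A Suc.prems(2)] t' C(2) this] show ?thesis using C(1) by blast
  qed
qed

text \<open>\<open>T ++ B\<close> replaces the dominos of \<open>T\<close> with small labels by the tableau \<open>B\<close>.\<close>

context
  fixes X N T m B
  assumes T: "domino_tableau X N T" and m: "m \<le> N" and B: "domino_tableau X m B"
    and sh: "shape B = shape (restrict_labels m T)"
begin

lemma override_apply:
  "(T ++ B) s = Some k \<longleftrightarrow> (if k \<le> m then B s = Some k else T s = Some k)"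
proof (cases "s \<in> shape B")
  case True
  then obtain l where l: "B s = Some l" by auto
  then have "l \<le> m" using tableau_label_le[OF B] by blast
  moreover obtain l' where "T s = Some l'" "l' \<le> m" using True sh by (auto simp: shape_restrict)
  ultimately show ?thesis using l by auto
next
  case False
  then have "\<not> (\<exists>l\<le>m. T s = Some l)" using sh by (simp add: shape_restrict)
  then show ?thesis using False by (auto simp: map_add_def)
qed

lemma domino_override: "domino (T ++ B) k = (if k \<le> m then domino B k else domino T k)"
  by (auto simp: domino_def override_apply)

lemma shape_override: "shape (T ++ B) = shape T"
  using sh by (auto simp: shape_restrict)

lemma restrict_override: "restrict_labels m (T ++ B) = B"
proof (rule ext)
  fix s show "restrict_labels m (T ++ B) s = B s"
  proof (cases "B s")
    case None
    have "\<not> (\<exists>l\<le>m. (T ++ B) s = Some l)" using None by (auto simp: override_apply)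
    then have "restrict_labels m (T ++ B) s = None" unfolding restrict_labels_apply by (rule if_not_P)
    then show ?thesis using None by simp
  next
    case (Some l)
    then have "l \<le> m" using tableau_label_le[OF B] by blast
    then show ?thesis using Some by (simp add: restrict_labels_apply)
  qed
qed

lemma override_tableau: "domino_tableau X N (T ++ B)"
proof (rule tableauI)
  show "young_diagram (shape (T ++ B))" using tableau_young[OF T] by (simp only: shape_override)
  have mono: "a \<le> b" if s: "(T ++ B) (i, j) = Some a" "(T ++ B) (i', j') = Some b"
    and le: "i \<le> i'" "j \<le> j'" for i j i' j' a b
  proof -
    consider "a \<le> m" "b \<le> m" | "a \<le> m" "m < b" | "m < a" "m < b" | "m < a" "b \<le> m" by linarith
    then show ?thesis
    proof cases
      \<comment> \<open>The only case that mixes the two tableaux in the wrong order: a large label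
        of \<open>T\<close> up and to the left of a small one. As the shape of \<open>B\<close> is a
        Young diagram, it would contain the first square too, where \<open>T\<close> has a small
        label.\<close>
      case 4
      have t: "T (i, j) = Some a" and b: "B (i', j') = Some b"
        using s 4 override_apply by (meson not_le)+
      have "(i, j) \<in> shape T" using t by auto
      then have "1 \<le> i \<and> 1 \<le> j" using young_pos[OF tableau_young[OF T]] by blast
      then have "(i, j) \<in> shape B" using young_down[OF tableau_young[OF B], of i' j'] le b by blast
      then show ?thesis using t 4 sh by (auto simp: shape_restrict)
    qed (use tableau_mono[OF B] tableau_mono[OF T] s le in \<open>auto simp: override_apply simp del: map_add_Some_iff\<close>)
  qed
  then show "weakly_increasing (T ++ B)" by (rule weakly_increasingI)
  show "is_domino (domino (T ++ B) k)" if "1 \<le> k" "k \<le> N" for k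
    using that tableau_domino[OF B] tableau_domino[OF T] by (simp add: domino_override)
  show "k \<le> N" if "(T ++ B) s = Some k" for s k
    using that m tableau_label_le[OF T, of s k] by (simp add: override_apply split: if_splits)
  show "domino (T ++ B) 0 = (case X of TypeC \<Rightarrow> {} | TypeB \<Rightarrow> {(1, 1)})"
    using tableau_zero[OF B] by (simp add: domino_override)
qed

end

lemma override_restrict: "T ++ restrict_labels m T = T"
  by (rule ext) (auto simp: map_add_def restrict_labels_apply)

lemma tableau_eqI_le:
  assumes "domino_tableau X n T" "domino_tableau X n T'" and "\<And>k. k \<le> n \<Longrightarrow> domino T k = domino T' k"
  shows "T = T'"
proof (rule ext)
  fix s
  have "T s = Some k \<longleftrightarrow> T' s = Some k" for k
    using assms(3)[of k] tableau_label_le[OF assms(1), of s k] tableau_label_le[OF assms(2), of s k]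
    unfolding domino_def by blast
  then show "T s = T' s" by (metis not_None_eq)
qed

section \<open>Joining tableaux by interchanges of labels\<close>

lemma interchange_eq_Some:
  "interchange a b T s = Some k \<longleftrightarrow> T s = Some (Transposition.transpose a b k)"
  unfolding interchange_def by (cases "T s") (auto simp: transpose_eq_iff)

lemma domino_interchange: "domino (interchange a b T) k = domino T (Transposition.transpose a b k)"
  by (simp add: domino_def interchange_eq_Some)

lemma shape_interchange: "shape (interchange a b T) = shape T"
  by (auto simp: interchange_def)

lemma interchange_interchange [simp]: "interchange a b (interchange a b T) = T"
  by (rule ext) (simp add: interchange_def option.map_comp o_def option.map_ident)

text \<open>Monotonicity can fail only where a square labelled \<open>k\<close> lies up and to the
  left of one labelled \<open>k + 1\<close>. The hypothesis excludes this, since such a square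
  labelled \<open>k\<close> would have to survive the removal of its domino.\<close>

lemma interchange_tableau:
  assumes T: "domino_tableau X N T" and k: "1 \<le> k" "k + 1 \<le> N"
    and y: "young_diagram (shape (restrict_labels (k + 1) T) - domino T k)"
  shows "domino_tableau X N (interchange k (k + 1) T)"
proof (rule tableauI)
  show "young_diagram (shape (interchange k (k + 1) T))"
    using tableau_young[OF T] by (simp add: shape_interchange)
  show "weakly_increasing (interchange k (k + 1) T)"
  proof (rule weakly_increasingI)
    fix i j i' j' a b
    assume s: "interchange k (k + 1) T (i, j) = Some a" "interchange k (k + 1) T (i', j') = Some b"
      and le: "i \<le> i'" "j \<le> j'"
    let ?t = "Transposition.transpose k (k + 1)"
    have t: "T (i, j) = Some (?t a)" "T (i', j') = Some (?t b)"
      using s by (simp_all add: interchange_eq_Some)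
    then have "?t a \<le> ?t b" using tableau_mono[OF T _ _ le] by blast
    moreover have "\<not> (?t a = k \<and> ?t b = k + 1)"
    proof
      assume ab: "?t a = k \<and> ?t b = k + 1"
      then have "(i', j') \<in> shape (restrict_labels (k + 1) T) - domino T k"
        using t by (auto simp: shape_restrict mem_domino)
      moreover have "1 \<le> i \<and> 1 \<le> j" using young_pos[OF tableau_young[OF T]] t by blast
      ultimately have "(i, j) \<in> shape (restrict_labels (k + 1) T) - domino T k"
        using young_down[OF y] le by blast
      then show False using ab t by (simp add: mem_domino)
    qed
    ultimately show "a \<le> b" unfolding Transposition.transpose_def by (auto split: if_splits)
  qed
  show "is_domino (domino (interchange k (k + 1) T) l)" if "1 \<le> l" "l \<le> N" for l
    using that k tableau_domino[OF T] unfolding domino_interchange Transposition.transpose_def by auto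
  show "l \<le> N" if "interchange k (k + 1) T s = Some l" for s l
    using that k tableau_label_le[OF T, of s]
    by (auto simp: interchange_eq_Some Transposition.transpose_def split: if_splits)
  show "domino (interchange k (k + 1) T) 0 = (case X of TypeC \<Rightarrow> {} | TypeB \<Rightarrow> {(1, 1)})"
    using k tableau_zero[OF T] by (simp add: domino_interchange Transposition.transpose_def)
qed

text \<open>Operators interchange labels in the whole tableau, whereas \<open>joined\<close>
  exchanges its lower part; here the two descriptions are identified.\<close>

lemma interchange_override:
  assumes "restrict_labels n T = B" "a \<le> n" "b \<le> n"
  shows "interchange a b T = T ++ interchange a b B"
proof (rule ext)
  fix s
  show "interchange a b T s = (T ++ interchange a b B) s"
  proof (cases "T s")
    case None
    then show ?thesis using assms by (auto simp: interchange_def map_add_def restrict_labels_apply)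
  next
    case (Some l)
    show ?thesis
    proof (cases "l \<le> n")
      case True
      then have "B s = Some l" using assms(1) Some by (auto simp: restrict_labels_eq_Some)
      then show ?thesis using Some by (auto simp: interchange_def map_add_def)
    next
      case False
      then have "B s = None" using assms(1) Some by (auto simp: restrict_labels_apply)
      then show ?thesis using Some False assms(2,3)
        by (auto simp: interchange_def map_add_def Transposition.transpose_def)
    qed
  qed
qed

text \<open>The lower right square of the domino qualifies: a neighbour of it to the right or below
  inside the diagram would remain after the removal and force the square itself to remain.\<close>

lemma young_corner:
  assumes A: "young_diagram A" and P: "is_domino P" "P \<subseteq> A" and AP: "young_diagram (A - P)"
  obtains i j where "(i, j) \<in> P" "(i + 1, j) \<notin> A" "(i, j + 1) \<notin> A"
proof -
  have out: "(i', j') \<notin> A" if "(i, j) \<in> P" "i \<le> i'" "j \<le> j'" "(i', j') \<notin> P" for i j i' j'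
    using that young_down[OF AP, of i' j' i j] young_pos[OF A, of i j] P(2) by blast
  from P(1) consider i j where "P = {(i, j), (i, j + 1)}" | i j where "P = {(i, j), (i + 1, j)}"
    unfolding is_domino_def horizontal_def vertical_def by blast
  then show ?thesis
  proof cases
    case 1
    then show ?thesis using out[of i "j + 1" "i + 1" "j + 1"] out[of i "j + 1" i "j + 2"]
      by (intro that[of i "j + 1"]) (auto simp: add.assoc)
  next
    case 2
    then show ?thesis using out[of "i + 1" j "i + 2" j] out[of "i + 1" j "i + 1" "j + 1"]
      by (intro that[of "i + 1" j]) (auto simp: add.assoc)
  qed
qed

text \<open>A rectangle inside a Young diagram contains at most one of its corners.\<close>

lemma not_rectangle:
  assumes A: "young_diagram A" and s: "removable A s" and t: "removable A t"
    and dis: "rim A s \<inter> rim A t = {}" and sub: "R \<subseteq> A" "rim A s \<subseteq> R" "rim A t \<subseteq> R"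
  shows "\<not> rectangle_2x3_or_3x2 R"
proof
  assume "rectangle_2x3_or_3x2 R"
  then obtain a b c d :: int where R: "R = {a..b} \<times> {c..d}"
    unfolding rectangle_2x3_or_3x2_def by blast
  have corner: "(b, d) \<in> rim A u" if u: "removable A u" "rim A u \<subseteq> R" for u
  proof -
    obtain i j where "(i, j) \<in> rim A u" "(i + 1, j) \<notin> A" "(i, j + 1) \<notin> A"
      by (rule young_corner[OF A is_domino_rim[OF A] rim_subset[OF A u(1)] young_remove[OF A u(1)]])
    then have ij: "(i, j) \<in> rim A u" "(i + 1, j) \<notin> R" "(i, j + 1) \<notin> R" "(i, j) \<in> R"
      using u(2) sub(1) by auto
    then have "i = b" "j = d" unfolding R by simp_all
    then show ?thesis using ij(1) by simp
  qed
  show False using corner[OF s sub(2)] corner[OF t sub(3)] dis by blast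
qed

section \<open>Transposition of tableaux\<close>

lemma transpose_tableau_apply [simp]: "transpose_tableau T (i, j) = T (j, i)"
  by (simp add: transpose_tableau_def)

lemma transpose_transpose [simp]: "transpose_tableau (transpose_tableau T) = T"
  by (rule ext) (simp add: transpose_tableau_def)

lemma mem_swap_image: "(i, j) \<in> prod.swap ` A \<longleftrightarrow> (j, i) \<in> A"
  by force

lemma domino_transpose: "domino (transpose_tableau T) k = prod.swap ` domino T k"
  by (auto simp: mem_swap_image mem_domino)

lemma shape_transpose: "shape (transpose_tableau T) = prod.swap ` shape T"
  by (auto simp: mem_swap_image)

lemma restrict_transpose: "restrict_labels n (transpose_tableau T) = transpose_tableau (restrict_labels n T)"
  by (rule ext) (auto simp: restrict_labels_apply)

lemma interchange_transpose: "interchange a b (transpose_tableau T) = transpose_tableau (interchange a b T)"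
  by (rule ext) (simp add: interchange_def transpose_tableau_def)

lemma swap_swap_image: "prod.swap ` prod.swap ` A = A"
  by (simp add: image_comp)

lemma swap_dominoI: "horizontal d \<Longrightarrow> vertical (prod.swap ` d)" "vertical d \<Longrightarrow> horizontal (prod.swap ` d)"
  by (auto simp: horizontal_def[of d] vertical_def[of d] horizontal_pair vertical_pair)

lemma horizontal_swap: "horizontal (prod.swap ` d) \<longleftrightarrow> vertical d"
  using swap_dominoI(1)[of "prod.swap ` d"] swap_dominoI(2)[of d] by (auto simp only: swap_swap_image)

lemma vertical_swap: "vertical (prod.swap ` d) \<longleftrightarrow> horizontal d"
  using horizontal_swap[of "prod.swap ` d"] by (simp only: swap_swap_image)

lemma young_swap: "young_diagram A \<Longrightarrow> young_diagram (prod.swap ` A)"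
  unfolding young_diagram_def by (fastforce simp: mem_swap_image)

lemma transpose_tableau_tableau:
  assumes T: "domino_tableau X n T"
  shows "domino_tableau X n (transpose_tableau T)"
proof (rule tableauI)
  show "young_diagram (shape (transpose_tableau T))"
    using young_swap[OF tableau_young[OF T]] by (simp only: shape_transpose)
  show "weakly_increasing (transpose_tableau T)"
    by (rule weakly_increasingI) (use tableau_mono[OF T] in auto)
  show "is_domino (domino (transpose_tableau T) k)" if "1 \<le> k" "k \<le> n" for k
    using tableau_domino[OF T that] by (auto simp: is_domino_def domino_transpose horizontal_swap vertical_swap)
  show "k \<le> n" if "transpose_tableau T s = Some k" for s k
    using that tableau_label_le[OF T] by (cases s) auto
  show "domino (transpose_tableau T) 0 = (case X of TypeC \<Rightarrow> {} | TypeB \<Rightarrow> {(1, 1)})"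
    using tableau_zero[OF T] by (cases X) (simp_all add: domino_transpose)
qed

section \<open>Steps and the joining relation\<close>

locale operator_family =
  fixes X :: cartan_type and Q Q' :: "nat \<Rightarrow> tableau"
begin

text \<open>The right tableau is quantified inside, so that the operator is chosen from the left
  tableau alone and steps can be chained without mentioning the right one.\<close>

definition step :: "nat \<Rightarrow> tableau \<Rightarrow> tableau \<Rightarrow> bool" where
  "step N T T' \<longleftrightarrow> (\<exists>\<sigma>. admissible N \<sigma> \<and>
     (\<forall>T2. (T, T2) \<in> tableau_pairs X N \<longrightarrow> (T', T2) \<in> apply_op X N Q Q' \<sigma> (T, T2)))"

definition move :: "nat \<Rightarrow> tableau \<Rightarrow> tableau \<Rightarrow> bool" where
  "move N T T' \<longleftrightarrow> step N T T' \<and> domino_tableau X N T' \<and> shape T' = shape T"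

text \<open>Quantifying over all extensions \<open>T\<close> of \<open>B\<close> by dominos with larger labels makes
  the relation stable under adding dominos.\<close>

definition joined :: "nat \<Rightarrow> tableau \<Rightarrow> tableau \<Rightarrow> bool" where
  "joined n B B' \<longleftrightarrow> (\<forall>N\<ge>n. \<forall>T. domino_tableau X N T \<longrightarrow> restrict_labels n T = B \<longrightarrow>
     (move N)\<^sup>*\<^sup>* T (T ++ B'))"

text \<open>One pair of witnesses is enough: tableaux with the same largest domino are joined by
  induction on the rank, so a single bridge connects all tableaux with their largest domino in one
  of the two positions.\<close>

definition top_joined :: "nat \<Rightarrow> square set \<Rightarrow> int \<Rightarrow> int \<Rightarrow> bool" where
  "top_joined n A s t \<longleftrightarrow> (\<exists>B B'. domino_tableau X n B \<and> domino_tableau X n B' \<and>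
     shape B = A \<and> shape B' = A \<and> domino B n = rim A s \<and> domino B' n = rim A t \<and>
     joined n B B' \<and> joined n B' B)"

lemma top_joined_sym: "top_joined n A s t \<Longrightarrow> top_joined n A t s"
  unfolding top_joined_def by blast

lemma joined_refl: "joined n B B"
  using override_restrict unfolding joined_def by auto

lemma joined_trans:
  assumes B: "domino_tableau X n B" "domino_tableau X n B'" "shape B' = shape B" "shape B'' = shape B'"
    and j: "joined n B B'" "joined n B' B''"
  shows "joined n B B''"
  unfolding joined_def
proof (intro allI impI)
  fix N T assume *: "n \<le> N" "domino_tableau X N T" "restrict_labels n T = B"
  have sh: "shape B' = shape (restrict_labels n T)" using *(3) B(3) by simp
  have "(T ++ B') ++ B'' = T ++ B''"
  proof (rule ext)
    fix s
    have "s \<in> shape B' \<longleftrightarrow> s \<in> shape B''" using B(4) by simp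
    then show "((T ++ B') ++ B'') s = (T ++ B'') s" by (auto simp: map_add_def split: option.splits)
  qed
  moreover have "(move N)\<^sup>*\<^sup>* T (T ++ B')" using * j(1) unfolding joined_def by blast
  moreover have "(move N)\<^sup>*\<^sup>* (T ++ B') ((T ++ B') ++ B'')"
    using * j(2) override_tableau[OF *(2,1) B(2) sh] restrict_override[OF *(2,1) B(2) sh]
    unfolding joined_def by blast
  ultimately show "(move N)\<^sup>*\<^sup>* T (T ++ B'')" by simp
qed

text \<open>Only extensions of \<open>B\<close> have to be examined. An extension \<open>T\<close>
  of \<open>B'\<close> is the partner of the extension \<open>T ++ B\<close> of \<open>B\<close>,
  because overriding once more with \<open>B'\<close> gives back \<open>T\<close>.\<close>

lemma joined_both:
  assumes B: "domino_tableau X n B" "domino_tableau X n B'" "shape B' = shape B"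
    and st: "\<And>N T. n \<le> N \<Longrightarrow> domino_tableau X N T \<Longrightarrow> restrict_labels n T = B \<Longrightarrow>
      step N T (T ++ B') \<and> step N (T ++ B') T"
  shows "joined n B B'" "joined n B' B"
proof -
  show "joined n B B'" unfolding joined_def
  proof (intro allI impI)
    fix N T assume *: "n \<le> N" "domino_tableau X N T" "restrict_labels n T = B"
    have sh: "shape B' = shape (restrict_labels n T)" using *(3) B(3) by simp
    have "move N T (T ++ B')"
      unfolding move_def
      using st[OF *] override_tableau[OF *(2,1) B(2) sh] shape_override[OF *(2,1) B(2) sh] by blast
    then show "(move N)\<^sup>*\<^sup>* T (T ++ B')" by blast
  qed
  show "joined n B' B" unfolding joined_def
  proof (intro allI impI)
    fix N T assume *: "n \<le> N" "domino_tableau X N T" "restrict_labels n T = B'"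
    have sh: "shape B = shape (restrict_labels n T)" using *(3) B(3) by simp
    have "T ++ B ++ B' = T"
    proof (rule ext)
      fix s
      have "s \<in> shape B \<longleftrightarrow> s \<in> shape B'" using B(3) by simp
      moreover have "B' s \<noteq> None \<Longrightarrow> B' s = T s"
        using *(3) by (auto simp: restrict_labels_apply split: if_splits)
      ultimately show "(T ++ B ++ B') s = T s" by (auto simp: map_add_def split: option.splits)
    qed
    then have "move N T (T ++ B)"
      unfolding move_def
      using st[OF *(1) override_tableau[OF *(2,1) B(1) sh] restrict_override[OF *(2,1) B(1) sh]]
        override_tableau[OF *(2,1) B(1) sh] shape_override[OF *(2,1) B(1) sh] by auto
    then show "(move N)\<^sup>*\<^sup>* T (T ++ B)" by blast
  qed
qed

lemma step_T:
  assumes "2 \<le> i" "i + 1 \<le> N" "{a, b} = {i, i + 1}" "T_op X N a b T = {T'}"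
  shows "step N T T'"
  unfolding step_def using assms by (intro exI[of _ "Op_T a b"]) auto

lemma T_op_eq:
  assumes T: "domino_tableau X N T" "b \<in> tau N T" "a \<notin> tau N T"
    and i: "2 \<le> i" "i + 1 \<le> N" "{a, b} = {i, i + 1}"
  shows "T_op X N a b T = {T'. if rectangle_2x3_or_3x2 (three_dominos T i)
            then F_type_candidates X N i a b T = {T'} else interchange_candidates X N i a b T = {T'}}"
proof -
  have "j = i" if "{a, b} = {j, j + 1}" for j
    using that i(3) by (auto simp: doubleton_eq_iff)
  then show ?thesis using T i unfolding T_op_def by auto
qed

lemma tau_iff: "2 \<le> k \<Longrightarrow> k \<le> N \<Longrightarrow> k \<in> tau N T \<longleftrightarrow> lies_below (domino T k) (domino T (k - 1))"
  by (simp add: tau_def)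

lemma T_op_interchange:
  assumes "domino_tableau X N T" "b \<in> tau N T" "a \<notin> tau N T"
    and "2 \<le> i" "i + 1 \<le> N" "{a, b} = {i, i + 1}"
    and "\<not> rectangle_2x3_or_3x2 (three_dominos T i)" "interchange_candidates X N i a b T = {T'}"
  shows "step N T T'"
  using assms by (intro step_T[of i N a b]) (auto simp: T_op_eq[OF assms(1-6)])

lemma T_op_F_type:
  assumes "domino_tableau X N T" "b \<in> tau N T" "a \<notin> tau N T"
    and "2 \<le> i" "i + 1 \<le> N" "{a, b} = {i, i + 1}"
    and "rectangle_2x3_or_3x2 (three_dominos T i)" "F_type_candidates X N i a b T = {T'}"
  shows "step N T T'"
  using assms by (intro step_T[of i N a b]) (auto simp: T_op_eq[OF assms(1-6)])

text \<open>The domino \<open>R\<close> labelled \<open>i - 1\<close> acts like the middle letter in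
  a Knuth relation: \<open>P\<close> lies below it and \<open>P'\<close> does not. Interchanging
  \<open>i\<close> and \<open>i + 1\<close> therefore moves exactly one of the two roots into the
  \<tau>-invariant and the other one out of it.\<close>

lemma step_swap:
  assumes T: "domino_tableau X N T" and i: "2 \<le> i" "i + 1 \<le> N"
    and T': "T' = interchange i (i + 1) T" "domino_tableau X N T'"
    and D: "R = domino T (i - 1)" "P' = domino T i" "P = domino T (i + 1)"
    and below: "lies_below P P'" "\<not> lies_below P' R" "lies_below P R" "\<not> lies_below P' P"
    and rect: "\<not> rectangle_2x3_or_3x2 (R \<union> P' \<union> P)"
  shows "step N T T'" "step N T' T"
proof -
  have T2: "T = interchange i (i + 1) T'" by (simp add: T'(1))
  have D': "domino T' (i - 1) = R" "domino T' i = P" "domino T' (i + 1) = P'"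
    unfolding T'(1) domino_interchange D using i by (auto simp: Transposition.transpose_def)
  have three: "three_dominos T i = R \<union> P' \<union> P" "three_dominos T' i = R \<union> P' \<union> P"
    unfolding three_dominos_def using D D' by auto
  have tauT: "i + 1 \<in> tau N T" "i \<notin> tau N T"
    using i below D by (simp_all add: tau_iff)
  have tauT': "i + 1 \<notin> tau N T'" "i \<in> tau N T'"
    using i below D' by (simp_all add: tau_iff)
  have tr: "Transposition.transpose (i - 1) i i = i - 1" "Transposition.transpose (i - 1) i (i + 1) = i + 1"
    using i by (auto simp: Transposition.transpose_def)
  \<comment> \<open>The competing interchange of \<open>i - 1\<close> and \<open>i\<close> keeps
    \<open>P\<close> below the domino now labelled \<open>i\<close>, so it fails by its
    \<tau>-invariant; whether it yields a tableau need not be decided.\<close>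
  have "i + 1 \<in> tau N (interchange (i - 1) i T)"
    using i below D by (simp add: tau_iff domino_interchange tr[simplified])
  then have cand: "interchange_candidates X N i i (i + 1) T = {T'}"
    unfolding interchange_candidates_def using T' tauT' by auto
  have "i + 1 \<notin> tau N (interchange (i - 1) i T')"
    using i below D' by (simp add: tau_iff domino_interchange tr[simplified])
  then have cand': "interchange_candidates X N i (i + 1) i T' = {T}"
    unfolding interchange_candidates_def using T T2 tauT by auto
  show "step N T T'"
    using i rect cand by (intro T_op_interchange[OF T tauT]) (auto simp: three)
  show "step N T' T"
    using i rect cand' by (intro T_op_interchange[OF T'(2) tauT'(2,1)]) (auto simp: three)
qed

lemma step_S:
  assumes adm: "admissible N \<sigma>" and op: "apply_op X N Q Q' \<sigma> = S_op X N n Q0"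
    and T: "restrict_labels n T \<in> {Q0, interchange (n - 1) n Q0}"
  shows "step N T (interchange (n - 1) n T)"
  unfolding step_def using assms
  by (intro exI[of _ \<sigma>]) (auto simp: S_op_def)

lemma step_transposed_S:
  assumes adm: "admissible N \<sigma>" and op: "apply_op X N Q Q' \<sigma> = transposed_op (S_op X N n Q0)"
    and T: "restrict_labels n T \<in> {transpose_tableau Q0, interchange (n - 1) n (transpose_tableau Q0)}"
  shows "step N T (interchange (n - 1) n T)"
proof -
  let ?t = transpose_tableau
  have r: "restrict_labels n (?t T) \<in> {Q0, interchange (n - 1) n Q0}"
    using T by (auto simp: restrict_transpose interchange_transpose)
  have "(interchange (n - 1) n T, T2) \<in> transposed_op (S_op X N n Q0) (T, T2)"
    if "(T, T2) \<in> tableau_pairs X N" for T2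
  proof -
    have "(?t T, ?t T2) \<in> tableau_pairs X N"
      using that transpose_tableau_tableau unfolding tableau_pairs_def by (auto simp: shape_transpose)
    then have "S_op X N n Q0 (?t T, ?t T2) = {(interchange (n - 1) n (?t T), ?t T2)}"
      using r by (simp add: S_op_def)
    then show ?thesis by (simp add: transposed_op_def transpose_pair_def flip: interchange_transpose)
  qed
  then show ?thesis unfolding step_def using adm op by (intro exI[of _ \<sigma>]) auto
qed

text \<open>The position of the domino labelled \<open>n - 1\<close> is assumed to be removable
  already in the full shape, so the interchange leaves a tableau, with that domino on top.\<close>

lemma top_joined_S:
  assumes B: "domino_tableau X n B" "2 \<le> n" and s: "domino B n = rim (shape B) s"
    and t: "removable (shape B) t" "domino B (n - 1) = rim (shape B) t"
    and st: "\<And>N T. n \<le> N \<Longrightarrow> restrict_labels n T \<in> {B, interchange (n - 1) n B} \<Longrightarrow>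
      step N T (interchange (n - 1) n T)"
  shows "top_joined n (shape B) s t"
proof -
  let ?B = "interchange (n - 1) n B"
  have n: "1 \<le> n - 1" "n - 1 + 1 = n" using B(2) by auto
  have B': "domino_tableau X n ?B"
    using interchange_tableau[OF B(1) n(1)] n restrict_all[OF B(1)]
      young_remove[OF tableau_young[OF B(1)] t(1)] t(2) by simp
  have D: "domino ?B n = domino B (n - 1)" by (simp add: domino_interchange)
  have "step N T (T ++ ?B) \<and> step N (T ++ ?B) T"
    if N: "n \<le> N" "domino_tableau X N T" "restrict_labels n T = B" for N T
  proof -
    have sh: "shape ?B = shape (restrict_labels n T)" using N(3) by (simp add: shape_interchange)
    have eq: "interchange (n - 1) n T = T ++ ?B" using interchange_override[OF N(3)] by simp
    show ?thesis
      using st[OF N(1), of T] st[OF N(1), of "T ++ ?B"] N(3) restrict_override[OF N(2,1) B' sh]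
      unfolding eq[symmetric] by simp
  qed
  note j = joined_both[OF B(1) B' shape_interchange this]
  have "domino ?B n = rim (shape B) t" using D t(2) by simp
  then show ?thesis
    using j unfolding top_joined_def
    by (intro exI conjI) (rule B(1) B' refl shape_interchange s | assumption)+
qed

end

section \<open>Interchanges inside rectangles\<close>

lemma set_2x3: "{a..a + 1} \<times> {b..b + 2} =
    {(a, b), (a, b + 1), (a, b + 2), (a + 1, b), (a + 1, b + 1), (a + 1, b + (2 :: int))}" for a b :: int
proof -
  have "{a..a + 1} = {a, a + 1}" "{b..b + 2} = {b, b + 1, b + 2}" by auto
  then show ?thesis by auto
qed

lemma set_3x2: "{a..a + 2} \<times> {b..b + 1} =
    {(a, b), (a + 1, b), (a + 2, b), (a, b + 1), (a + 1, b + 1), (a + (2 :: int), b + 1)}" for a b :: int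
proof -
  have "{a..a + 2} = {a, a + 1, a + 2}" "{b..b + 1} = {b, b + 1}" by auto
  then show ?thesis by auto
qed

lemma is_domino_cases:
  assumes "is_domino d"
  obtains i j where "d = {(i, j), (i, j + 1)}" | i j where "d = {(i, j), (i + 1, j)}"
  using assms unfolding is_domino_def horizontal_def vertical_def by blast

lemma domino_containing:
  assumes "is_domino d" "(i, j) \<in> d"
  shows "d = {(i, j), (i, j + 1)} \<or> d = {(i, j), (i + 1, j)} \<or>
    d = {(i, j), (i, j - 1)} \<or> d = {(i, j), (i - 1, j)}"
  using assms(1)
proof (cases rule: is_domino_cases)
  case (1 x y)
  then consider "x = i" "y = j" | "x = i" "y = j - 1" using assms(2) by auto
  then show ?thesis by cases (use 1 in \<open>simp_all add: insert_commute\<close>)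
next
  case (2 x y)
  then consider "x = i" "y = j" | "x = i - 1" "y = j" using assms(2) by auto
  then show ?thesis by cases (use 2 in \<open>simp_all add: insert_commute\<close>)
qed

lemma is_domino_pair:
  assumes "is_domino {(i, j), (i', j')}"
  shows "\<bar>i - i'\<bar> + \<bar>j - j'\<bar> = 1"
  using assms
proof (cases rule: is_domino_cases)
  case (1 x y)
  then show ?thesis by (auto simp: doubleton_eq_iff)
next
  case (2 x y)
  then show ?thesis by (auto simp: doubleton_eq_iff)
qed

text \<open>The smallest label occupies the upper left corner and the largest one the lower right
  corner. Each of these two dominos has two possible directions, and the middle domino is what they
  leave over.\<close>

lemma rectangle_2x3_dominos:
  assumes T: "domino_tableau X N T" and i: "2 \<le> i" "i + 1 \<le> N"
    and R: "three_dominos T i = {a..a + 1} \<times> {b..b + 2}"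
  shows "domino T (i - 1) = {(a, b), (a, b + 1)} \<and> domino T i = {(a + 1, b), (a + 1, b + 1)} \<and>
      domino T (i + 1) = {(a, b + 2), (a + 1, b + 2)} \<or>
    domino T (i - 1) = {(a, b), (a + 1, b)} \<and> domino T i = {(a, b + 1), (a, b + 2)} \<and>
      domino T (i + 1) = {(a + 1, b + 1), (a + 1, b + 2)} \<or>
    domino T (i - 1) = {(a, b), (a + 1, b)} \<and> domino T i = {(a, b + 1), (a + 1, b + 1)} \<and>
      domino T (i + 1) = {(a, b + 2), (a + 1, b + 2)}"
proof -
  let ?D = "domino T"
  have R6: "?D (i - 1) \<union> ?D i \<union> ?D (i + 1) =
      {(a, b), (a, b + 1), (a, b + 2), (a + 1, b), (a + 1, b + 1), (a + 1, b + 2)}"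
    using R unfolding three_dominos_def set_2x3 .
  have dom: "is_domino (?D (i - 1))" "is_domino (?D i)" "is_domino (?D (i + 1))"
    using i by (intro tableau_domino[OF T]; simp)+
  have lab: "\<exists>k\<in>{i - 1, i, i + 1}. T s = Some k" if "s \<in> {a..a + 1} \<times> {b..b + 2}" for s
    using that unfolding R[symmetric] three_dominos_def by (auto simp: mem_domino)
  obtain x y where xy: "(x, y) \<in> ?D (i - 1)" using is_domino_nonempty[OF dom(1)] by auto
  then have xy': "(x, y) \<in> {a..a + 1} \<times> {b..b + 2}" using R unfolding three_dominos_def by blast
  obtain k where k: "k \<in> {i - 1, i, i + 1}" "T (a, b) = Some k" using lab[of "(a, b)"] by auto
  have "k \<le> i - 1" using tableau_mono[OF T k(2), of x y "i - 1"] xy xy' by (auto simp: mem_domino)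
  then have tl: "(a, b) \<in> ?D (i - 1)" using k i by (auto simp: mem_domino)
  obtain x y where xy: "(x, y) \<in> ?D (i + 1)" using is_domino_nonempty[OF dom(3)] by auto
  then have xy': "(x, y) \<in> {a..a + 1} \<times> {b..b + 2}" using R unfolding three_dominos_def by blast
  obtain k where k: "k \<in> {i - 1, i, i + 1}" "T (a + 1, b + 2) = Some k" using lab[of "(a + 1, b + 2)"] by auto
  have "i + 1 \<le> k" using tableau_mono[OF T _ k(2), of x y "i + 1"] xy xy' by (auto simp: mem_domino)
  then have br: "(a + 1, b + 2) \<in> ?D (i + 1)" using k i by (auto simp: mem_domino)
  have "?D (i - 1) \<subseteq> {a..a + 1} \<times> {b..b + 2}" "?D (i + 1) \<subseteq> {a..a + 1} \<times> {b..b + 2}"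
    using R unfolding three_dominos_def by blast+
  then have out: "(a, b - 1) \<notin> ?D (i - 1)" "(a - 1, b) \<notin> ?D (i - 1)"
    "(a + 1, b + 3) \<notin> ?D (i + 1)" "(a + 2, b + 2) \<notin> ?D (i + 1)"
    by fastforce+
  from domino_containing[OF dom(1) tl]
  have D1: "?D (i - 1) = {(a, b), (a, b + 1)} \<or> ?D (i - 1) = {(a, b), (a + 1, b)}"
    by (elim disjE) (use out(1,2) in simp_all)
  from domino_containing[OF dom(3) br]
  have D3: "?D (i + 1) = {(a + 1, b + 1), (a + 1, b + 2)} \<or> ?D (i + 1) = {(a, b + 2), (a + 1, b + 2)}"
    by (elim disjE) (use out(3,4) in \<open>simp_all add: insert_commute add.commute\<close>)
  have "i \<noteq> i - 1" "i \<noteq> i + 1" using i by auto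
  then have "?D i \<inter> ?D (i - 1) = {}" "?D i \<inter> ?D (i + 1) = {}"
    using domino_disjoint by metis+
  then have "?D i = (?D (i - 1) \<union> ?D i \<union> ?D (i + 1)) - ?D (i - 1) - ?D (i + 1)"
    by (simp add: Un_Diff Diff_triv) blast
  then have D2: "?D i = {(a, b), (a, b + 1), (a, b + 2), (a + 1, b), (a + 1, b + 1), (a + 1, b + 2)}
      - ?D (i - 1) - ?D (i + 1)" unfolding R6 .
  from D1 D3 show ?thesis
  proof (elim disjE)
    assume *: "?D (i - 1) = {(a, b), (a, b + 1)}" "?D (i + 1) = {(a + 1, b + 1), (a + 1, b + 2)}"
    \<comment> \<open>With both outer dominos horizontal, the two squares left over are not
      adjacent.\<close>
    have "?D i = {(a, b + 2), (a + 1, b)}" unfolding D2 * by auto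
    then show ?thesis using is_domino_pair[of a "b + 2" "a + 1" b] dom(2) by simp
  next
    assume *: "?D (i - 1) = {(a, b), (a, b + 1)}" "?D (i + 1) = {(a, b + 2), (a + 1, b + 2)}"
    have "?D i = {(a + 1, b), (a + 1, b + 1)}" unfolding D2 * by auto
    then show ?thesis using * by simp
  next
    assume *: "?D (i - 1) = {(a, b), (a + 1, b)}" "?D (i + 1) = {(a + 1, b + 1), (a + 1, b + 2)}"
    have "?D i = {(a, b + 1), (a, b + 2)}" unfolding D2 * by auto
    then show ?thesis using * by simp
  next
    assume *: "?D (i - 1) = {(a, b), (a + 1, b)}" "?D (i + 1) = {(a, b + 2), (a + 1, b + 2)}"
    have "?D i = {(a, b + 1), (a + 1, b + 1)}" unfolding D2 * by auto
    then show ?thesis using * by simp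
  qed
qed

lemma swap_image_eq_iff: "prod.swap ` A = B \<longleftrightarrow> A = prod.swap ` B"
  using swap_swap_image by metis

lemma rectangle_3x2_dominos:
  assumes T: "domino_tableau X N T" and i: "2 \<le> i" "i + 1 \<le> N"
    and R: "three_dominos T i = {a..a + 2} \<times> {b..b + 1}"
  shows "domino T (i - 1) = {(a, b), (a + 1, b)} \<and> domino T i = {(a, b + 1), (a + 1, b + 1)} \<and>
      domino T (i + 1) = {(a + 2, b), (a + 2, b + 1)} \<or>
    domino T (i - 1) = {(a, b), (a, b + 1)} \<and> domino T i = {(a + 1, b), (a + 2, b)} \<and>
      domino T (i + 1) = {(a + 1, b + 1), (a + 2, b + 1)} \<or>
    domino T (i - 1) = {(a, b), (a, b + 1)} \<and> domino T i = {(a + 1, b), (a + 1, b + 1)} \<and>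
      domino T (i + 1) = {(a + 2, b), (a + 2, b + 1)}"
proof -
  have "three_dominos (transpose_tableau T) i = prod.swap ` three_dominos T i"
    unfolding three_dominos_def domino_transpose by (simp add: image_Un)
  also have "\<dots> = {b..b + 1} \<times> {a..a + 2}" unfolding R product_swap ..
  finally show ?thesis
    using rectangle_2x3_dominos[OF transpose_tableau_tableau[OF T] i]
    unfolding domino_transpose swap_image_eq_iff by simp
qed

context operator_family
begin

text \<open>Apart from the two fillings that are exchanged, the box admits only the one with three
  parallel dominos. It has both or none of the two roots in its \<tau>-invariant, so it is never a
  candidate; \<open>uniq\<close> is the form of this fact common to both kinds of boxes.\<close>

lemma step_F_type:
  assumes T: "domino_tableau X N T" "domino_tableau X N T'" and i: "2 \<le> i" "i + 1 \<le> N"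
    and R: "three_dominos T i = R" "three_dominos T' i = R" "rectangle_2x3_or_3x2 R"
    and eq: "\<And>s. s \<notin> R \<Longrightarrow> T s = T' s"
    and tau: "i \<in> tau N T" "i + 1 \<notin> tau N T" "i \<notin> tau N T'" "i + 1 \<in> tau N T'"
    and uniq: "\<And>U. domino_tableau X N U \<Longrightarrow> three_dominos U i = R \<Longrightarrow>
      (\<forall>k\<in>{i - 1, i, i + 1}. domino U k = domino T k) \<or> (\<forall>k\<in>{i - 1, i, i + 1}. domino U k = domino T' k) \<or>
      (i \<in> tau N U \<longleftrightarrow> i + 1 \<in> tau N U)"
  shows "step N T T'" "step N T' T"
proof -
  have same: "U = S" if U: "three_dominos U i = R" "three_dominos S i = R" "\<forall>s. s \<notin> R \<longrightarrow> U s = S s"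
    "\<forall>k\<in>{i - 1, i, i + 1}. domino U k = domino S k" for U S
  proof (rule ext)
    fix s
    show "U s = S s"
    proof (cases "s \<in> R")
      case True
      then obtain k where k: "k \<in> {i - 1, i, i + 1}" "s \<in> domino U k"
        using U(1) unfolding three_dominos_def by auto
      then have "s \<in> domino S k" using U(4) by blast
      then show ?thesis using k(2) by (simp add: mem_domino)
    qed (use U(3) in blast)
  qed
  have ne: "T \<noteq> T'" using tau by auto
  have "F_type_candidates X N i (i + 1) i T = {T'}"
  proof (intro set_eqI iffI)
    fix U assume "U \<in> F_type_candidates X N i (i + 1) i T"
    then have U: "domino_tableau X N U" "i + 1 \<in> tau N U" "i \<notin> tau N U" "three_dominos U i = R"
      "U \<noteq> T" "\<forall>s. s \<notin> R \<longrightarrow> U s = T s" using R unfolding F_type_candidates_def by auto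
    then show "U \<in> {T'}" using uniq[OF U(1,4)] same[OF U(4) R(1)] same[OF U(4) R(2)] eq by auto
  qed (use T R tau eq ne in \<open>auto simp: F_type_candidates_def\<close>)
  then show "step N T T'"
    using i R by (intro T_op_F_type[OF T(1) tau(1,2)]) auto
  have "F_type_candidates X N i i (i + 1) T' = {T}"
  proof (intro set_eqI iffI)
    fix U assume "U \<in> F_type_candidates X N i i (i + 1) T'"
    then have U: "domino_tableau X N U" "i + 1 \<notin> tau N U" "i \<in> tau N U" "three_dominos U i = R"
      "U \<noteq> T'" "\<forall>s. s \<notin> R \<longrightarrow> U s = T' s" using R unfolding F_type_candidates_def by auto
    then show "U \<in> {T}" using uniq[OF U(1,4)] same[OF U(4) R(1)] same[OF U(4) R(2)] eq by auto
  qed (use T R tau eq ne in \<open>auto simp: F_type_candidates_def\<close>)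
  then show "step N T' T"
    using i R by (intro T_op_F_type[OF T(2) tau(4,3)]) auto
qed

lemma step_2x3:
  assumes T: "domino_tableau X N T" "domino_tableau X N T'" and i: "2 \<le> i" "i + 1 \<le> N"
    and D: "domino T (i - 1) = {(a, b), (a, b + 1)}" "domino T i = {(a + 1, b), (a + 1, b + 1)}"
      "domino T (i + 1) = {(a, b + 2), (a + 1, b + 2)}"
    and D': "domino T' (i - 1) = {(a, b), (a + 1, b)}" "domino T' i = {(a, b + 1), (a, b + 2)}"
      "domino T' (i + 1) = {(a + 1, b + 1), (a + 1, b + 2)}"
    and eq: "\<And>s. s \<notin> {a..a + 1} \<times> {b..b + 2} \<Longrightarrow> T s = T' s"
  shows "step N T T'" "step N T' T"
proof -
  have R: "three_dominos T i = {a..a + 1} \<times> {b..b + 2}" "three_dominos T' i = {a..a + 1} \<times> {b..b + 2}"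
    unfolding three_dominos_def D D' set_2x3 by auto
  have rect: "rectangle_2x3_or_3x2 ({a..a + 1} \<times> {b..b + 2})"
    unfolding rectangle_2x3_or_3x2_def by blast
  have tau: "i \<in> tau N T" "i + 1 \<notin> tau N T" "i \<notin> tau N T'" "i + 1 \<in> tau N T'"
    using i D D' by (simp_all add: tau_iff lies_below_def)
  have uniq: "(\<forall>k\<in>{i - 1, i, i + 1}. domino U k = domino T k) \<or> (\<forall>k\<in>{i - 1, i, i + 1}. domino U k = domino T' k) \<or>
      (i \<in> tau N U \<longleftrightarrow> i + 1 \<in> tau N U)"
    if U: "domino_tableau X N U" "three_dominos U i = {a..a + 1} \<times> {b..b + 2}" for U
    using rectangle_2x3_dominos[OF U(1) i U(2)]
  proof (elim disjE)
    assume *: "domino U (i - 1) = {(a, b), (a + 1, b)} \<and> domino U i = {(a, b + 1), (a + 1, b + 1)} \<and>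
      domino U (i + 1) = {(a, b + 2), (a + 1, b + 2)}"
    then have "i \<notin> tau N U" "i + 1 \<notin> tau N U" using i by (simp_all add: tau_iff lies_below_def)
    then show ?thesis by simp
  qed (use D D' in simp_all)
  show "step N T T'" "step N T' T" by (rule step_F_type[OF T i R rect eq tau uniq]; assumption)+
qed

lemma step_3x2:
  assumes T: "domino_tableau X N T" "domino_tableau X N T'" and i: "2 \<le> i" "i + 1 \<le> N"
    and D: "domino T (i - 1) = {(a, b), (a, b + 1)}" "domino T i = {(a + 1, b), (a + 2, b)}"
      "domino T (i + 1) = {(a + 1, b + 1), (a + 2, b + 1)}"
    and D': "domino T' (i - 1) = {(a, b), (a + 1, b)}" "domino T' i = {(a, b + 1), (a + 1, b + 1)}"
      "domino T' (i + 1) = {(a + 2, b), (a + 2, b + 1)}"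
    and eq: "\<And>s. s \<notin> {a..a + 2} \<times> {b..b + 1} \<Longrightarrow> T s = T' s"
  shows "step N T T'" "step N T' T"
proof -
  have R: "three_dominos T i = {a..a + 2} \<times> {b..b + 1}" "three_dominos T' i = {a..a + 2} \<times> {b..b + 1}"
    unfolding three_dominos_def D D' set_3x2 by auto
  have rect: "rectangle_2x3_or_3x2 ({a..a + 2} \<times> {b..b + 1})"
    unfolding rectangle_2x3_or_3x2_def by blast
  have tau: "i \<in> tau N T" "i + 1 \<notin> tau N T" "i \<notin> tau N T'" "i + 1 \<in> tau N T'"
    using i D D' by (simp_all add: tau_iff lies_below_def)
  have uniq: "(\<forall>k\<in>{i - 1, i, i + 1}. domino U k = domino T k) \<or> (\<forall>k\<in>{i - 1, i, i + 1}. domino U k = domino T' k) \<or>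
      (i \<in> tau N U \<longleftrightarrow> i + 1 \<in> tau N U)"
    if U: "domino_tableau X N U" "three_dominos U i = {a..a + 2} \<times> {b..b + 1}" for U
    using rectangle_3x2_dominos[OF U(1) i U(2)]
  proof (elim disjE)
    assume *: "domino U (i - 1) = {(a, b), (a, b + 1)} \<and> domino U i = {(a + 1, b), (a + 1, b + 1)} \<and>
      domino U (i + 1) = {(a + 2, b), (a + 2, b + 1)}"
    then have "i \<in> tau N U" "i + 1 \<in> tau N U" using i by (simp_all add: tau_iff lies_below_def)
    then show ?thesis by simp
  qed (use D D' in simp_all)
  show "step N T T'" "step N T' T" by (rule step_F_type[OF T i R rect eq tau uniq]; assumption)+
qed

end

section \<open>Three largest dominos over a common remainder\<close>

lemma place_chain:
  assumes A: "young_diagram A"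
    and P1: "removable A s1" "P1 = rim A s1"
    and P2: "removable (A - P1) s2" "P2 = rim (A - P1) s2"
    and P3: "removable (A - P1 - P2) s3" "P3 = rim (A - P1 - P2) s3"
    and C: "domino_tableau X m C" "shape C = A - P1 - P2 - P3"
  defines "B \<equiv> place (place (place C P3 (m + 1)) P2 (m + 2)) P1 (m + 3)"
  shows "domino_tableau X (m + 3) B" "shape B = A" "domino B (m + 1) = P3" "domino B (m + 2) = P2"
    "domino B (m + 3) = P1" "s \<notin> P1 \<union> P2 \<union> P3 \<Longrightarrow> B s = C s"
proof -
  have A1: "young_diagram (A - P1)" using young_remove[OF A P1(1)] P1(2) by simp
  have A2: "young_diagram (A - P1 - P2)" using young_remove[OF A1 P2(1)] P2(2) by simp
  define E where "E = place C P3 (m + 1)"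
  have E: "domino_tableau X (m + 1) E" "shape E = A - P1 - P2" "domino E (m + 1) = P3"
    using place_rim[OF A2 P3(1) C(1)] C(2) P3(2) by (simp_all add: E_def)
  define F where "F = place E P2 (m + 2)"
  have F: "domino_tableau X (m + 2) F" "shape F = A - P1" "domino F (m + 2) = P2" "restrict_labels (m + 1) F = E"
    using place_rim[OF A1 P2(1) E(1)] E(2) P2(2) by (simp_all add: F_def)
  have B: "B = place F P1 (m + 3)" by (simp add: B_def F_def E_def)
  have B': "domino_tableau X (m + 3) B" "shape B = A" "domino B (m + 3) = P1" "restrict_labels (m + 2) B = F"
    using place_rim[OF A P1(1) F(1)] F(2) P1(2) unfolding B by (simp_all add: numeral_3_eq_3)
  show "domino_tableau X (m + 3) B" "shape B = A" "domino B (m + 3) = P1" using B' by auto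
  show "domino B (m + 2) = P2" using domino_restrict[of "m + 2" "m + 2" B] B'(4) F(3) by simp
  show "domino B (m + 1) = P3"
    using domino_restrict[of "m + 1" "m + 2" B] domino_restrict[of "m + 1" "m + 1" F] B'(4) F(4) E(3) by simp
  show "B s = C s" if "s \<notin> P1 \<union> P2 \<union> P3"
    using that by (simp add: B_def place_def)
qed

lemma remove_tileable_chain:
  assumes T: "domino_tableau X n T" "shape T = A"
    and P1: "removable A s1" "P1 = rim A s1"
    and P2: "removable (A - P1) s2" "P2 = rim (A - P1) s2"
    and P3: "removable (A - P1 - P2) s3" "P3 = rim (A - P1 - P2) s3"
  obtains m C where "n = m + 3" "domino_tableau X m C" "shape C = A - P1 - P2 - P3"
proof -
  obtain m1 C1 where C1: "n = Suc m1" "domino_tableau X m1 C1" "shape C1 = A - P1"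
    using remove_tileable[OF T(1)] P1 unfolding T(2) by blast
  obtain m2 C2 where C2: "m1 = Suc m2" "domino_tableau X m2 C2" "shape C2 = A - P1 - P2"
    using remove_tileable[OF C1(2)] P2 unfolding C1(3) by blast
  obtain m C3 where C3: "m2 = Suc m" "domino_tableau X m C3" "shape C3 = A - P1 - P2 - P3"
    using remove_tileable[OF C2(2)] P3 unfolding C2(3) by blast
  show ?thesis using that[OF _ C3(2,3)] C1(1) C2(1) C3(1) by simp
qed

lemma alternation:
  fixes f :: "int \<Rightarrow> bool"
  assumes "\<not> f x" "f (x + 2 * int m)"
  shows "\<exists>i<m. \<not> f (x + 2 * int i) \<and> f (x + 2 * int i + 2)"
  using assms
proof (induction m)
  case (Suc m)
  show ?case
  proof (cases "f (x + 2 * int m)")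
    case True
    then show ?thesis using Suc less_Suc_eq by blast
  next
    case False
    moreover have "x + 2 * int (Suc m) = x + 2 * int m + 2" by simp
    ultimately show ?thesis using Suc.prems(2) by (metis lessI)
  qed
qed simp

context operator_family
begin

text \<open>Both triples of removals leave the same diagram, so one filling \<open>C\<close> of it
  extends to both tableaux, which then differ only inside the region of the triples. Such a
  \<open>C\<close> exists because removing dominos from a tileable shape keeps it tileable.\<close>

lemma top_joined_chain:
  assumes T: "domino_tableau X n T" "shape T = A"
    and P1: "removable A s1" "P1 = rim A s1"
    and P2: "removable (A - P1) s2" "P2 = rim (A - P1) s2"
    and P3: "removable (A - P1 - P2) s3" "P3 = rim (A - P1 - P2) s3"
    and R1: "removable A t1" "R1 = rim A t1"
    and R2: "removable (A - R1) t2" "R2 = rim (A - R1) t2"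
    and R3: "removable (A - R1 - R2) t3" "R3 = rim (A - R1 - R2) t3"
    and R: "P1 \<union> P2 \<union> P3 = R" "R1 \<union> R2 \<union> R3 = R"
    and st: "\<And>N U U' i. domino_tableau X N U \<Longrightarrow> domino_tableau X N U' \<Longrightarrow> 2 \<le> i \<Longrightarrow> i + 1 \<le> N \<Longrightarrow>
      domino U (i - 1) = P3 \<Longrightarrow> domino U i = P2 \<Longrightarrow> domino U (i + 1) = P1 \<Longrightarrow>
      domino U' (i - 1) = R3 \<Longrightarrow> domino U' i = R2 \<Longrightarrow> domino U' (i + 1) = R1 \<Longrightarrow>
      (\<And>s. s \<notin> R \<Longrightarrow> U s = U' s) \<Longrightarrow> step N U U' \<and> step N U' U"
  shows "top_joined n A s1 t1"
proof -
  note A = tableau_young[OF T(1), unfolded T(2)]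
  obtain m C where C: "n = m + 3" "domino_tableau X m C" "shape C = A - P1 - P2 - P3"
    using remove_tileable_chain[OF T P1 P2 P3] .
  have "A - P1 - P2 - P3 = A - R1 - R2 - R3" using R by auto
  then have C': "shape C = A - R1 - R2 - R3" using C(3) by simp
  define B where "B = place (place (place C P3 (m + 1)) P2 (m + 2)) P1 (m + 3)"
  define B' where "B' = place (place (place C R3 (m + 1)) R2 (m + 2)) R1 (m + 3)"
  note B = place_chain[OF A P1 P2 P3 C(2,3), folded B_def C(1)]
  note B' = place_chain[OF A R1 R2 R3 C(2) C', folded B'_def C(1)]
  have sh: "shape B' = shape B" by (simp only: B B')
  have "step N U (U ++ B') \<and> step N (U ++ B') U"
    if N: "n \<le> N" "domino_tableau X N U" "restrict_labels n U = B" for N U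
  proof -
    have sh': "shape B' = shape (restrict_labels n U)" using N(3) sh by simp
    have DU: "domino U k = domino B k" if "k \<le> n" for k using domino_restrict[OF that, of U] N(3) by simp
    have DU': "domino (U ++ B') k = domino B' k" if "k \<le> n" for k
      using domino_override[OF N(2,1) B'(1) sh'] that by simp
    have eq: "U s = (U ++ B') s" if "s \<notin> R" for s
    proof -
      have s: "B s = B' s" using B(6)[of s] B'(6)[of s] that R by simp
      show ?thesis
      proof (cases "B s")
        case None
        then show ?thesis using s by (simp add: map_add_def)
      next
        case (Some k)
        then have "U s = Some k" using N(3) by (auto simp: restrict_labels_eq_Some)
        moreover have "B' s = Some k" using s Some by metis
        ultimately show ?thesis by simp
      qed
    qed
    have "m + 2 - 1 = m + 1" "m + 2 + 1 = m + 3" by simp_all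
    then show ?thesis
      using N(1) C(1) DU[of "m + 1"] DU[of "m + 2"] DU[of "m + 3"] DU'[of "m + 1"] DU'[of "m + 2"] DU'[of "m + 3"]
        B(3-5) B'(3-5)
      by (intro st[OF N(2) override_tableau[OF N(2,1) B'(1) sh'], of "m + 2"] eq) (simp_all add: numeral_3_eq_3)
  qed
  note j = joined_both[OF B(1) B'(1) sh this]
  have "domino B n = rim A s1" "domino B' n = rim A t1" using B(5) B'(5) C(1) P1 R1 by simp_all
  then show ?thesis using j unfolding top_joined_def
    by (intro exI conjI) (rule B(1,2) B'(1,2) | assumption)+
qed

text \<open>From \<open>s - 1\<close> to \<open>s + 3\<close> the word reads east, east, east,
  north, north, so the corner is a box with two rows and three columns. Its two relevant fillings
  arise from the removal orders \<open>s + 1\<close>, \<open>s - 1\<close>, \<open>s\<close> and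
  \<open>s\<close>, \<open>s + 1\<close>, \<open>s - 1\<close>.\<close>

lemma top_joined_2x3:
  assumes T: "domino_tableau X n T" "shape T = A"
    and s: "removable A s" "removable A (s + 1)" "\<not> north A (s - 1)"
  shows "top_joined n A (s + 1) s"
proof -
  note A = tableau_young[OF T(1), unfolded T(2)]
  define d where "d = depth A (s + 1)"
  have w: "\<not> north A s" "\<not> north A (s + 1)" "north A (s + 2)" "north A (s + 3)"
    using s unfolding removable_def by (simp_all add: add.assoc)
  have D: "depth A s = d" "depth A (s + 1) = d" "depth A (s + 2) = d" "depth A (s + 3) = d - 1"
    using depth_Suc[OF A, of s] depth_Suc[OF A, of "s + 1"] depth_Suc[OF A, of "s + 2"] w
    by (simp_all add: add.assoc d_def)
  let ?P1 = "rim A (s + 1)" and ?R1 = "rim A s"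
  note A1 = young_remove[OF A s(2)] and A1' = young_remove[OF A s(1)]
  have P2: "removable (A - ?P1) (s - 1)"
    using w s(3) unfolding removable_def north_remove[OF A s(2)] by (simp add: add.assoc)
  have R2: "removable (A - ?R1) (s + 1)"
    using w s(3) unfolding removable_def north_remove[OF A s(1)] by (simp add: add.assoc)
  let ?P2 = "rim (A - ?P1) (s - 1)" and ?R2 = "rim (A - ?R1) (s + 1)"
  have P3: "removable (A - ?P1 - ?P2) s"
    using w s(3) unfolding removable_def north_remove[OF A1 P2] north_remove[OF A s(2)] by (simp add: add.assoc)
  have R3: "removable (A - ?R1 - ?R2) (s - 1)"
    using w s(3) unfolding removable_def north_remove[OF A1' R2] north_remove[OF A s(1)] by (simp add: add.assoc)
  let ?P3 = "rim (A - ?P1 - ?P2) s" and ?R3 = "rim (A - ?R1 - ?R2) (s - 1)"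
  \<comment> \<open>\<open>(a, b)\<close> is the upper left square of the box: its bottom row is
    \<open>d\<close>, and its lower left square lies on the diagonal \<open>s\<close>.\<close>
  define a where "a = d - 1"
  define b where "b = d + s"
  have P1s: "?P1 = {(a, b + 2), (a + 1, b + 2)}"
    unfolding rim_def using D by (auto simp: a_def b_def algebra_simps)
  have P2s: "?P2 = {(a + 1, b), (a + 1, b + 1)}"
    unfolding rim_def[of _ "s - 1"] depth_remove[OF A s(2)] using D by (auto simp: a_def b_def algebra_simps)
  have P3s: "?P3 = {(a, b), (a, b + 1)}"
    unfolding rim_def[of _ s] depth_remove[OF A1 P2] depth_remove[OF A s(2)]
    using D by (auto simp: a_def b_def algebra_simps)
  have R1s: "?R1 = {(a + 1, b + 1), (a + 1, b + 2)}"
    unfolding rim_def using D by (auto simp: a_def b_def algebra_simps)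
  have R2s: "?R2 = {(a, b + 1), (a, b + 2)}"
    unfolding rim_def[of _ "s + 1"] depth_remove[OF A s(1)] using D by (auto simp: a_def b_def algebra_simps)
  have R3s: "?R3 = {(a, b), (a + 1, b)}"
    unfolding rim_def[of _ "s - 1"] depth_remove[OF A1' R2] depth_remove[OF A s(1)]
    using D by (auto simp: a_def b_def algebra_simps)
  show ?thesis
  proof (rule top_joined_chain[OF T s(2) refl P2 refl P3 refl s(1) refl R2 refl R3 refl])
    show "?P1 \<union> ?P2 \<union> ?P3 = {a..a + 1} \<times> {b..b + 2}" unfolding P3s unfolding P2s unfolding P1s set_2x3 by auto
    show "?R1 \<union> ?R2 \<union> ?R3 = {a..a + 1} \<times> {b..b + 2}" unfolding R3s unfolding R2s unfolding R1s set_2x3 by auto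
  qed (unfold P3s R3s, unfold P2s R2s, unfold P1s R1s, intro conjI step_2x3; assumption)
qed

text \<open>Here the word reads east, east, north, north, north from \<open>s\<close> to
  \<open>s + 4\<close>, and the removal orders are \<open>s + 1\<close>, \<open>s\<close>,
  \<open>s + 2\<close> and \<open>s\<close>, \<open>s + 2\<close>, \<open>s + 1\<close>.\<close>

lemma top_joined_3x2:
  assumes T: "domino_tableau X n T" "shape T = A"
    and s: "removable A s" "removable A (s + 1)" "north A (s + 4)"
  shows "top_joined n A (s + 1) s"
proof -
  note A = tableau_young[OF T(1), unfolded T(2)]
  define d where "d = depth A (s + 1)"
  have w: "\<not> north A s" "\<not> north A (s + 1)" "north A (s + 2)" "north A (s + 3)"
    using s unfolding removable_def by (simp_all add: add.assoc)
  have D: "depth A (s + 1) = d" "depth A (s + 2) = d" "depth A (s + 3) = d - 1" "depth A (s + 4) = d - 2"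
    using depth_Suc[OF A, of "s + 1"] depth_Suc[OF A, of "s + 2"] depth_Suc[OF A, of "s + 3"] w
    by (simp_all add: add.assoc d_def)
  let ?P1 = "rim A (s + 1)" and ?R1 = "rim A s"
  note A1 = young_remove[OF A s(2)] and A1' = young_remove[OF A s(1)]
  have P2: "removable (A - ?P1) s"
    using w s(3) unfolding removable_def north_remove[OF A s(2)] by (simp add: add.assoc)
  have R2: "removable (A - ?R1) (s + 2)"
    using w s(3) unfolding removable_def north_remove[OF A s(1)] by (simp add: add.assoc)
  let ?P2 = "rim (A - ?P1) s" and ?R2 = "rim (A - ?R1) (s + 2)"
  have P3: "removable (A - ?P1 - ?P2) (s + 2)"
    using w s(3) unfolding removable_def north_remove[OF A1 P2] north_remove[OF A s(2)] by (simp add: add.assoc)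
  have R3: "removable (A - ?R1 - ?R2) (s + 1)"
    using w s(3) unfolding removable_def north_remove[OF A1' R2] north_remove[OF A s(1)] by (simp add: add.assoc)
  let ?P3 = "rim (A - ?P1 - ?P2) (s + 2)" and ?R3 = "rim (A - ?R1 - ?R2) (s + 1)"
  define a where "a = d - 2"
  define b where "b = d + s + 1"
  have P1s: "?P1 = {(a + 1, b + 1), (a + 2, b + 1)}"
    unfolding rim_def using D by (auto simp: a_def b_def algebra_simps)
  have P2s: "?P2 = {(a + 1, b), (a + 2, b)}"
    unfolding rim_def[of _ s] depth_remove[OF A s(2)] using D by (auto simp: a_def b_def algebra_simps)
  have P3s: "?P3 = {(a, b), (a, b + 1)}"
    unfolding rim_def[of _ "s + 2"] depth_remove[OF A1 P2] depth_remove[OF A s(2)]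
    using D by (auto simp: a_def b_def algebra_simps)
  have R1s: "?R1 = {(a + 2, b), (a + 2, b + 1)}"
    unfolding rim_def using D by (auto simp: a_def b_def algebra_simps)
  have R2s: "?R2 = {(a, b + 1), (a + 1, b + 1)}"
    unfolding rim_def[of _ "s + 2"] depth_remove[OF A s(1)] using D by (auto simp: a_def b_def algebra_simps)
  have R3s: "?R3 = {(a, b), (a + 1, b)}"
    unfolding rim_def[of _ "s + 1"] depth_remove[OF A1' R2] depth_remove[OF A s(1)]
    using D by (auto simp: a_def b_def algebra_simps)
  show ?thesis
  proof (rule top_joined_chain[OF T s(2) refl P2 refl P3 refl s(1) refl R2 refl R3 refl])
    show "?P1 \<union> ?P2 \<union> ?P3 = {a..a + 2} \<times> {b..b + 1}" unfolding P3s unfolding P2s unfolding P1s set_3x2 by auto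
    show "?R1 \<union> ?R2 \<union> ?R3 = {a..a + 2} \<times> {b..b + 1}" unfolding R3s unfolding R2s unfolding R1s set_3x2 by auto
  qed (unfold P3s R3s, unfold P2s R2s, unfold P1s R1s, intro conjI step_3x2; assumption)
qed

text \<open>The dominos at \<open>s\<close> and \<open>t\<close> carry the two largest labels and
  the one at \<open>r\<close> the next. Since \<open>r\<close> lies strictly between them, it plays
  the role of \<open>R\<close> in \<open>step_swap\<close>.\<close>

lemma top_joined_swap:
  assumes T: "domino_tableau X n T" "shape T = A"
    and s: "removable A s" and t: "removable A t" and st: "s + 3 \<le> t"
    and r: "s < r" "r < t" "removable (A - rim A s - rim A t) r"
  shows "top_joined n A s t"
proof -
  note y = tableau_young[OF T(1), unfolded T(2)]
  let ?S = "rim A s" and ?T = "rim A t"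
  let ?A = "A - ?S - ?T"
  let ?R = "rim ?A r"
  have rims: "rim (A - ?S) t = ?T" "rim (A - ?T) s = ?S"
    using rim_remove[OF y s, of t] rim_remove[OF y t, of s] st by simp_all
  have ts: "removable (A - ?S) t" "removable (A - ?T) s"
    using removable_remove[OF y s t] removable_remove[OF y t s] st by simp_all
  have yS: "young_diagram (A - ?S)" and yT: "young_diagram (A - ?T)" using young_remove[OF y] s t by simp_all
  have A2: "A - ?T - ?S = ?A" by blast
  have yA: "young_diagram ?A" using young_remove[OF yS ts(1)] rims by simp
  have r': "removable (A - ?T - ?S) r" "?R = rim (A - ?T - ?S) r" using r(3) A2 by simp_all
  have below: "lies_below ?S ?T" "\<not> lies_below ?T ?R" "lies_below ?S ?R" "\<not> lies_below ?T ?S"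
    using lies_below_rim[OF y s ts(1)] lies_below_rim[OF y t ts(2)]
      lies_below_rim[OF yS ts(1), of r] lies_below_rim[OF yT ts(2), of r] r rims st A2 by simp_all
  have "?R \<subseteq> A" using rim_subset[OF yA r(3)] by blast
  then have rect: "\<not> rectangle_2x3_or_3x2 (?R \<union> ?T \<union> ?S)"
    using rim_subset[OF y s] rim_subset[OF y t]
    by (intro not_rectangle[OF y s t rim_disjoint[OF y st]]) auto
  show ?thesis
  proof (rule top_joined_chain[OF T s refl ts(1) rims(1)[symmetric] r(3) refl t refl ts(2) rims(2)[symmetric] r'])
    fix N U U' and i :: nat
    assume U: "domino_tableau X N U" "domino_tableau X N U'" "2 \<le> i" "i + 1 \<le> N"
      and D: "domino U (i - 1) = ?R" "domino U i = ?T" "domino U (i + 1) = ?S"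
        "domino U' (i - 1) = ?R" "domino U' i = ?S" "domino U' (i + 1) = ?T"
      and eq: "\<And>x. x \<notin> ?R \<union> ?T \<union> ?S \<Longrightarrow> U x = U' x"
    have "U' = interchange i (i + 1) U"
    proof (rule tableau_eqI)
      fix k
      consider "k = i - 1" | "k = i" | "k = i + 1" | "k \<noteq> i - 1" "k \<noteq> i" "k \<noteq> i + 1" by blast
      then show "domino U' k = domino (interchange i (i + 1) U) k"
      proof cases
        case 4
        have "x \<in> domino U' k \<longleftrightarrow> x \<in> domino U k" for x
        proof (cases "x \<in> ?R \<union> ?T \<union> ?S")
          case True
          then have "x \<in> domino U (i - 1) \<union> domino U i \<union> domino U (i + 1)"
            "x \<in> domino U' (i - 1) \<union> domino U' i \<union> domino U' (i + 1)"
            unfolding D by blast+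
          then show ?thesis using 4 by (auto simp: mem_domino)
        next
          case False
          then show ?thesis by (simp add: mem_domino eq)
        qed
        then show ?thesis using 4 unfolding domino_interchange by (auto simp: Transposition.transpose_def)
      next
        case 1
        then have "Transposition.transpose i (i + 1) k = i - 1" using U(3) by (auto simp: Transposition.transpose_def)
        then show ?thesis unfolding domino_interchange using 1 D(1,4) by simp
      qed (use D in \<open>simp_all add: domino_interchange\<close>)
    qed
    from step_swap[OF U(1,3,4) this U(2) D(1-3)[symmetric] below rect]
    show "step N U U' \<and> step N U' U" by simp
  qed blast+
qed

text \<open>Removing both dominos turns \<open>s + 2\<close> into an east step and \<open>t\<close>
  into a north step, and the third domino may use either of them.\<close>

lemma removable_between:
  assumes T: "domino_tableau X n T" "shape T = A"
    and s: "removable A s" and t: "removable A t" and st: "s + 3 \<le> t"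
    and r: "s < r" "r < t" "r = s + 2 \<or> \<not> north A r" "r + 2 = t \<or> north A (r + 2) \<and> r \<noteq> s"
  shows "top_joined n A s t"
proof -
  note A = tableau_young[OF T(1), unfolded T(2)]
  have ts: "removable (A - rim A s) t" "rim (A - rim A s) t = rim A t"
    using removable_remove[OF A s t] rim_remove[OF A s, of t] st by simp_all
  have "north A (s + 2)" "\<not> north A t" using s t unfolding removable_def by auto
  then have "removable (A - rim A s - rim A t) r"
    using r st north_remove[OF young_remove[OF A s] ts(1)]
    unfolding removable_def ts(2) north_remove[OF A s] by auto
  then show ?thesis using top_joined_swap[OF T s t st r(1,2)] by blast
qed

text \<open>After both removals the common runner has an east step at \<open>s + 2\<close> and a
  north step at \<open>t\<close>. Somewhere between them an east step is followed by a north step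
  two places later, and this gives the third domino.\<close>

lemma top_joined_same_parity:
  assumes T: "domino_tableau X n T" "shape T = A"
    and s: "removable A s" and t: "removable A t" and st: "s < t" "even (t - s)"
  shows "top_joined n A s t"
proof -
  have w: "\<not> north A s" "north A (s + 2)" "\<not> north A t" using s t unfolding removable_def by auto
  have ne: "t \<noteq> s + 2" using w by auto
  obtain m where m: "t - s = 2 * m" using st(2) by blast
  then have "m > 1" using ne st(1) by (cases "m = 1") auto
  then obtain k where k: "t = s + 2 + 2 * int k" "k > 0"
    using m by (intro that[of "nat (m - 1)"]) auto
  \<comment> \<open>On the positions from \<open>s + 2\<close> to \<open>t\<close> of this runner,
    \<open>f\<close> is the word after both removals.\<close>
  define f where "f x \<longleftrightarrow> x = t \<or> (x \<noteq> s + 2 \<and> north A x)" for x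
  obtain i where i: "i < k" "\<not> f (s + 2 + 2 * int i)" "f (s + 2 + 2 * int i + 2)"
    using alternation[of f "s + 2" k] k unfolding f_def by auto
  then show ?thesis using k
    by (intro removable_between[OF T s t, of "s + 2 + 2 * int i"]) (auto simp: f_def)
qed

text \<open>Since no third domino is available, neither runner has an adjacent east-north pair in
  the gap after both removals. The runner of \<open>t\<close> ends with the north step at
  \<open>t\<close>, so it is north throughout; the runner of \<open>s\<close> begins with the east
  step at \<open>s + 2\<close>, so it is east from there on. The bound \<open>t + 1\<close> is
  attained because the third domino may start at \<open>t - 1\<close>.\<close>

lemma not_top_joined_gap:
  assumes T: "domino_tableau X n T" "shape T = A"
    and s: "removable A s" and t: "removable A t" and st: "s + 3 \<le> t" "odd (t - s)"
    and nj: "\<not> top_joined n A s t"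
  shows "s < r \<Longrightarrow> r < t \<Longrightarrow> even (t - r) \<Longrightarrow> north A r"
    and "s + 2 < r \<Longrightarrow> r \<le> t + 1 \<Longrightarrow> even (r - s) \<Longrightarrow> \<not> north A r"
proof -
  have w: "\<not> north A s" "north A (s + 2)" "\<not> north A t" using s t unfolding removable_def by auto
  have gap: False if "s < x" "x < t" "x = s + 2 \<or> \<not> north A x" "x + 2 = t \<or> north A (x + 2)" for x
    using removable_between[OF T s t st(1) that(1-3)] that(4) nj that by auto
  show "north A r" if r: "s < r" "r < t" "even (t - r)"
  proof (rule ccontr)
    assume nr: "\<not> north A r"
    define f where "f x \<longleftrightarrow> x = t \<or> north A x" for x
    obtain m where "t - r = 2 * m" using r(3) by blast
    then obtain k where k: "t = r + 2 * int k" using r by (intro that[of "nat m"]) simp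
    obtain i where i: "i < k" "\<not> f (r + 2 * int i)" "f (r + 2 * int i + 2)"
      using alternation[of f r k] k nr r unfolding f_def by auto
    then show False using gap[of "r + 2 * int i"] k r by (auto simp: f_def)
  qed
  show "\<not> north A r" if r: "s + 2 < r" "r \<le> t + 1" "even (r - s)"
  proof
    assume nr: "north A r"
    define f where "f x \<longleftrightarrow> x \<noteq> s + 2 \<and> north A x" for x
    obtain m where "r - s = 2 * m" using r(3) by blast
    then obtain k where k: "r = s + 2 + 2 * int k" using r by (intro that[of "nat (m - 1)"]) simp
    obtain i where i: "i < k" "\<not> f (s + 2 + 2 * int i)" "f (s + 2 + 2 * int i + 2)"
      using alternation[of f "s + 2" k] k nr r unfolding f_def by auto
    then show False using gap[of "s + 2 + 2 * int i"] k r by (auto simp: f_def)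
  qed
qed

end

section \<open>Runners of the boundary word\<close>

lemma runner_left:
  fixes f :: "int \<Rightarrow> bool"
  assumes M: "\<And>k. k \<le> M \<Longrightarrow> f k" and no: "\<And>k. k < u \<Longrightarrow> f (k + 1) \<Longrightarrow> f k" and u: "\<not> f u"
  shows "\<exists>a\<ge>1. \<forall>k\<le>u. f k \<longleftrightarrow> k \<le> u - a"
proof -
  have "f (u - int (nat (u - M)))" by (rule M) linarith
  then have ex: "\<exists>j. f (u - int j)" by blast
  define j where "j = (LEAST j. f (u - int j))"
  have j: "f (u - int j)" unfolding j_def using LeastI_ex[OF ex] .
  have least: "\<not> f (u - int i)" if "i < j" for i using not_less_Least that unfolding j_def by blast
  have "f k" if "k \<le> u - int j" for k
    using that
  proof (induction k rule: int_le_induct)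
    case (step i)
    then show ?case using no[of "i - 1"] by simp
  qed (rule j)
  moreover have "\<not> f k" if "k \<le> u" "u - int j < k" for k
    using least[of "nat (u - k)"] that by simp
  moreover have "j \<noteq> 0" using j u by (intro notI) simp
  ultimately have "1 \<le> int j" "\<forall>k\<le>u. f k \<longleftrightarrow> k \<le> u - int j" by (auto simp: not_less[symmetric])
  then show ?thesis by blast
qed

lemma runner_right:
  fixes f :: "int \<Rightarrow> bool"
  assumes M: "\<And>k. k \<ge> M \<Longrightarrow> \<not> f k" and no: "\<And>k. u \<le> k \<Longrightarrow> f (k + 1) \<Longrightarrow> f k" and u: "f u"
  shows "\<exists>b\<ge>1. \<forall>k\<ge>u. f k \<longleftrightarrow> k < u + b"
proof -
  \<comment> \<open>Reversing the runner and exchanging the two kinds of steps turns the claim into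
    \<open>runner_left\<close>.\<close>
  let ?g = "\<lambda>k. \<not> f (- k)"
  have M': "?g k" if "k \<le> - M" for k using M[of "- k"] that by simp
  have no': "?g k" if "k < - u" "?g (k + 1)" for k using no[of "- k - 1"] that by auto
  have u': "\<not> ?g (- u)" using u by simp
  obtain a where a: "1 \<le> a" "\<forall>k\<le>- u. ?g k \<longleftrightarrow> k \<le> - u - a"
    using runner_left[of "- M" ?g "- u", OF M' no' u'] by blast
  have "f k \<longleftrightarrow> k < u + a" if "u \<le> k" for k using spec[OF a(2), of "- k"] that by auto
  then show ?thesis using a(1) by blast
qed

lemma runner_all_left:
  fixes f :: "int \<Rightarrow> bool"
  assumes no: "\<And>k. k < u \<Longrightarrow> f (k + 1) \<Longrightarrow> f k" and u: "f u" and k: "k \<le> u"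
  shows "f k"
  using k
proof (induction k rule: int_le_induct)
  case (step i)
  then show ?case using no[of "i - 1"] by simp
qed (rule u)

lemma runner_all_right:
  fixes f :: "int \<Rightarrow> bool"
  assumes no: "\<And>k. u \<le> k \<Longrightarrow> f (k + 1) \<Longrightarrow> f k" and u: "\<not> f u" and k: "u \<le> k"
  shows "\<not> f k"
  using k
proof (induction k rule: int_ge_induct)
  case (step i)
  then show ?case using no[of i] by blast
qed (rule u)

text \<open>\<open>level A p x\<close> expresses that the north steps at the positions of parity \<open>p\<close> fill
  up, once pushed together to the left, exactly the positions \<open>2 * k + p\<close> with \<open>k \<le> x\<close>.
  Removing a domino does not change the level, so that it is determined by the 2-core.\<close>

definition level :: "square set \<Rightarrow> int \<Rightarrow> int \<Rightarrow> bool" where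
  "level A p x \<longleftrightarrow>
     (\<exists>M0. \<forall>M\<ge>M0. int (card {k. - M \<le> k \<and> k < M \<and> north A (2 * k + p)}) = M + x + 1)"

text \<open>The levels of all words met here can be computed from an infinite block and at most two
  finite ones; shorter descriptions are padded with empty blocks. In particular the level is
  unique.\<close>

lemma level_blocks:
  assumes f: "\<And>k. north A (2 * k + p) \<longleftrightarrow> k \<le> a \<or> (b < k \<and> k \<le> b') \<or> (c < k \<and> k \<le> c')"
    and le: "a \<le> b" "b \<le> b'" "b' \<le> c" "c \<le> c'"
  shows "level A p x \<longleftrightarrow> x = a + (b' - b) + (c' - c)"
proof -
  have card: "int (card {k. - M \<le> k \<and> k < M \<and> north A (2 * k + p)}) = M + (a + (b' - b) + (c' - c)) + 1"
    if M: "M > \<bar>a\<bar> + \<bar>c'\<bar>" for M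
  proof -
    have "{k. - M \<le> k \<and> k < M \<and> north A (2 * k + p)} = {- M..a} \<union> ({b + 1..b'} \<union> {c + 1..c'})"
      unfolding f using M le by auto
    also have "card \<dots> = card {- M..a} + (card {b + 1..b'} + card {c + 1..c'})"
      using le by (subst card_Un_disjoint; force simp: card_Un_disjoint)
    finally show ?thesis using M le by simp
  qed
  show ?thesis
  proof
    assume "level A p x"
    then obtain M0 where "\<And>M. M \<ge> M0 \<Longrightarrow> int (card {k. - M \<le> k \<and> k < M \<and> north A (2 * k + p)}) = M + x + 1"
      unfolding level_def by blast
    from this[of "max M0 (\<bar>a\<bar> + \<bar>c'\<bar> + 1)"] card[of "max M0 (\<bar>a\<bar> + \<bar>c'\<bar> + 1)"]
    show "x = a + (b' - b) + (c' - c)" by simp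
  next
    assume "x = a + (b' - b) + (c' - c)"
    then show "level A p x" unfolding level_def using card by (intro exI[of _ "\<bar>a\<bar> + \<bar>c'\<bar> + 1"]) auto
  qed
qed

text \<open>On the runner of \<open>s\<close> one north step moves back by one place and the other
  runner is unchanged, so the count in a window containing both places stays the same.\<close>

lemma level_remove:
  assumes A: "young_diagram A" and s: "removable A s" and lev: "level (A - rim A s) p x"
  shows "level A p x"
proof -
  let ?S = "\<lambda>A M. {k. - M \<le> k \<and> k < M \<and> north A (2 * k + p)}"
  obtain M0 where M0: "\<And>M. M \<ge> M0 \<Longrightarrow> int (card (?S (A - rim A s) M)) = M + x + 1"
    using lev unfolding level_def by blast
  have "card (?S A M) = card (?S (A - rim A s) M)" if M: "M > \<bar>s\<bar> + \<bar>p\<bar> + 2" for M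
  proof (cases "even (s - p)")
    case True
    then obtain u where u: "s - p = 2 * u" by blast
    then have su: "s = 2 * u + p" by simp
    have fin: "finite (?S (A - rim A s) M)" by (rule finite_subset[of _ "{- M..M}"]) auto
    have nB: "north (A - rim A s) (2 * k + p) \<longleftrightarrow> k = u \<or> (k \<noteq> u + 1 \<and> north A (2 * k + p))" for k
      using north_remove[OF A s, of "2 * k + p"] su by auto
    have wu: "\<not> north A (2 * u + p)" "north A (2 * (u + 1) + p)"
      using s unfolding removable_def su by (simp_all add: algebra_simps)
    have b: "- M \<le> u" "u + 1 < M" using M su by linarith+
    have "?S A M = insert (u + 1) (?S (A - rim A s) M - {u})"
      unfolding nB using b wu by auto
    moreover have "u \<in> ?S (A - rim A s) M" "u + 1 \<notin> ?S (A - rim A s) M"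
      unfolding nB using b by auto
    ultimately show ?thesis using fin card.remove[OF fin, of u] by simp
  next
    case False
    then have "2 * k + p \<noteq> s" "2 * k + p \<noteq> s + 2" for k by (auto; presburger)+
    then show ?thesis unfolding north_remove[OF A s] by simp
  qed
  then show ?thesis unfolding level_def using M0
    by (intro exI[of _ "max M0 (\<bar>s\<bar> + \<bar>p\<bar> + 3)"]) auto
qed

text \<open>The core is empty in type C, with north steps exactly at the negative positions. In type
  B it is the single square, with north steps at 0 and at all positions up to -2. The values are the
  last filled places on the two runners.\<close>

definition core_level :: "cartan_type \<Rightarrow> int \<Rightarrow> int" where
  "core_level X p = (case X of TypeC \<Rightarrow> - 1 | TypeB \<Rightarrow> if p = 0 then 0 else - 2)"

lemma young_empty: "young_diagram {}"
  by (simp add: young_diagram_def)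

lemma young_insert:
  assumes A: "young_diagram A" and ij: "1 \<le> i" "1 \<le> j" "i = 1 \<or> (i - 1, j) \<in> A" "j = 1 \<or> (i, j - 1) \<in> A"
  shows "young_diagram (insert (i, j) A)"
  unfolding young_diagram_def
proof (intro conjI ballI allI impI)
  show "finite (insert (i, j) A)" using young_finite[OF A] by simp
  show "case s of (i, j) \<Rightarrow> 1 \<le> i \<and> 1 \<le> j" if "s \<in> insert (i, j) A" for s
    using that ij young_pos[OF A] by auto
next
  fix x y x' y' assume xy: "(x, y) \<in> insert (i, j) A" and le: "1 \<le> x'" "x' \<le> x" "1 \<le> y'" "y' \<le> y"
  show "(x', y') \<in> insert (i, j) A"
  proof (cases "(x, y) \<in> A")
    case True
    then show ?thesis using young_down[OF A True le] by simp
  next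
    case False
    then have [simp]: "x = i" "y = j" using xy by auto
    consider "x' = i" "y' = j" | "x' \<le> i - 1" | "y' \<le> j - 1" using le by fastforce
    then show ?thesis
    proof cases
      case 2
      then show ?thesis using young_down[OF A, of "i - 1" j x' y'] ij le by auto
    next
      case 3
      then show ?thesis using young_down[OF A, of i "j - 1" x' y'] ij le by auto
    qed simp
  qed
qed

lemma tableau_level:
  assumes "domino_tableau X n T" "p = 0 \<or> p = 1"
  shows "level (shape T) p (core_level X p)"
  using assms(1)
proof (induction n arbitrary: T)
  case 0
  show ?case
  proof (cases X)
    case TypeC
    then have sh: "shape T = {}" using shape_rank_0[OF 0] by simp
    have n: "north {} t \<longleftrightarrow> t < 0" for t
      unfolding north_iff[OF young_empty] filled_def by (auto intro: exI[of _ "- t"])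
    have "north (shape T) (2 * k + p) \<longleftrightarrow> k \<le> - 1 \<or> (0 < k \<and> k \<le> 0) \<or> (0 < k \<and> k \<le> 0)" for k
      unfolding sh n using assms(2) by auto
    from level_blocks[OF this] show ?thesis using TypeC by (simp add: core_level_def)
  next
    case TypeB
    then have sh: "shape T = {(1, 1)}" using shape_rank_0[OF 0] by simp
    have y: "young_diagram {(1, 1)}" using young_insert[OF young_empty, of 1 1] by simp
    have n: "north {(1, 1)} t \<longleftrightarrow> t = 0 \<or> t \<le> - 2" for t
      unfolding north_iff[OF y] filled_def
      by (auto intro: exI[of _ "- t"] exI[of _ 1])
    have core: "core_level X p = (if p = 0 then 0 else - 2)" using TypeB by (simp add: core_level_def)
    have "north (shape T) (2 * k + p) \<longleftrightarrow>
        k \<le> core_level X p \<or> (1 < k \<and> k \<le> 1) \<or> (1 < k \<and> k \<le> 1)" for k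
      unfolding sh n core using assms(2) by presburger
    from level_blocks[OF this] show ?thesis using TypeB by (simp add: core_level_def split: if_splits)
  qed
next
  case (Suc n)
  obtain s where s: "removable (shape T) s" "shape (restrict_labels n T) = shape T - rim (shape T) s"
    using top_domino[OF Suc.prems] by metis
  have "domino_tableau X n (restrict_labels n T)" using restrict_tableau[OF Suc.prems] by simp
  from Suc.IH[OF this] show ?case
    using level_remove[OF tableau_young[OF Suc.prems] s(1)] s(2) by simp
qed

text \<open>A runner without removable positions changes from north to east only once, and every
  removable position adds one return to north. The conditions \<open>w\<close> shorten the returning
  block behind \<open>s\<close> to one step and the east gap before the block behind
  \<open>t\<close> to one step, so one length per runner stays free.\<close>

lemma two_removables:
  assumes A: "young_diagram A" and s: "removable A s" and t: "removable A t"
    and only: "\<And>r. removable A r \<Longrightarrow> r = s \<or> r = t" and odd: "odd (t - s)"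
    and w: "\<not> north A (s + 4)" "north A (t - 2)"
  obtains a b where "1 \<le> a" "1 \<le> b"
    "\<And>k. north A (s + 2 * k) \<longleftrightarrow> k \<le> - a \<or> k = 1"
    "\<And>k. north A (t + 2 * k) \<longleftrightarrow> k \<le> - 1 \<or> (0 < k \<and> k \<le> b)"
proof -
  obtain M where M: "M > 0" "\<And>t. t \<ge> M \<Longrightarrow> \<not> north A t" "\<And>t. t \<le> - M \<Longrightarrow> north A t"
    using north_eventually[OF A] by blast
  have ne: "t \<noteq> s + 2 * k" "s \<noteq> t + 2 * k" for k using odd by auto
  have ws: "\<not> north A s" "north A (s + 2)" "\<not> north A t" "north A (t + 2)"
    using s t unfolding removable_def by auto
  let ?f = "\<lambda>k. north A (s + 2 * k)" and ?g = "\<lambda>k. north A (t + 2 * k)"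
  have f: "?f (k + 1) \<Longrightarrow> ?f k" if "k \<noteq> 0" for k
    using only[of "s + 2 * k"] ne that unfolding removable_def by (auto simp: algebra_simps)
  have g: "?g (k + 1) \<Longrightarrow> ?g k" if "k \<noteq> 0" for k
    using only[of "t + 2 * k"] ne that unfolding removable_def by (auto simp: algebra_simps)
  have fM: "?f k" if "k \<le> - M - \<bar>s\<bar>" for k by (rule M(3)) (use that M(1) in linarith)
  have f0: "?f k" if "k < 0" "?f (k + 1)" for k using f[of k] that by simp
  have f1: "\<not> ?f 0" using ws(1) by simp
  obtain a where a: "1 \<le> a" "\<And>k. k \<le> 0 \<Longrightarrow> ?f k \<longleftrightarrow> k \<le> 0 - a"
    using runner_left[of "- M - \<bar>s\<bar>" ?f 0, OF fM f0 f1] by blast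
  have f2: "\<not> ?f k" if "2 \<le> k" for k
  proof (rule runner_all_right[of 2 ?f k, OF _ _ that])
    show "\<not> ?f 2" using w(1) by simp
  qed (use f in simp)
  have g2: "?g k" if "k \<le> - 1" for k
  proof (rule runner_all_left[of "- 1" ?g k, OF _ _ that])
    show "?g (- 1)" using w(2) by simp
  qed (use g in simp)
  have gM: "\<not> ?g k" if "M + \<bar>t\<bar> \<le> k" for k by (rule M(2)) (use that M(1) in linarith)
  have g0: "?g k" if "1 \<le> k" "?g (k + 1)" for k using g[of k] that by simp
  have g1: "?g 1" using ws(4) by simp
  obtain b where b: "1 \<le> b" "\<And>k. 1 \<le> k \<Longrightarrow> ?g k \<longleftrightarrow> k < 1 + b"
    using runner_right[of "M + \<bar>t\<bar>" ?g 1, OF gM g0 g1] by blast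
  show ?thesis
  proof (rule that[OF a(1) b(1)])
    show "?f k \<longleftrightarrow> k \<le> - a \<or> k = 1" for k
    proof -
      consider "k \<le> 0" | "k = 1" | "2 \<le> k" by linarith
      then show ?thesis using a f2 ws(2) by cases auto
    qed
    show "?g k \<longleftrightarrow> k \<le> - 1 \<or> (0 < k \<and> k \<le> b)" for k
    proof -
      consider "k \<le> - 1" | "k = 0" | "1 \<le> k" by linarith
      then show ?thesis using b g2 ws(3) by cases auto
    qed
  qed
qed

text \<open>The positions \<open>s\<close> and \<open>s + 4\<close> lie on one runner and
  \<open>s + 1\<close> on the other. The second runner is determined completely by \<open>w\<close>;
  on the first one, the lengths \<open>a\<close> of the left gap and \<open>c\<close> of the last
  block remain.\<close>

lemma three_removables:
  assumes A: "young_diagram A"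
    and only: "\<And>r. removable A r \<longleftrightarrow> r = s \<or> r = s + 1 \<or> r = s + 4"
    and w: "north A (s - 1)" "\<not> north A (s + 5)"
  obtains a c where "1 \<le> a" "1 \<le> c"
    "\<And>k. north A (s + 2 * k) \<longleftrightarrow> k \<le> - a \<or> k = 1 \<or> (2 < k \<and> k \<le> 2 + c)"
    "\<And>k. north A (s + 1 + 2 * k) \<longleftrightarrow> k \<le> - 1 \<or> k = 1"
proof -
  obtain M where M: "M > 0" "\<And>t. t \<ge> M \<Longrightarrow> \<not> north A t" "\<And>t. t \<le> - M \<Longrightarrow> north A t"
    using north_eventually[OF A] by blast
  have ws: "\<not> north A s" "north A (s + 2)" "\<not> north A (s + 1)" "north A (s + 3)"
      "\<not> north A (s + 4)" "north A (s + 6)"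
    using only[of s] only[of "s + 1"] only[of "s + 4"] unfolding removable_def by (simp_all add: add.assoc)
  let ?f = "\<lambda>k. north A (s + 2 * k)" and ?g = "\<lambda>k. north A (s + 1 + 2 * k)"
  have ne: "2 * k \<noteq> 1" "2 * k \<noteq> 3" for k :: int by presburger+
  have f: "?f (k + 1) \<Longrightarrow> ?f k" if "k \<noteq> 0" "k \<noteq> 2" for k
    using only[of "s + 2 * k"] ne[of k] that unfolding removable_def by (auto simp: algebra_simps)
  have g: "?g (k + 1) \<Longrightarrow> ?g k" if "k \<noteq> 0" for k
    using only[of "s + 1 + 2 * k"] ne[of k] ne[of "- k"] that unfolding removable_def
    by (auto simp: algebra_simps)
  have fM: "?f k" if "k \<le> - M - \<bar>s\<bar>" for k by (rule M(3)) (use that M(1) in linarith)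
  have f0: "?f k" if "k < 0" "?f (k + 1)" for k using f[of k] that by simp
  have f1: "\<not> ?f 0" using ws(1) by simp
  obtain a where a: "1 \<le> a" "\<And>k. k \<le> 0 \<Longrightarrow> ?f k \<longleftrightarrow> k \<le> 0 - a"
    using runner_left[of "- M - \<bar>s\<bar>" ?f 0, OF fM f0 f1] by blast
  have fM': "\<not> ?f k" if "M + \<bar>s\<bar> \<le> k" for k by (rule M(2)) (use that M(1) in linarith)
  have f3: "?f k" if "3 \<le> k" "?f (k + 1)" for k using f[of k] that by simp
  have f4: "?f 3" using ws(6) by simp
  obtain c where c: "1 \<le> c" "\<And>k. 3 \<le> k \<Longrightarrow> ?f k \<longleftrightarrow> k < 3 + c"
    using runner_right[of "M + \<bar>s\<bar>" ?f 3, OF fM' f3 f4] by blast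
  have g2: "\<not> ?g k" if "2 \<le> k" for k
  proof (rule runner_all_right[of 2 ?g k, OF _ _ that])
    show "\<not> ?g 2" using w(2) by (simp add: add.assoc)
  qed (use g in simp)
  have g1: "?g k" if "k \<le> - 1" for k
  proof (rule runner_all_left[of "- 1" ?g k, OF _ _ that])
    show "?g (- 1)" using w(1) by simp
  qed (use g in simp)
  show ?thesis
  proof (rule that[OF a(1) c(1)])
    show "?f k \<longleftrightarrow> k \<le> - a \<or> k = 1 \<or> (2 < k \<and> k \<le> 2 + c)" for k
    proof -
      consider "k \<le> 0" | "k = 1" | "k = 2" | "3 \<le> k" by linarith
      then show ?thesis using a c ws by cases auto
    qed
    show "?g k \<longleftrightarrow> k \<le> - 1 \<or> k = 1" for k
    proof -
      consider "k \<le> - 1" | "k = 0" | "k = 1" | "2 \<le> k" by linarith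
      then show ?thesis using g1 g2 ws(3,4) by cases (auto simp: algebra_simps)
    qed
  qed
qed

section \<open>Shapes without further moves\<close>

lemma sorted_rows:
  "sorted_wrt (\<ge>) rs \<Longrightarrow> i \<le> j \<Longrightarrow> j < length rs \<Longrightarrow> rs ! j \<le> (rs ! i :: nat)"
  using sorted_wrt_nth_less[of "(\<ge>)" rs i j] by (cases "i = j") auto

lemma young_diagram_of_rows:
  assumes "sorted_wrt (\<ge>) rs"
  shows "young_diagram (diagram_of_rows rs)"
  unfolding young_diagram_def
proof (intro conjI ballI allI impI)
  have "diagram_of_rows rs \<subseteq> {1..int (length rs)} \<times> {1..int (rs ! 0)}"
  proof
    fix s assume s: "s \<in> diagram_of_rows rs"
    obtain i j where [simp]: "s = (i, j)" by (cases s)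
    have "rs ! nat (i - 1) \<le> rs ! 0" using s sorted_rows[OF assms, of 0 "nat (i - 1)"]
      by (auto simp: diagram_of_rows_def)
    then show "s \<in> {1..int (length rs)} \<times> {1..int (rs ! 0)}" using s by (auto simp: diagram_of_rows_def)
  qed
  then show "finite (diagram_of_rows rs)" by (rule finite_subset) simp
  show "case s of (i, j) \<Rightarrow> 1 \<le> i \<and> 1 \<le> j" if "s \<in> diagram_of_rows rs" for s
    using that by (auto simp: diagram_of_rows_def)
next
  fix i j i' j' assume s: "(i, j) \<in> diagram_of_rows rs" and le: "1 \<le> i'" "i' \<le> i" "1 \<le> j'" "j' \<le> j"
  have "rs ! nat (i - 1) \<le> rs ! nat (i' - 1)" using s le sorted_rows[OF assms, of "nat (i' - 1)" "nat (i - 1)"]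
    by (auto simp: diagram_of_rows_def)
  then show "(i', j') \<in> diagram_of_rows rs" using s le by (auto simp: diagram_of_rows_def)
qed

lemma north_diagram_of_rows:
  assumes "sorted_wrt (\<ge>) rs"
  shows "north (diagram_of_rows rs) t \<longleftrightarrow>
    (\<exists>i<length rs. t = int (rs ! i) - int i - 1) \<or> t < - int (length rs)"
proof
  assume "north (diagram_of_rows rs) t"
  then obtain i where i: "filled (diagram_of_rows rs) i (i + t)" "\<not> filled (diagram_of_rows rs) i (i + t + 1)"
    unfolding north_iff[OF young_diagram_of_rows[OF assms]] by blast
  show "(\<exists>i<length rs. t = int (rs ! i) - int i - 1) \<or> t < - int (length rs)"
  proof (cases "i \<le> int (length rs)")
    case True
    then have "t = int (rs ! nat (i - 1)) - int (nat (i - 1)) - 1" "nat (i - 1) < length rs"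
      using i unfolding filled_def diagram_of_rows_def by auto
    then show ?thesis by blast
  next
    case False
    then show ?thesis using i unfolding filled_def diagram_of_rows_def by auto
  qed
next
  assume "(\<exists>i<length rs. t = int (rs ! i) - int i - 1) \<or> t < - int (length rs)"
  then show "north (diagram_of_rows rs) t"
  proof (elim disjE exE conjE)
    fix i assume "i < length rs" "t = int (rs ! i) - int i - 1"
    then show ?thesis unfolding north_iff[OF young_diagram_of_rows[OF assms]]
      unfolding filled_def diagram_of_rows_def by (intro exI[of _ "int i + 1"]) auto
  next
    assume "t < - int (length rs)"
    then show ?thesis unfolding north_iff[OF young_diagram_of_rows[OF assms]]
      unfolding filled_def diagram_of_rows_def by (intro exI[of _ "- t"]) auto
  qed
qed

lemma sorted_wrt_ge_append:
  "sorted_wrt (\<ge>) (xs @ ys) \<longleftrightarrow> sorted_wrt (\<ge>) xs \<and> sorted_wrt (\<ge>) ys \<and> (\<forall>x\<in>set xs. \<forall>y\<in>set ys. y \<le> (x :: nat))"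
  by (auto simp: sorted_wrt_append)

lemma sorted_wrt_rev_upt: "sorted_wrt (\<ge>) (rev [a..<b])"
  by (simp add: sorted_wrt_rev)

text \<open>Common normal form of the four families: a staircase from \<open>d\<close> down to
  \<open>c + 1\<close>, two rows of length \<open>e\<close>, and a staircase from \<open>f\<close>
  down to 1.\<close>

lemma quasi_staircase_rows:
  fixes c d e f :: nat
  defines "rs \<equiv> rev [c + 1..<d + 1] @ [e, e] @ rev [1..<f + 1]"
  assumes cd: "c \<le> d" "f \<le> e" "e \<le> c"
  shows "sorted_wrt (\<ge>) rs" "length rs = d - c + 2 + f"
    "i < d - c \<Longrightarrow> rs ! i = d - i" "rs ! (d - c) = e" "rs ! (d - c + 1) = e"
    "j < f \<Longrightarrow> rs ! (d - c + 2 + j) = f - j"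
proof -
  show "sorted_wrt (\<ge>) rs"
    unfolding rs_def using cd by (auto simp: sorted_wrt_ge_append sorted_wrt_rev_upt simp del: upt_Suc)
  show "length rs = d - c + 2 + f" unfolding rs_def by (simp del: upt_Suc)
  show "i < d - c \<Longrightarrow> rs ! i = d - i" unfolding rs_def by (simp add: nth_append rev_nth del: upt_Suc)
  show "rs ! (d - c) = e" "rs ! (d - c + 1) = e" unfolding rs_def by (simp_all add: nth_append del: upt_Suc)
  show "j < f \<Longrightarrow> rs ! (d - c + 2 + j) = f - j"
    unfolding rs_def by (simp add: nth_append rev_nth del: upt_Suc)
qed

text \<open>The rows of a quasi-staircase are read off in three groups: the rows above the two equal
  ones, these two, and the rows below them.\<close>

lemma north_quasi_staircase:
  fixes c d e f :: nat
  defines "rs \<equiv> rev [c + 1..<d + 1] @ [e, e] @ rev [1..<f + 1]"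
  assumes cd: "c \<le> d" "f \<le> e" "e \<le> c"
  shows "north (diagram_of_rows rs) t \<longleftrightarrow>
      (even (int d - 1 - t) \<and> int c - int (d - c) < t \<and> t < int d) \<or>
      t = int e - int (d - c) - 1 \<or> t = int e - int (d - c) - 2 \<or>
      (even (int f - int (d - c) - 3 - t) \<and> - int (d - c) - 3 - int f < t \<and> t \<le> int f - int (d - c) - 3) \<or>
      t < - int (d - c) - 2 - int f"
    (is "?L \<longleftrightarrow> ?R")
proof -
  note rows = quasi_staircase_rows[OF cd, folded rs_def]
  have len: "- int (length rs) = - int (d - c) - 2 - int f" unfolding rows(2) by simp
  have "?L \<longleftrightarrow> (\<exists>i<d - c + 2 + f. t = int (rs ! i) - int i - 1) \<or> t < - int (d - c) - 2 - int f"
    unfolding north_diagram_of_rows[OF rows(1)] len unfolding rows(2) by (rule refl)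
  also have "(\<exists>i<d - c + 2 + f. t = int (rs ! i) - int i - 1) \<longleftrightarrow>
      (\<exists>i<d - c. t = int d - 2 * int i - 1) \<or> t = int e - int (d - c) - 1 \<or> t = int e - int (d - c) - 2 \<or>
      (\<exists>j<f. t = int f - int (d - c) - 3 - 2 * int j)" (is "_ \<longleftrightarrow> ?M")
  proof
    assume "\<exists>i<d - c + 2 + f. t = int (rs ! i) - int i - 1"
    then obtain i where i: "i < d - c + 2 + f" "t = int (rs ! i) - int i - 1" by blast
    consider "i < d - c" | "i = d - c" | "i = d - c + 1" | "d - c + 2 \<le> i" by linarith
    then show ?M
    proof cases
      case 1
      then show ?thesis using i(2) rows(3) by auto
    next
      case 4
      then obtain j where j: "i = d - c + 2 + j" using le_Suc_ex by blast
      then show ?thesis using i rows(6)[of j] by auto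
    qed (use i(2) rows(4,5) in auto)
  next
    assume ?M
    then show "\<exists>i<d - c + 2 + f. t = int (rs ! i) - int i - 1"
    proof (elim disjE exE conjE)
      fix i assume "i < d - c" "t = int d - 2 * int i - 1"
      then show ?thesis using rows(3) by (intro exI[of _ i]) auto
    next
      fix j assume "j < f" "t = int f - int (d - c) - 3 - 2 * int j"
      then show ?thesis using rows(6) by (intro exI[of _ "d - c + 2 + j"]) auto
    next
      assume "t = int e - int (d - c) - 1"
      then show ?thesis using rows(4) by (intro exI[of _ "d - c"]) auto
    next
      assume "t = int e - int (d - c) - 2"
      then show ?thesis using rows(5) by (intro exI[of _ "d - c + 1"]) auto
    qed
  qed
  also have "(\<exists>i<d - c. t = int d - 2 * int i - 1) \<longleftrightarrow>
      even (int d - 1 - t) \<and> int c - int (d - c) < t \<and> t < int d" (is "_ \<longleftrightarrow> ?E1")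
  proof
    assume ?E1
    then obtain m where "int d - 1 - t = 2 * m" by blast
    then show "\<exists>i<d - c. t = int d - 2 * int i - 1" using \<open>?E1\<close> cd by (intro exI[of _ "nat m"]) auto
  qed (use cd in auto)
  also have "(\<exists>j<f. t = int f - int (d - c) - 3 - 2 * int j) \<longleftrightarrow>
      even (int f - int (d - c) - 3 - t) \<and> - int (d - c) - 3 - int f < t \<and> t \<le> int f - int (d - c) - 3" (is "_ \<longleftrightarrow> ?E2")
  proof
    assume ?E2
    then obtain m where "int f - int (d - c) - 3 - t = 2 * m" by blast
    then show "\<exists>j<f. t = int f - int (d - c) - 3 - 2 * int j" using \<open>?E2\<close> by (intro exI[of _ "nat m"]) auto
  qed auto
  finally show ?thesis by blast
qed

lemma quasi_staircase_shapes:
  "1 \<le> k \<Longrightarrow> lambda_shape TypeC k = diagram_of_rows (rev [(k + 2) + 1..<(2 * k + 1) + 1] @ [k + 1, k + 1] @ rev [1..<(k - 1) + 1])"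
  "1 \<le> k \<Longrightarrow> mu_shape TypeC k = diagram_of_rows (rev [(k + 2) + 1..<(2 * k + 2) + 1] @ [k + 1, k + 1] @ rev [1..<(k - 1) + 1])"
  "2 \<le> k \<Longrightarrow> lambda_shape TypeB k = diagram_of_rows (rev [(k + 1) + 1..<(2 * k + 1) + 1] @ [k, k] @ rev [1..<(k - 2) + 1])"
  "1 \<le> k \<Longrightarrow> mu_shape TypeB k = diagram_of_rows (rev [(k + 3) + 1..<(2 * k + 2) + 1] @ [k + 2, k + 2] @ rev [1..<k + 1])"
proof -
  have e: "(k + 2) + 1 = k + 3" "(2 * k + 1) + 1 = 2 * k + 2" "(2 * k + 2) + 1 = 2 * k + 3" "(k + 1) + 1 = k + 2"
    "(k + 3) + 1 = k + 4" by auto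
  show "mu_shape TypeB k = diagram_of_rows (rev [(k + 3) + 1..<(2 * k + 2) + 1] @ [k + 2, k + 2] @ rev [1..<k + 1])"
    unfolding mu_shape_def e by (simp only: cartan_type.case)
  show "lambda_shape TypeC k = diagram_of_rows (rev [(k + 2) + 1..<(2 * k + 1) + 1] @ [k + 1, k + 1] @ rev [1..<(k - 1) + 1])"
    if "1 \<le> k"
  proof -
    have "k - 1 + 1 = k" using that by simp
    then show ?thesis unfolding lambda_shape_def e by (simp only: cartan_type.case)
  qed
  show "mu_shape TypeC k = diagram_of_rows (rev [(k + 2) + 1..<(2 * k + 2) + 1] @ [k + 1, k + 1] @ rev [1..<(k - 1) + 1])"
    if "1 \<le> k"
  proof -
    have "k - 1 + 1 = k" using that by simp
    then show ?thesis unfolding mu_shape_def e by (simp only: cartan_type.case)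
  qed
  show "lambda_shape TypeB k = diagram_of_rows (rev [(k + 1) + 1..<(2 * k + 1) + 1] @ [k, k] @ rev [1..<(k - 2) + 1])"
    if "2 \<le> k"
  proof -
    have "k - 2 + 1 = k - 1" using that by simp
    then show ?thesis unfolding lambda_shape_def e by (simp only: cartan_type.case)
  qed
qed

text \<open>Splitting the word by parity makes it directly comparable with the two runners found in
  \<open>three_removables\<close>; the same form is used for the other families.\<close>

lemma north_lambda_C:
  assumes "1 \<le> k"
  shows "north (lambda_shape TypeC k) t \<longleftrightarrow>
    even t \<and> (t \<le> - 2 * int k - 2 \<or> t = 0 \<or> 4 \<le> t \<and> t \<le> 2 * int k) \<or> odd t \<and> (t \<le> - 3 \<or> t = 1)"
proof -
  have e: "2 * k + 1 - (k + 2) = k - 1" "int (k - 1) = int k - 1" using assms by auto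
  have k: "1 \<le> int k" using assms by simp
  have le: "k + 2 \<le> 2 * k + 1" "k - 1 \<le> k + 1" "k + 1 \<le> k + 2" using assms by auto
  show ?thesis
    unfolding quasi_staircase_shapes(1)[OF assms] north_quasi_staircase[OF le] e
    by (simp only: of_nat_add of_nat_mult of_nat_numeral of_nat_1 e) (use k in presburger)
qed

lemma north_mu_C:
  assumes "1 \<le> k"
  shows "north (mu_shape TypeC k) t \<longleftrightarrow>
    odd t \<and> (t \<le> - 2 * int k - 3 \<or> t = - 1 \<or> 3 \<le> t \<and> t \<le> 2 * int k + 1) \<or> even t \<and> (t \<le> - 4 \<or> t = 0)"
proof -
  have e: "2 * k + 2 - (k + 2) = k" "int (k - 1) = int k - 1" using assms by auto
  have k: "1 \<le> int k" using assms by simp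
  have le: "k + 2 \<le> 2 * k + 2" "k - 1 \<le> k + 1" "k + 1 \<le> k + 2" using assms by auto
  show ?thesis
    unfolding quasi_staircase_shapes(2)[OF assms] north_quasi_staircase[OF le] e
    by (simp only: of_nat_add of_nat_mult of_nat_numeral of_nat_1 e) (use k in presburger)
qed

lemma north_lambda_B:
  assumes "2 \<le> k"
  shows "north (lambda_shape TypeB k) t \<longleftrightarrow>
    even t \<and> (t \<le> - 2 * int k - 2 \<or> t = - 2 \<or> 2 \<le> t \<and> t \<le> 2 * int k) \<or> odd t \<and> (t \<le> - 5 \<or> t = - 1)"
proof -
  have e: "2 * k + 1 - (k + 1) = k" "int (k - 1) = int k - 1" "int (k - 2) = int k - 2" using assms by auto
  have k: "2 \<le> int k" using assms by simp
  have le: "k + 1 \<le> 2 * k + 1" "k - 2 \<le> k" "k \<le> k + 1" using assms by auto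
  show ?thesis
    unfolding quasi_staircase_shapes(3)[OF assms] north_quasi_staircase[OF le] e
    by (simp only: of_nat_add of_nat_mult of_nat_numeral of_nat_1 e) (use k in presburger)
qed

lemma north_mu_B:
  assumes "1 \<le> k"
  shows "north (mu_shape TypeB k) t \<longleftrightarrow>
    odd t \<and> (t \<le> - 2 * int k - 3 \<or> t = 1 \<or> 5 \<le> t \<and> t \<le> 2 * int k + 1) \<or> even t \<and> (t \<le> - 2 \<or> t = 2)"
proof -
  have e: "2 * k + 2 - (k + 3) = k - 1" "int (k - 1) = int k - 1" using assms by auto
  have k: "1 \<le> int k" using assms by simp
  have le: "k + 3 \<le> 2 * k + 2" "k \<le> k + 2" "k + 2 \<le> k + 3" using assms by auto
  show ?thesis
    unfolding quasi_staircase_shapes(4)[OF assms] north_quasi_staircase[OF le] e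
    by (simp only: of_nat_add of_nat_mult of_nat_numeral of_nat_1 e) (use k in presburger)
qed

lemma young_quasi_staircase:
  "1 \<le> k \<Longrightarrow> young_diagram (lambda_shape TypeC k)"
  "1 \<le> k \<Longrightarrow> young_diagram (mu_shape TypeC k)"
  "2 \<le> k \<Longrightarrow> young_diagram (lambda_shape TypeB k)"
  "1 \<le> k \<Longrightarrow> young_diagram (mu_shape TypeB k)"
  unfolding quasi_staircase_shapes
  by (intro young_diagram_of_rows quasi_staircase_rows(1); simp)+

text \<open>The parity classes of the two removable positions and their levels leave only finitely
  many shapes.\<close>

lemma two_removables_shape:
  assumes T: "domino_tableau X n T" "shape T = A" and s: "removable A s" and t: "removable A t"
    and only: "\<And>r. removable A r \<Longrightarrow> r = s \<or> r = t" and st: "s < t" "odd (t - s)"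
    and w: "\<not> north A (s + 4)" "north A (t - 2)"
  shows "X = TypeC \<and> A = diagram_of_rows [2, 2] \<or>
    X = TypeB \<and> (A = diagram_of_rows [3, 1, 1] \<or> A = diagram_of_rows [3, 3, 1] \<or> A = diagram_of_rows [3, 2, 2])"
proof -
  note A = tableau_young[OF T(1), unfolded T(2)]
  obtain a b where ab: "1 \<le> a" "1 \<le> b"
    and f: "\<And>k. north A (s + 2 * k) \<longleftrightarrow> k \<le> - a \<or> k = 1"
    and g: "\<And>k. north A (t + 2 * k) \<longleftrightarrow> k \<le> - 1 \<or> (0 < k \<and> k \<le> b)"
    using two_removables[OF A s t only st(2) w] by metis
  define p where "p = s mod 2"
  define u where "u = s div 2"
  define v where "v = t div 2"
  have p: "p = 0 \<or> p = 1" unfolding p_def by auto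
  have s_eq: "s = 2 * u + p" unfolding u_def p_def by simp
  have t_eq: "t = 2 * v + (1 - p)" using st(2) unfolding v_def p_def by presburger
  have "north A (2 * k + p) \<longleftrightarrow> k \<le> u - a \<or> (u < k \<and> k \<le> u + 1) \<or> (u + 1 < k \<and> k \<le> u + 1)" for k
    using f[of "k - u"] unfolding s_eq by (auto simp: algebra_simps)
  from level_blocks[OF this] have l1: "core_level X p = u - a + 1"
    using tableau_level[OF T(1), of p] p ab T(2) by simp
  have "north A (2 * k + (1 - p)) \<longleftrightarrow> k \<le> v - 1 \<or> (v < k \<and> k \<le> v + b) \<or> (v + b < k \<and> k \<le> v + b)" for k
    using g[of "k - v"] unfolding t_eq by (auto simp: algebra_simps)
  from level_blocks[OF this] have l2: "core_level X (1 - p) = v - 1 + b"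
    using tableau_level[OF T(1), of "1 - p"] p ab T(2) by auto
  have eqI: "A = diagram_of_rows rs" if rs: "sorted_wrt (\<ge>) rs"
    "\<And>k. north (diagram_of_rows rs) (s + 2 * k) \<longleftrightarrow> k \<le> - a \<or> k = 1"
    "\<And>k. north (diagram_of_rows rs) (t + 2 * k) \<longleftrightarrow> k \<le> - 1 \<or> (0 < k \<and> k \<le> b)" for rs
  proof (rule young_eqI[OF A young_diagram_of_rows[OF rs(1)]])
    fix x
    show "north A x = north (diagram_of_rows rs) x"
    proof (cases "even (x - s)")
      case True
      then obtain k where "x - s = 2 * k" by blast
      then show ?thesis using rs(2)[of k] f[of k] by (simp add: algebra_simps)
    next
      case False
      then have "even (x - t)" using st(2) by presburger
      then obtain k where "x - t = 2 * k" by blast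
      then show ?thesis using rs(3)[of k] g[of k] by (simp add: algebra_simps)
    qed
  qed
  note diag = north_diagram_of_rows less_Suc_eq ex_disj_distrib conj_disj_distribR
  show ?thesis
  proof (cases X)
    case TypeC
    \<comment> \<open>The levels give s = 2a - 4 + p and t = 1 - p - 2b, so s < t means a + b < (5 -
      2p) / 2, which forces p = 0 and a = b = 1.\<close>
    then have "s = - 2" "t = - 1" "a = 1" "b = 1"
      using l1 l2 ab st p s_eq t_eq unfolding core_level_def by auto
    then have "A = diagram_of_rows [2, 2]"
      by (intro eqI; auto simp: diag; presburger)
    then show ?thesis using TypeC by simp
  next
    case TypeB
    \<comment> \<open>For p = 0 the levels give s = 2a - 2 and t = -1 - 2b, against s < t. For p = 1
      they give s = 2a - 5 and t = 2 - 2b, so a + b is at most 3, which leaves three pairs.\<close>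
    have "s = - 3 \<and> t = 0 \<and> a = 1 \<and> b = 1 \<or> s = - 3 \<and> t = - 2 \<and> a = 1 \<and> b = 2 \<or>
        s = - 1 \<and> t = 0 \<and> a = 2 \<and> b = 1"
    proof (cases "p = 0")
      case True
      then have "u - a + 1 = 0" "v - 1 + b = - 2" using l1 l2 TypeB by (simp_all add: core_level_def)
      then show ?thesis using True s_eq t_eq st(1) ab by presburger
    next
      case False
      then have "p = 1" "u - a + 1 = - 2" "v - 1 + b = 0" using p l1 l2 TypeB by (simp_all add: core_level_def)
      then show ?thesis using s_eq t_eq st(1) ab by presburger
    qed
    then have "A = diagram_of_rows [3, 1, 1] \<or> A = diagram_of_rows [3, 3, 1] \<or> A = diagram_of_rows [3, 2, 2]"
    proof (elim disjE conjE)
      assume "s = - 3" "t = 0" "a = 1" "b = 1"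
      then have "A = diagram_of_rows [3, 1, 1]" by (intro eqI; auto simp: diag; presburger)
      then show ?thesis by simp
    next
      assume "s = - 3" "t = - 2" "a = 1" "b = 2"
      then have "A = diagram_of_rows [3, 2, 2] \<or> A = diagram_of_rows [3, 3, 1]" by (intro disjI1 eqI; auto simp: diag; presburger)
      then show ?thesis by auto
    next
      assume "s = - 1" "t = 0" "a = 2" "b = 1"
      then have "A = diagram_of_rows [3, 3, 1]" by (intro eqI; auto simp: diag; presburger)
      then show ?thesis by simp
    qed
    then show ?thesis using TypeB by simp
  qed
qed

text \<open>The runner of \<open>s + 1\<close> has no free length, so its level fixes
  \<open>s\<close> within each parity. The level of the other runner then ties \<open>c\<close> to
  \<open>a\<close>, and the remaining parameter is the index of a family of quasi-staircases, one
  family for each parity of \<open>s\<close>.\<close>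

lemma three_removables_shape:
  assumes T: "domino_tableau X n T" "shape T = A"
    and only: "\<And>r. removable A r \<longleftrightarrow> r = s \<or> r = s + 1 \<or> r = s + 4"
    and w: "north A (s - 1)" "\<not> north A (s + 5)"
  shows "(\<exists>k\<ge>2. A = lambda_shape X k \<or> A = mu_shape X k) \<or> X = TypeC \<and> A = mu_shape TypeC 1"
proof -
  note A = tableau_young[OF T(1), unfolded T(2)]
  obtain a c where ac: "1 \<le> a" "1 \<le> c"
    and f: "\<And>k. north A (s + 2 * k) \<longleftrightarrow> k \<le> - a \<or> k = 1 \<or> (2 < k \<and> k \<le> 2 + c)"
    and g: "\<And>k. north A (s + 1 + 2 * k) \<longleftrightarrow> k \<le> - 1 \<or> k = 1"
    using three_removables[OF A only w] by metis
  define p where "p = s mod 2"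
  define u where "u = s div 2"
  have p: "p = 0 \<or> p = 1" unfolding p_def by auto
  have s_eq: "s = 2 * u + p" unfolding u_def p_def by simp
  have "north A (2 * k + p) \<longleftrightarrow> k \<le> u - a \<or> (u < k \<and> k \<le> u + 1) \<or> (u + 2 < k \<and> k \<le> u + 2 + c)" for k
    using f[of "k - u"] unfolding s_eq by (auto simp: algebra_simps)
  from level_blocks[OF this] have l1: "core_level X p = u - a + 1 + c"
    using tableau_level[OF T(1), of p] p ac T(2) by simp
  have "north A (2 * k + (1 - p)) \<longleftrightarrow> k \<le> u + p - 1 \<or> (u + p < k \<and> k \<le> u + p + 1) \<or>
      (u + p + 1 < k \<and> k \<le> u + p + 1)" for k
    using g[of "k - u - p"] p unfolding s_eq by (auto simp: algebra_simps)
  from level_blocks[OF this] have l2: "core_level X (1 - p) = u + p"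
    using tableau_level[OF T(1), of "1 - p"] p T(2) by auto
  have eqI: "A = B" if B: "young_diagram B"
    "\<And>k. north B (s + 2 * k) \<longleftrightarrow> k \<le> - a \<or> k = 1 \<or> (2 < k \<and> k \<le> 2 + c)"
    "\<And>k. north B (s + 1 + 2 * k) \<longleftrightarrow> k \<le> - 1 \<or> k = 1" for B
  proof (rule young_eqI[OF A B(1)])
    fix x
    show "north A x = north B x"
    proof (cases "even (x - s)")
      case True
      then obtain k where "x - s = 2 * k" by blast
      then show ?thesis using B(2)[of k] f[of k] by (simp add: algebra_simps)
    next
      case False
      then have "even (x - s - 1)" by presburger
      then obtain k where "x - s - 1 = 2 * k" by blast
      then show ?thesis using B(3)[of k] g[of k] by (simp add: algebra_simps)
    qed
  qed
  show ?thesis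
  proof (cases X)
    case TypeC
    then have "s = - 2 \<and> c = a - 1 \<or> s = - 3 \<and> c = a"
      using l1 l2 ac p s_eq unfolding core_level_def by auto
    then show ?thesis
    proof (elim disjE conjE)
      assume *: "s = - 2" "c = a - 1"
      define k where "k = nat a"
      have k: "a = int k" "2 \<le> k" using * ac by (auto simp: k_def)
      have "A = lambda_shape TypeC k"
        using * k by (intro eqI young_quasi_staircase; auto simp: north_lambda_C; presburger)
      then show ?thesis using k TypeC by blast
    next
      assume *: "s = - 3" "c = a"
      define k where "k = nat a"
      have k: "a = int k" "1 \<le> k" using * ac by (auto simp: k_def)
      have "A = mu_shape TypeC k"
        using * k by (intro eqI young_quasi_staircase; auto simp: north_mu_C; presburger)
      \<comment> \<open>For \<open>k = 1\<close> no operator \<open>Op_S'\<close> is admissible;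
        this shape, with rows 4, 2, 2, is left to \<open>U_op\<close>.\<close>
      moreover have "k = 1 \<or> 2 \<le> k" using k by auto
      ultimately show ?thesis using TypeC by blast
    qed
  next
    case TypeB
    then have "s = - 4 \<and> c = a + 1 \<or> s = - 1 \<and> a = c + 2"
      using l1 l2 ac p s_eq unfolding core_level_def by auto
    then show ?thesis
    proof (elim disjE conjE)
      assume *: "s = - 4" "c = a + 1"
      define k where "k = nat c"
      have k: "c = int k" "2 \<le> k" using * ac by (auto simp: k_def)
      have "A = lambda_shape TypeB k"
        using * k by (intro eqI young_quasi_staircase; auto simp: north_lambda_B; presburger)
      then show ?thesis using k TypeB by blast
    next
      assume *: "s = - 1" "a = c + 2"
      define k where "k = nat (c + 1)"
      have k: "c = int k - 1" "2 \<le> k" using * ac by (auto simp: k_def)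
      have "A = mu_shape TypeB k"
        using * k by (intro eqI young_quasi_staircase; auto simp: north_mu_B; presburger)
      then show ?thesis using k TypeB by blast
    qed
  qed
qed

section \<open>Cycles filling a box\<close>

lemma domino_transpose_12:
  assumes "prod.swap ` (domino T 1 \<union> domino T 2) = domino T 1 \<union> domino T 2"
  shows "domino (transpose_12 T) k =
    (if k = 1 \<or> k = 2 then prod.swap ` domino T k else domino T k)"
proof -
  have mem: "s \<in> prod.swap ` domino T m \<longleftrightarrow> prod.swap s \<in> domino T m" for s m
    by (cases s) (simp add: mem_swap_image)
  have st: "prod.swap s \<in> domino T 1 \<union> domino T 2 \<longleftrightarrow> s \<in> domino T 1 \<union> domino T 2" for s
    using assms by (metis mem Un_iff image_Un)
  show ?thesis
  proof (rule set_eqI)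
    fix s
    show "s \<in> domino (transpose_12 T) k \<longleftrightarrow>
        s \<in> (if k = 1 \<or> k = 2 then prod.swap ` domino T k else domino T k)"
      using st[of s] by (auto simp: mem mem_domino transpose_12_def simp del: swap_simp)
  qed
qed

lemma fixed_square:
  assumes "is_domino d"
  shows "fixed_square_of d \<in> d" "odd (fst (fixed_square_of d) + snd (fixed_square_of d))"
proof -
  have "\<exists>!s. s \<in> d \<and> odd (fst s + snd s)"
    using assms
  proof (cases rule: is_domino_cases)
    case (1 i j)
    show ?thesis
    proof (cases "odd (i + j)")
      case True
      show ?thesis by (rule ex1I[of _ "(i, j)"]) (use True 1 in auto)
    next
      case False
      show ?thesis by (rule ex1I[of _ "(i, j + 1)"]) (use False 1 in auto)
    qed
  next
    case (2 i j)
    show ?thesis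
    proof (cases "odd (i + j)")
      case True
      show ?thesis by (rule ex1I[of _ "(i, j)"]) (use True 2 in auto)
    next
      case False
      show ?thesis by (rule ex1I[of _ "(i + 1, j)"]) (use False 2 in auto)
    qed
  qed
  from theI'[OF this] show "fixed_square_of d \<in> d" "odd (fst (fixed_square_of d) + snd (fixed_square_of d))"
    unfolding fixed_square_of_def by auto
qed

lemma fixed_square_eqI:
  assumes "is_domino d" "(i, j) \<in> d" "odd (i + j)"
  shows "fixed_square_of d = (i, j)"
  using assms(1)
proof (cases rule: is_domino_cases)
  case (1 x y)
  then show ?thesis using fixed_square[OF assms(1)] assms(2,3) by auto
next
  case (2 x y)
  then show ?thesis using fixed_square[OF assms(1)] assms(2,3) by auto
qed

lemma moved_domino_cases:
  assumes "is_domino (domino T m)"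
  obtains p q where "T (p, q) = Some m" "odd (p + q)"
    "moved_domino T m = {(p, q), (p - 1, q)} \<and> enat m < label T (p - 1, q + 1) \<or>
     moved_domino T m = {(p, q), (p, q + 1)} \<and> \<not> enat m < label T (p - 1, q + 1) \<or>
     moved_domino T m = {(p, q), (p, q - 1)} \<and> enat m < label T (p + 1, q - 1) \<or>
     moved_domino T m = {(p, q), (p + 1, q)} \<and> \<not> enat m < label T (p + 1, q - 1)"
proof -
  obtain p q where pq: "fixed_square_of (domino T m) = (p, q)" by fastforce
  have "T (p, q) = Some m" "odd (p + q)" using fixed_square[OF assms] pq by (simp_all add: mem_domino)
  then show ?thesis using that[of p q] unfolding moved_domino_def pq by (auto split: if_splits)
qed

text \<open>Two dominos \<open>k\<close> and \<open>l\<close> tile a box whose upper left and lower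
  right squares are fixed. The labels in \<open>nbr\<close> belong to the squares adjacent to the
  two variable squares of the box from outside; they prevent other dominos from moving in. Moving
  through the cycle replaces one tiling of the box by the other.\<close>

context
  fixes X N T k l i j box
  assumes T: "domino_tableau X N T" and kl: "1 \<le> k" "k \<le> N" "1 \<le> l" "l \<le> N" "k \<noteq> l"
    and odd: "odd (i + j)" and box: "box = {(i, j), (i, j + 1), (i + 1, j), (i + 1, j + (1 :: int))}"
    and lab: "T (i, j) = Some k" "T (i + 1, j + 1) = Some l"
    and D: "domino T k \<union> domino T l = box"
    and M: "moved_domino T k \<union> moved_domino T l = box" "moved_domino T k \<inter> moved_domino T l = {}"
    and link: "domino T l \<inter> moved_domino T k \<noteq> {}"
    and nbr: "label T (i - 1, j + 1) < enat k" "label T (i + 1, j - 1) < enat k"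
      "enat l < label T (i, j + 2)" "enat l < label T (i + 2, j)"
begin

lemma box_pos: "1 \<le> i" "1 \<le> j"
  using lab(1) young_pos[OF tableau_young[OF T], of i j] by auto

lemma box_labels: "label T (i, j) = enat k" "label T (i + 1, j + 1) = enat l"
  using lab box_pos by (simp_all add: label_def)

text \<open>A domino outside the box cannot move into one of the two variable squares of the box: it
  would have to pass one of the four squares adjacent to them.\<close>

lemma moved_domino_outside:
  assumes m: "1 \<le> m" "m \<le> N" "m \<noteq> k" "m \<noteq> l"
  shows "moved_domino T m \<inter> box = {}"
proof (rule ccontr)
  assume "moved_domino T m \<inter> box \<noteq> {}"
  then obtain x y where xy: "(x, y) \<in> moved_domino T m" "(x, y) \<in> box" by fastforce
  obtain p q where pq: "T (p, q) = Some m" "odd (p + q)" and mv: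
    "moved_domino T m = {(p, q), (p - 1, q)} \<and> enat m < label T (p - 1, q + 1) \<or>
     moved_domino T m = {(p, q), (p, q + 1)} \<and> \<not> enat m < label T (p - 1, q + 1) \<or>
     moved_domino T m = {(p, q), (p, q - 1)} \<and> enat m < label T (p + 1, q - 1) \<or>
     moved_domino T m = {(p, q), (p + 1, q)} \<and> \<not> enat m < label T (p + 1, q - 1)"
    using moved_domino_cases[OF tableau_domino[OF T m(1,2)]] by metis
  have out: "(p, q) \<notin> box"
    using pq(1) m(3,4) unfolding D[symmetric] by (simp add: mem_domino)
  then have out': "(p, q) \<noteq> (i, j)" "(p, q) \<noteq> (i + 1, j + 1)" unfolding box by auto
  have pos: "1 \<le> p" "1 \<le> q" using pq(1) young_pos[OF tableau_young[OF T], of p q] by auto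
  then have lpq: "label T (p, q) = enat m" using pq(1) by (simp add: label_def)
  \<comment> \<open>A domino keeps its fixed square, so the square newly entered is a variable
    one.\<close>
  have xy': "(x, y) = (i, j + 1) \<or> (x, y) = (i + 1, j)"
  proof -
    have "(x, y) \<noteq> (p, q)" using xy(2) out by auto
    with mv xy(1) have "(x, y) \<in> {(p - 1, q), (p, q + 1), (p, q - 1), (p + 1, q)}" by fastforce
    then have "even (x + y)" using pq(2) by auto
    then show ?thesis using xy(2) odd unfolding box by auto
  qed
  from mv show False
  proof (elim disjE conjE)
    assume a: "moved_domino T m = {(p, q), (p - 1, q)}" "enat m < label T (p - 1, q + 1)"
    then have "(x, y) = (p - 1, q)" using xy out by auto
    \<comment> \<open>A domino that moves up into the box comes from directly below it, because
      \<open>out'\<close> excludes the fixed squares of the box. Its direction is then decided by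
      comparison with the label \<open>l\<close> of \<open>(i + 1, j + 1)\<close>, which is smaller.
      The other three directions are analogous.\<close>
    then have e: "p = i + 2" "q = j" using xy' out' by auto
    show False using a(2) lpq nbr(4) box_labels unfolding e by (simp add: add.commute)
  next
    assume a: "moved_domino T m = {(p, q), (p, q + 1)}" "\<not> enat m < label T (p - 1, q + 1)"
    then have "(x, y) = (p, q + 1)" using xy out by auto
    then have e: "p = i + 1" "q = j - 1" using xy' out' by auto
    show False using a(2) lpq nbr(2) box_labels unfolding e by (simp add: add.commute)
  next
    assume a: "moved_domino T m = {(p, q), (p, q - 1)}" "enat m < label T (p + 1, q - 1)"
    then have "(x, y) = (p, q - 1)" using xy out by auto
    then have e: "p = i" "q = j + 2" using xy' out' by auto
    show False using a(2) lpq nbr(3) box_labels unfolding e by (simp add: add.commute)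
  next
    assume a: "moved_domino T m = {(p, q), (p + 1, q)}" "\<not> enat m < label T (p + 1, q - 1)"
    then have "(x, y) = (p + 1, q)" using xy out by auto
    then have e: "p = i - 1" "q = j + 1" using xy' out' by auto
    show False using a(2) lpq nbr(1) box_labels unfolding e by (simp add: add.commute)
  qed
qed

text \<open>The dominos \<open>k\<close>, \<open>l\<close> and their moved versions fill the same
  box, and all other dominos avoid it before and after moving. Hence no link leaves {k, l}.\<close>

lemma cycle_box: "cycle_of N T k = {k, l}"
proof -
  have closed: "x \<in> {k, l} \<longleftrightarrow> y \<in> {k, l}" if "linked N T x y" for x y
  proof
    assume "x \<in> {k, l}"
    then have "domino T x \<subseteq> box" using D by auto
    then show "y \<in> {k, l}" using that moved_domino_outside[of y] unfolding linked_def by fastforce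
  next
    assume "y \<in> {k, l}"
    then have "moved_domino T y \<subseteq> box" using M(1) by auto
    then have "domino T x \<inter> box \<noteq> {}" using that unfolding linked_def by blast
    then have "domino T x \<inter> domino T k \<noteq> {} \<or> domino T x \<inter> domino T l \<noteq> {}" unfolding D[symmetric] by blast
    then show "x \<in> {k, l}" using domino_disjoint[of x _ T] by blast
  qed
  have "y \<in> {k, l}" if "equivclp (linked N T) k y" for y
    using that
  proof (induction rule: equivclp_induct)
    case (step y z)
    then show ?case using closed by blast
  qed simp
  moreover have "equivclp (linked N T) k l"
    using link kl by (intro r_into_equivclp converse_r_into_equivclp) (simp add: linked_def)
  ultimately show ?thesis unfolding cycle_of_def by auto
qed

lemma domino_move_box:
  "domino (move_through T {k, l}) m = (if m \<in> {k, l} then moved_domino T m else domino T m)"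
proof -
  \<comment> \<open>The definite description is meaningful because the two moved dominos are
    disjoint.\<close>
  have the: "(THE m. m \<in> {k, l} \<and> s \<in> moved_domino T m) = m" if "m \<in> {k, l}" "s \<in> moved_domino T m" for m s
    using that M(2) by (intro the_equality) auto
  have "move_through T {k, l} s = Some m \<longleftrightarrow> s \<in> (if m \<in> {k, l} then moved_domino T m else domino T m)" for s
  proof (cases "s \<in> box")
    case True
    then obtain c where c: "c \<in> {k, l}" "s \<in> moved_domino T c" using M(1) by auto
    then have "move_through T {k, l} s = Some c" unfolding move_through_def using the[OF c] by auto
    moreover have "s \<in> moved_domino T m \<longleftrightarrow> m = c" if "m \<in> {k, l}" for m using c that M(2) by auto
    moreover have "s \<notin> domino T m" if "m \<notin> {k, l}" for m
      using True that unfolding D[symmetric] by (auto simp: mem_domino)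
    ultimately show ?thesis using c(1) by (cases "m \<in> {k, l}") auto
  next
    case False
    then have "\<not> (\<exists>c\<in>{k, l}. s \<in> moved_domino T c)" using M(1) by auto
    moreover have "\<not> (\<exists>c\<in>{k, l}. s \<in> domino T c)" using False D by auto
    ultimately show ?thesis unfolding move_through_def by (auto simp: mem_domino)
  qed
  then show ?thesis unfolding domino_def[of "move_through T {k, l}"] by (simp only: Collect_mem_eq)
qed

lemma closed_cycle_box: "closed_cycle T {k, l}"
proof -
  have "shape U = (\<Union>m. domino U m)" for U by (auto simp: mem_domino)
  then have "shape (move_through T {k, l}) = (\<Union>m. if m \<in> {k, l} then moved_domino T m else domino T m)"
    by (simp only: domino_move_box)
  also have "\<dots> = (moved_domino T k \<union> moved_domino T l) \<union> (\<Union>m\<in>- {k, l}. domino T m)" by auto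
  also have "\<dots> = (domino T k \<union> domino T l) \<union> (\<Union>m\<in>- {k, l}. domino T m)" using D M(1) by simp
  also have "\<dots> = shape T" by (auto simp: mem_domino)
  finally show ?thesis unfolding closed_cycle_def domino_move_box using kl by auto
qed

end

section \<open>Operators for roots of different lengths, applied to extensions\<close>

context operator_family
begin

lemma step_U:
  assumes T: "domino_tableau X N T" "basic X T" and N: "2 \<le> N" and ab: "{a, b} = {1, 2 :: nat}"
    and tau: "b \<in> tau N T" "a \<notin> tau N T"
    and T': "T' = transpose_12 T \<or> closed_cycle (transpose_12 T) (cycle_of N (transpose_12 T) 2) \<and>
      T' = move_through (transpose_12 T) (cycle_of N (transpose_12 T) 2)"
  shows "step N T T'"
  unfolding step_def
proof (intro exI[of _ "Op_U a b"] conjI allI impI)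
  show "admissible N (Op_U a b)" using N ab by simp
  fix T2 assume p: "(T, T2) \<in> tableau_pairs X N"
  have "(T', T2) \<in> U_on_basic X N a b (T, T2)"
    unfolding U_on_basic_def using p T tau T' by blast
  then show "(T', T2) \<in> apply_op X N Q Q' (Op_U a b) (T, T2)"
    using p T N ab tau by (simp add: U_op_def)
qed

text \<open>On a tableau that is not basic the operator is defined as the inverse relation, so it
  suffices that \<open>T\<close> is basic and has \<open>T'\<close> among its values.\<close>

lemma step_U_inverse:
  assumes T: "domino_tableau X N T" "basic X T" and N: "2 \<le> N" and ab: "{a, b} = {1, 2 :: nat}"
    and tau: "b \<in> tau N T" "a \<notin> tau N T"
    and T': "closed_cycle (transpose_12 T) (cycle_of N (transpose_12 T) 2)"
      "T' = move_through (transpose_12 T) (cycle_of N (transpose_12 T) 2)"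
    and inv: "\<not> basic X T'" "shape T' = shape T" "a \<in> tau N T'" "b \<notin> tau N T'"
  shows "step N T' T"
  unfolding step_def
proof (intro exI[of _ "Op_U b a"] conjI allI impI)
  show "admissible N (Op_U b a)" using N ab by (simp add: insert_commute)
  fix T2 assume p: "(T', T2) \<in> tableau_pairs X N"
  then have p': "(T, T2) \<in> tableau_pairs X N" using T inv(2) by (simp add: tableau_pairs_def)
  have "(T', T2) \<in> U_on_basic X N a b (T, T2)"
    unfolding U_on_basic_def using p' T tau T' by blast
  then show "(T, T2) \<in> apply_op X N Q Q' (Op_U b a) (T', T2)"
    using p T N ab tau inv by (simp add: U_op_def insert_commute)
qed

end

lemma is_domino_pair_iff: "is_domino {(i, j), (i', j')} \<longleftrightarrow> \<bar>i - i'\<bar> + \<bar>j - j'\<bar> = 1"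
proof
  assume "\<bar>i - i'\<bar> + \<bar>j - j'\<bar> = 1"
  then consider "i' = i" "j' = j + 1" | "i' = i" "j = j' + 1" | "i' = i + 1" "j' = j" | "i = i' + 1" "j' = j"
    by linarith
  then show "is_domino {(i, j), (i', j')}"
    by cases (simp_all add: is_domino_def horizontal_pair vertical_pair insert_commute[of "(_ + 1, _)"]
      insert_commute[of "(_, _ + 1)"])
qed (rule is_domino_pair)

lemma horizontal_pair_iff: "horizontal {(i, j), (i', j')} \<longleftrightarrow> i = i' \<and> \<bar>j - j'\<bar> = 1"
proof
  assume "horizontal {(i, j), (i', j')}"
  then obtain x y where "{(i, j), (i', j')} = {(x, y), (x, y + 1)}" unfolding horizontal_def by blast
  then show "i = i' \<and> \<bar>j - j'\<bar> = 1" by (auto simp: doubleton_eq_iff)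
next
  assume "i = i' \<and> \<bar>j - j'\<bar> = 1"
  then consider "i' = i" "j' = j + 1" | "i' = i" "j = j' + 1" by linarith
  then show "horizontal {(i, j), (i', j')}"
    by cases (simp_all add: horizontal_pair insert_commute[of "(_, _ + 1)"])
qed

lemma vertical_pair_iff: "vertical {(i, j), (i', j')} \<longleftrightarrow> j = j' \<and> \<bar>i - i'\<bar> = 1"
  using horizontal_swap[of "{(i, j), (i', j')}"] by (simp add: horizontal_pair_iff)

lemma moved_domino_box:
  assumes odd: "odd (i + j)"
  shows "domino T k = {(i, j), (i, j + 1)} \<Longrightarrow> label T (i + 1, j - 1) < enat k \<Longrightarrow>
      moved_domino T k = {(i, j), (i + 1, j)}"
    and "domino T k = {(i, j), (i + 1, j)} \<Longrightarrow> label T (i - 1, j + 1) < enat k \<Longrightarrow>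
      moved_domino T k = {(i, j), (i, j + 1)}"
    and "domino T k = {(i + 1, j), (i + 1, j + 1)} \<Longrightarrow> enat k < label T (i, j + 2) \<Longrightarrow>
      moved_domino T k = {(i, j + 1), (i + 1, j + 1)}"
    and "domino T k = {(i, j + 1), (i + 1, j + 1)} \<Longrightarrow> enat k < label T (i + 2, j) \<Longrightarrow>
      moved_domino T k = {(i + 1, j), (i + 1, j + 1)}"
proof -
  have odd': "odd ((i + 1) + (j + 1))" using odd by simp
  have fix1: "fixed_square_of d = (i, j)" if "is_domino d" "(i, j) \<in> d" for d
    using fixed_square_eqI[OF that odd] .
  have fix2: "fixed_square_of d = (i + 1, j + 1)" if "is_domino d" "(i + 1, j + 1) \<in> d" for d
    using fixed_square_eqI[OF that odd'] .
  show "moved_domino T k = {(i, j), (i + 1, j)}"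
    if d: "domino T k = {(i, j), (i, j + 1)}" and l: "label T (i + 1, j - 1) < enat k"
  proof -
    have "fixed_square_of (domino T k) = (i, j)" unfolding d by (rule fix1) (simp_all add: is_domino_pair_iff)
    then show ?thesis unfolding moved_domino_def d using l by (simp add: doubleton_eq_iff)
  qed
  show "moved_domino T k = {(i, j), (i, j + 1)}"
    if d: "domino T k = {(i, j), (i + 1, j)}" and l: "label T (i - 1, j + 1) < enat k"
  proof -
    have "fixed_square_of (domino T k) = (i, j)" unfolding d by (rule fix1) (simp_all add: is_domino_pair_iff)
    then show ?thesis unfolding moved_domino_def d using l by (simp add: doubleton_eq_iff)
  qed
  show "moved_domino T k = {(i, j + 1), (i + 1, j + 1)}"
    if d: "domino T k = {(i + 1, j), (i + 1, j + 1)}" and l: "enat k < label T (i, j + 2)"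
  proof -
    have "fixed_square_of (domino T k) = (i + 1, j + 1)" unfolding d by (rule fix2) (simp_all add: is_domino_pair_iff)
    then show ?thesis unfolding moved_domino_def d using l
      by (simp add: doubleton_eq_iff add.commute insert_commute)
  qed
  show "moved_domino T k = {(i + 1, j), (i + 1, j + 1)}"
    if d: "domino T k = {(i, j + 1), (i + 1, j + 1)}" and l: "enat k < label T (i + 2, j)"
  proof -
    have "fixed_square_of (domino T k) = (i + 1, j + 1)" unfolding d by (rule fix2) (simp_all add: is_domino_pair_iff)
    then show ?thesis unfolding moved_domino_def d using l
      by (simp add: doubleton_eq_iff add.commute insert_commute)
  qed
qed

lemma tau_restrict:
  assumes "restrict_labels n T = B" "k \<le> n" "n \<le> N"
  shows "k \<in> tau N T \<longleftrightarrow> k \<in> tau n B"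
proof -
  have "domino T m = domino B m" if "m \<le> n" for m using domino_restrict[OF that, of T] assms(1) by simp
  from this[of k] this[of "k - 1"] this[of 1] show ?thesis using assms(2,3) by (auto simp: tau_def)
qed

lemma basic_cong: "domino T 1 = domino T' 1 \<Longrightarrow> domino T 2 = domino T' 2 \<Longrightarrow> basic X T \<longleftrightarrow> basic X T'"
  by (cases X) (simp_all add: basic_def)

context operator_family
begin

lemma override_transpose_12:
  assumes N: "n \<le> N" "domino_tableau X N T" "restrict_labels n T = B" and n: "2 \<le> n"
    and B: "domino_tableau X n B" "domino_tableau X n C" "shape C = shape B"
    and stable: "prod.swap ` (domino B 1 \<union> domino B 2) = domino B 1 \<union> domino B 2"
    and C: "domino C 1 = prod.swap ` domino B 1" "domino C 2 = prod.swap ` domino B 2"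
      "\<And>k. 3 \<le> k \<Longrightarrow> k \<le> n \<Longrightarrow> domino C k = domino B k"
  shows "transpose_12 T = T ++ C"
proof (rule tableau_eqI)
  fix k
  have sh: "shape C = shape (restrict_labels n T)" using N(3) B(3) by simp
  have DT: "domino T m = domino B m" if "m \<le> n" for m using domino_restrict[OF that, of T] N(3) by simp
  have st: "prod.swap ` (domino T 1 \<union> domino T 2) = domino T 1 \<union> domino T 2"
    using stable DT[of 1] DT[of 2] n by simp
  have C0: "domino C 0 = domino B 0" using tableau_zero[OF B(1)] tableau_zero[OF B(2)] by simp
  note eqs = domino_transpose_12[OF st] domino_override[OF N(2,1) B(2) sh]
  consider "k = 0" | "k = 1" | "k = 2" | "3 \<le> k" "k \<le> n" | "n < k" by linarith
  then show "domino (transpose_12 T) k = domino (T ++ C) k"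
  proof cases
    case 1
    then show ?thesis unfolding eqs using DT[of 0] C0 by simp
  next
    case 2
    then show ?thesis unfolding eqs using DT[of 1] C(1) n by simp
  next
    case 3
    then show ?thesis unfolding eqs using DT[of 2] C(2) n by simp
  next
    case 4
    then show ?thesis unfolding eqs using DT[of k] C(3)[of k] by simp
  next
    case 5
    then show ?thesis unfolding eqs using n by simp
  qed
qed

text \<open>Both tableaux are basic, and transposing the two smallest dominos a second time leads
  back, so both directions use the first kind of value.\<close>

lemma joined_U_basic:
  assumes B: "domino_tableau X 2 B" "domino_tableau X 2 C" "shape C = shape B"
    and stable: "prod.swap ` (domino B 1 \<union> domino B 2) = domino B 1 \<union> domino B 2"
    and C: "domino C 1 = prod.swap ` domino B 1" "domino C 2 = prod.swap ` domino B 2"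
    and basic: "basic X B" "basic X C"
    and tau: "2 \<in> tau 2 B" "1 \<notin> tau 2 B" "1 \<in> tau 2 C" "2 \<notin> tau 2 C"
  shows "joined 2 B C" "joined 2 C B"
proof -
  have "step N T (T ++ C) \<and> step N (T ++ C) T"
    if N: "2 \<le> N" "domino_tableau X N T" "restrict_labels 2 T = B" for N T
  proof -
    have sh: "shape C = shape (restrict_labels 2 T)" using N(3) B(3) by simp
    let ?T = "T ++ C"
    have T': "domino_tableau X N ?T" "restrict_labels 2 ?T = C"
      using override_tableau[OF N(2,1) B(2) sh] restrict_override[OF N(2,1) B(2) sh] .
    have DT: "domino T m = domino B m" "domino ?T m = domino C m" if "m \<le> 2" for m
      using domino_restrict[OF that, of T] domino_restrict[OF that, of ?T] N(3) T'(2) by simp_all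
    have 1: "?T = transpose_12 T"
      using override_transpose_12[OF N order_refl B stable C] by simp
    have st: "prod.swap ` (domino C 1 \<union> domino C 2) = domino C 1 \<union> domino C 2"
      using stable unfolding C image_Un swap_swap_image by blast
    have C': "domino B 1 = prod.swap ` domino C 1" "domino B 2 = prod.swap ` domino C 2"
      unfolding C swap_swap_image by simp_all
    have "transpose_12 ?T = ?T ++ B"
      by (rule override_transpose_12[OF N(1) T' order_refl B(2,1) B(3)[symmetric] st C']) simp
    also have "?T ++ B = T ++ B"
    proof (rule ext)
      fix s
      have "s \<in> shape B \<longleftrightarrow> s \<in> shape C" using B(3) by simp
      then show "(?T ++ B) s = (T ++ B) s" by (auto simp: map_add_def split: option.splits)
    qed
    also have "\<dots> = T" using N(3) override_restrict[of T 2] by simp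
    finally have 2: "T = transpose_12 ?T" by simp
    have bas: "basic X T" "basic X ?T"
      using basic basic_cong[of T B X] basic_cong[of ?T C X] DT by simp_all
    have tauT: "2 \<in> tau N T" "1 \<notin> tau N T" "1 \<in> tau N ?T" "2 \<notin> tau N ?T"
      using tau tau_restrict[OF N(3) _ N(1)] tau_restrict[OF T'(2) _ N(1)] by simp_all
    have ab: "{1, 2} = {1, 2 :: nat}" "{2, 1} = {1, 2 :: nat}" by auto
    show ?thesis
      using step_U[OF N(2) bas(1) N(1) ab(1) tauT(1,2) disjI1[OF 1]]
        step_U[OF T'(1) bas(2) N(1) ab(2) tauT(3,4) disjI1[OF 2]] by blast
  qed
  note st = this
  show "joined 2 B C" "joined 2 C B" by (rule joined_both[OF B], rule st, assumption+)+
qed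

text \<open>A single value of the operator passes through the intermediate tableau \<open>C\<close>:
  transposing the dominos 1 and 2 brings 2 into a common box with \<open>l\<close>, and the closed
  cycle {2, l} then turns this box. The way back is the inverse relation, available since
  \<open>B'\<close> is not basic.\<close>

lemma joined_U_closed:
  assumes B: "domino_tableau X n B" "domino_tableau X n C" "domino_tableau X n B'"
      "shape C = shape B" "shape B' = shape B"
    and l: "3 \<le> l" "l \<le> n"
    and basic: "basic X B" "\<not> basic X B'"
    and ab: "{a, b} = {1, 2}" and tau: "b \<in> tau n B" "a \<notin> tau n B" "a \<in> tau n B'" "b \<notin> tau n B'"
    and stable: "prod.swap ` (domino B 1 \<union> domino B 2) = domino B 1 \<union> domino B 2"
    and C: "domino C 1 = prod.swap ` domino B 1" "domino C 2 = prod.swap ` domino B 2"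
      "\<And>k. 3 \<le> k \<Longrightarrow> k \<le> n \<Longrightarrow> domino C k = domino B k"
    and odd: "odd (i + j)"
    and box: "domino C 2 = {(i, j), (i, j + 1)} \<and> domino C l = {(i + 1, j), (i + 1, j + 1)} \<and>
        domino B' 2 = {(i, j), (i + 1, j)} \<and> domino B' l = {(i, j + 1), (i + 1, j + 1)} \<or>
      domino C 2 = {(i, j), (i + 1, j)} \<and> domino C l = {(i, j + 1), (i + 1, j + 1)} \<and>
        domino B' 2 = {(i, j), (i, j + 1)} \<and> domino B' l = {(i + 1, j), (i + 1, j + 1)}"
    and B': "\<And>k. 1 \<le> k \<Longrightarrow> k \<le> n \<Longrightarrow> k \<noteq> 2 \<Longrightarrow> k \<noteq> l \<Longrightarrow> domino B' k = domino C k"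
    and nbr: "label C (i - 1, j + 1) < 2" "label C (i + 1, j - 1) < 2"
      "enat l < label C (i, j + 2)" "enat l < label C (i + 2, j)"
  shows "joined n B B'" "joined n B' B"
proof -
  have n: "2 \<le> n" using l by simp
  have "step N T (T ++ B') \<and> step N (T ++ B') T"
    if N: "n \<le> N" "domino_tableau X N T" "restrict_labels n T = B" for N T
  proof -
    have shC: "shape C = shape (restrict_labels n T)" and shB': "shape B' = shape (restrict_labels n T)"
      using N(3) B(4,5) by simp_all
    let ?T1 = "T ++ C" and ?T' = "T ++ B'"
    let ?c = "{2, l}"
    have T1: "domino_tableau X N ?T1" and T': "domino_tableau X N ?T'" "restrict_labels n ?T' = B'"
      using override_tableau[OF N(2,1) B(2) shC] override_tableau[OF N(2,1) B(3) shB']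
        restrict_override[OF N(2,1) B(3) shB'] by simp_all
    note D1 = domino_override[OF N(2,1) B(2) shC] and D' = domino_override[OF N(2,1) B(3) shB']
    have DT: "domino T m = domino B m" if "m \<le> n" for m using domino_restrict[OF that, of T] N(3) by simp
    have tr: "transpose_12 T = ?T1" by (rule override_transpose_12[OF N n B(1,2,4) stable C])
    have small: "label ?T1 s < enat 2" if "label C s < 2" for s
      using that by (cases "C s") (auto simp: label_def numeral_eq_enat split: if_splits)
    \<comment> \<open>In an extension, a square outside the shape of \<open>C\<close> may receive a
      label, but only one larger than \<open>n\<close>, so the lower bound survives.\<close>
    have large: "enat l < label ?T1 s" if "enat l < label C s" for s
    proof (cases "C s")
      case None
      have eq: "?T1 s = T s" using None by (simp add: map_add_def)
      have "n < m" if "T s = Some m" for m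
        using that None eq override_apply[OF N(2,1) B(2) shC, of s m] by (simp split: if_splits)
      then show ?thesis using that None l unfolding label_def eq by (cases "T s") (auto split: if_splits)
    next
      case (Some m)
      then have "?T1 s = Some m" by simp
      then have "label ?T1 s = label C s" using Some unfolding label_def by simp
      then show ?thesis using that by simp
    qed
    note nbr1 = small[OF nbr(1)] small[OF nbr(2)] large[OF nbr(3)] large[OF nbr(4)]
    have lN: "l \<le> N" "2 \<le> N" using l N(1) by auto
    have D2l: "domino ?T1 2 = domino C 2" "domino ?T1 l = domino C l" using D1 l n by simp_all
    have M: "moved_domino ?T1 2 = domino B' 2" "moved_domino ?T1 l = domino B' l"
      using box by (elim disjE conjE; simp add: D2l moved_domino_box[OF odd] nbr1)+
    have lab: "?T1 (i, j) = Some 2" "?T1 (i + 1, j + 1) = Some l"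
      using box D2l by (auto simp flip: mem_domino simp del: map_add_Some_iff)
    let ?box = "{(i, j), (i, j + 1), (i + 1, j), (i + 1, j + 1)}"
    have U: "domino ?T1 2 \<union> domino ?T1 l = ?box" unfolding D2l using box by auto
    have MU: "moved_domino ?T1 2 \<union> moved_domino ?T1 l = ?box" "moved_domino ?T1 2 \<inter> moved_domino ?T1 l = {}"
      "domino ?T1 l \<inter> moved_domino ?T1 2 \<noteq> {}"
      unfolding M D2l using box by (elim disjE conjE; simp; auto)+
    have l2: "(1 :: nat) \<le> 2" "1 \<le> l" "2 \<noteq> l" using l by auto
    note cyc = cycle_box[OF T1 l2(1) lN(2) l2(2) lN(1) l2(3) odd refl lab U MU nbr1]
    note clo = closed_cycle_box[OF T1 l2(1) lN(2) l2(2) lN(1) l2(3) odd refl lab U MU nbr1]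
    note mov = domino_move_box[OF T1 l2(1) lN(2) l2(2) lN(1) l2(3) odd refl lab U MU nbr1]
    have eq: "?T' = move_through ?T1 {2, l}"
    proof (rule tableau_eqI)
      fix m
      have "domino B' 0 = domino C 0" using tableau_zero[OF B(2)] tableau_zero[OF B(3)] by simp
      then have "domino B' m = domino C m" if "m \<le> n" "m \<notin> {2, l}" using B'[of m] that by (cases m) auto
      then show "domino ?T' m = domino (move_through ?T1 {2, l}) m"
        unfolding mov D' D1 using M l n by auto
    qed
    have closed: "closed_cycle (transpose_12 T) (cycle_of N (transpose_12 T) 2)"
      "?T' = move_through (transpose_12 T) (cycle_of N (transpose_12 T) 2)"
      unfolding tr cyc using clo eq by simp_all
    have "domino ?T' m = domino B' m" if "m \<le> n" for m using D' that by simp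
    then have bas: "basic X T" "\<not> basic X ?T'"
      using basic basic_cong[of T B X] basic_cong[of ?T' B' X] DT n by simp_all
    have kn: "a \<le> n" "b \<le> n" using ab n by (auto simp: doubleton_eq_iff)
    have tauT: "b \<in> tau N T" "a \<notin> tau N T" "a \<in> tau N ?T'" "b \<notin> tau N ?T'"
      using tau tau_restrict[OF N(3) _ N(1)] tau_restrict[OF T'(2) _ N(1)] kn by simp_all
    have sh: "shape ?T' = shape T" by (rule shape_override[OF N(2,1) B(3) shB'])
    show ?thesis
      using step_U[OF N(2) bas(1) lN(2) ab tauT(1,2) disjI2[OF conjI[OF closed]]]
        step_U_inverse[OF N(2) bas(1) lN(2) ab tauT(1,2) closed bas(2) sh tauT(3,4)] by blast
  qed
  note st = this
  show "joined n B B'" "joined n B' B" by (rule joined_both[OF B(1,3,5)], rule st, assumption+)+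
qed

text \<open>Orientation replaces parity because it can be read off from an explicit tableau. In the
  shapes where this is used, two removable positions of different orientation also have different
  parity.\<close>

definition mixed :: "nat \<Rightarrow> square set \<Rightarrow> bool" where
  "mixed n A \<longleftrightarrow> (\<exists>x y. removable A x \<and> removable A y \<and> top_joined n A x y \<and>
     \<not> north A (x + 1) \<and> north A (y + 1))"

lemma mixedI:
  assumes B: "domino_tableau X (Suc m) B" "shape B = A" and B': "domino_tableau X (Suc m) B'" "shape B' = A"
    and j: "joined (Suc m) B B'" "joined (Suc m) B' B"
    and top: "horizontal (domino B (Suc m))" "vertical (domino B' (Suc m))"
  shows "mixed (Suc m) A"
proof -
  note A = tableau_young[OF B(1), unfolded B(2)]
  obtain x where x: "removable A x" "domino B (Suc m) = rim A x"
    using top_domino[OF B(1)] unfolding B(2) by metis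
  obtain y where y: "removable A y" "domino B' (Suc m) = rim A y"
    using top_domino[OF B'(1)] unfolding B'(2) by metis
  have "top_joined (Suc m) A x y" unfolding top_joined_def using B B' j x y by blast
  then show ?thesis unfolding mixed_def
    using x y top horizontal_rim[OF A, of x] vertical_rim[OF A, of y] by auto
qed

end

section \<open>Small shapes\<close>

fun cells :: "cartan_type \<Rightarrow> square set list \<Rightarrow> square set" where
  "cells TypeC [] = {}"
| "cells TypeB [] = {(1, 1)}"
| "cells X (d # ds) = cells X ds \<union> d"

fun build :: "cartan_type \<Rightarrow> square set list \<Rightarrow> tableau" where
  "build TypeC [] = Map.empty"
| "build TypeB [] = [(1, 1) \<mapsto> 0]"
| "build X (d # ds) = place (build X ds) d (Suc (length ds))"

fun valid :: "cartan_type \<Rightarrow> square set list \<Rightarrow> bool" where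
  "valid X [] = True"
| "valid X (d # ds) \<longleftrightarrow> valid X ds \<and> is_domino d \<and> d \<inter> cells X ds = {} \<and> young_diagram (cells X (d # ds))"

declare build.simps [simp del] valid.simps [simp del]

text \<open>Checking the upper and the left neighbour of every square suffices, which the simplifier
  can do for an explicit finite set.\<close>

lemma young_explicit:
  assumes "finite A"
    and pred: "\<forall>(i, j)\<in>A. 1 \<le> i \<and> 1 \<le> j \<and> (i = 1 \<or> (i - 1, j) \<in> A) \<and> (j = 1 \<or> (i, j - 1) \<in> A)"
  shows "young_diagram A"
proof -
  have up: "(i', j) \<in> A" if "i' \<le> i" "(i, j) \<in> A" "1 \<le> i'" for i i' j
    using that
  proof (induction i' rule: int_le_induct)
    case (step x)
    then have "(x, j) \<in> A" by simp
    then show ?case using pred step.prems by fastforce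
  qed
  have left: "(i, j') \<in> A" if "j' \<le> j" "(i, j) \<in> A" "1 \<le> j'" for i j j'
    using that
  proof (induction j' rule: int_le_induct)
    case (step x)
    then have "(i, x) \<in> A" by simp
    then show ?case using pred step.prems by fastforce
  qed
  show ?thesis unfolding young_diagram_def using assms up left by fast
qed

lemma build:
  assumes "valid X ds"
  shows "domino_tableau X (length ds) (build X ds)" "shape (build X ds) = cells X ds"
    "1 \<le> k \<Longrightarrow> k \<le> length ds \<Longrightarrow> domino (build X ds) k = ds ! (length ds - k)"
proof -
  have "domino_tableau X (length ds) (build X ds) \<and> shape (build X ds) = cells X ds \<and>
      (\<forall>k. 1 \<le> k \<longrightarrow> k \<le> length ds \<longrightarrow> domino (build X ds) k = ds ! (length ds - k))"
    using assms
  proof (induction ds)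
    case Nil
    show ?case
    proof (cases X)
      case TypeC
      then show ?thesis
        by (auto intro!: tableauI weakly_increasingI simp: young_empty domino_def build.simps)
    next
      case TypeB
      have "domino_tableau TypeB 0 [(1, 1) \<mapsto> 0]"
      proof (rule tableauI)
        show "young_diagram (shape [(1, 1) \<mapsto> 0])" using young_insert[OF young_empty, of 1 1] by simp
        show "weakly_increasing [(1, 1) \<mapsto> 0]" by (rule weakly_increasingI) (auto split: if_splits)
      qed (auto simp: domino_def split: if_splits)
      then show ?thesis unfolding TypeB build.simps cells.simps list.size
      proof (intro conjI allI impI)
        show "shape [(1 :: int, 1 :: int) \<mapsto> 0 :: nat] = {(1, 1)}" by simp
        show "domino_tableau TypeB 0 [(1, 1) \<mapsto> 0]" by fact
      qed simp
    qed
  next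
    case (Cons d ds)
    let ?B = "build X ds"
    have IH: "domino_tableau X (length ds) ?B" "shape ?B = cells X ds"
      "\<And>k. 1 \<le> k \<Longrightarrow> k \<le> length ds \<Longrightarrow> domino ?B k = ds ! (length ds - k)"
      and d: "is_domino d" "d \<inter> shape ?B = {}" "young_diagram (shape ?B \<union> d)"
      using Cons by (auto simp: valid.simps)
    have "domino (place ?B d (Suc (length ds))) k = (d # ds) ! (length (d # ds) - k)"
      if k: "1 \<le> k" "k \<le> length (d # ds)" for k
    proof (cases "k = Suc (length ds)")
      case True
      then show ?thesis using domino_place_new[OF IH(1), of "Suc (length ds)" d] by simp
    next
      case False
      then have "length (d # ds) - k = Suc (length ds - k)" using k by auto
      then show ?thesis using domino_place_old[OF d(2) False] IH(3)[of k] k False by simp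
    qed
    then show ?case using place_tableau[OF IH(1) d] IH(2) by (simp add: shape_place build.simps)
  qed
  then show "domino_tableau X (length ds) (build X ds)" "shape (build X ds) = cells X ds"
    "1 \<le> k \<Longrightarrow> k \<le> length ds \<Longrightarrow> domino (build X ds) k = ds ! (length ds - k)" by auto
qed

lemma build_2:
  assumes "valid X [d2, d1]"
  shows "domino_tableau X 2 (build X [d2, d1])" "shape (build X [d2, d1]) = cells X [d2, d1]"
    "domino (build X [d2, d1]) 1 = d1" "domino (build X [d2, d1]) 2 = d2"
  using build[OF assms] by (simp_all add: numeral_2_eq_2)

lemma diagram_of_rows_Union:
  "diagram_of_rows rs = (\<Union>i<length rs. {int i + 1} \<times> {1..int (rs ! i)})"
proof (intro set_eqI iffI)
  fix s assume "s \<in> diagram_of_rows rs"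
  then obtain i j where s: "s = (i, j)" "1 \<le> i" "i \<le> int (length rs)" "1 \<le> j" "j \<le> int (rs ! nat (i - 1))"
    by (auto simp: diagram_of_rows_def)
  then show "s \<in> (\<Union>i<length rs. {int i + 1} \<times> {1..int (rs ! i)})"
    by (intro UN_I[of "nat (i - 1)"]) auto
qed (auto simp: diagram_of_rows_def)

lemma interval_explicit: "{1..1 :: int} = {1}" "{1..2 :: int} = {1, 2}" "{1..3 :: int} = {1, 2, 3}"
    "{1..4 :: int} = {1, 2, 3, 4}"
  by auto

lemmas diagram_explicit = diagram_of_rows_Union interval_explicit lessThan_Suc

lemmas tableau_explicit = tau_def basic_def lies_below_def vertical_pair_iff horizontal_pair_iff

lemma valid_explicit:
  "valid TypeC [{(2, 1), (2, 2)}, {(1, 1), (1, 2)}]"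
  "valid TypeC [{(1, 2), (2, 2)}, {(1, 1), (2, 1)}]"
  "valid TypeB [{(2, 1), (3, 1)}, {(1, 2), (1, 3)}]"
  "valid TypeB [{(1, 2), (1, 3)}, {(2, 1), (3, 1)}]"
  "valid TypeB [{(2, 2), (2, 3)}, {(2, 1), (3, 1)}, {(1, 2), (1, 3)}]"
  "valid TypeB [{(2, 2), (2, 3)}, {(1, 2), (1, 3)}, {(2, 1), (3, 1)}]"
  "valid TypeB [{(1, 3), (2, 3)}, {(1, 2), (2, 2)}, {(2, 1), (3, 1)}]"
  "valid TypeB [{(2, 2), (3, 2)}, {(1, 2), (1, 3)}, {(2, 1), (3, 1)}]"
  "valid TypeB [{(2, 2), (3, 2)}, {(2, 1), (3, 1)}, {(1, 2), (1, 3)}]"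
  "valid TypeB [{(3, 1), (3, 2)}, {(2, 1), (2, 2)}, {(1, 2), (1, 3)}]"
  "valid TypeC [{(3, 1), (3, 2)}, {(1, 3), (1, 4)}, {(1, 2), (2, 2)}, {(1, 1), (2, 1)}]"
  "valid TypeC [{(3, 1), (3, 2)}, {(1, 3), (1, 4)}, {(2, 1), (2, 2)}, {(1, 1), (1, 2)}]"
  "valid TypeC [{(2, 2), (3, 2)}, {(1, 3), (1, 4)}, {(2, 1), (3, 1)}, {(1, 1), (1, 2)}]"
  "valid TypeC [{(1, 3), (2, 3)}, {(3, 1), (4, 1)}, {(2, 1), (2, 2)}, {(1, 1), (1, 2)}]"
  "valid TypeC [{(1, 3), (2, 3)}, {(3, 1), (4, 1)}, {(1, 2), (2, 2)}, {(1, 1), (2, 1)}]"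
  "valid TypeC [{(2, 2), (2, 3)}, {(3, 1), (4, 1)}, {(1, 2), (1, 3)}, {(1, 1), (2, 1)}]"
  by (simp_all add: valid.simps is_domino_pair_iff young_explicit)

context operator_family
begin

lemma mixed_22:
  assumes X: "X = TypeC"
  shows "mixed 2 (diagram_of_rows [2, 2])"
proof -
  define B where "B = build X [{(2, 1), (2, 2)}, {(1, 1), (1, 2)}]"
  define C where "C = build X [{(1, 2), (2, 2)}, {(1, 1), (2, 1)}]"
  note B = build_2[OF valid_explicit(1), folded X, folded B_def]
  note C = build_2[OF valid_explicit(2), folded X, folded C_def]
  have sh: "shape B = diagram_of_rows [2, 2]" "shape C = diagram_of_rows [2, 2]"
    unfolding B C unfolding X by (auto simp: diagram_explicit)
  have "prod.swap ` (domino B 1 \<union> domino B 2) = domino B 1 \<union> domino B 2" unfolding B by auto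
  moreover have "domino C 1 = prod.swap ` domino B 1" "domino C 2 = prod.swap ` domino B 2"
    unfolding B C by auto
  moreover have "basic X B" "basic X C"
    unfolding basic_def B C unfolding X by auto
  moreover have "2 \<in> tau 2 B" "1 \<notin> tau 2 B" "1 \<in> tau 2 C" "2 \<notin> tau 2 C"
    by (simp_all add: tableau_explicit B(3,4) C(3,4) B(3)[simplified] C(3)[simplified])
  moreover have "shape C = shape B" using sh by simp
  ultimately have j: "joined 2 B C" "joined 2 C B"
    using joined_U_basic[OF B(1) C(1)] by blast+
  have "mixed (Suc 1) (diagram_of_rows [2, 2])"
    using B C sh j by (intro mixedI[of 1 B _ C]) (simp_all add: numeral_2_eq_2 tableau_explicit)
  then show ?thesis by (simp add: numeral_2_eq_2)
qed

lemma mixed_311: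
  assumes X: "X = TypeB"
  shows "mixed 2 (diagram_of_rows [3, 1, 1])"
proof -
  define B where "B = build X [{(2, 1), (3, 1)}, {(1, 2), (1, 3)}]"
  define C where "C = build X [{(1, 2), (1, 3)}, {(2, 1), (3, 1)}]"
  note B = build_2[OF valid_explicit(3), folded X, folded B_def]
  note C = build_2[OF valid_explicit(4), folded X, folded C_def]
  have sh: "shape B = diagram_of_rows [3, 1, 1]" "shape C = diagram_of_rows [3, 1, 1]"
    unfolding B C unfolding X by (auto simp: diagram_explicit)
  have "prod.swap ` (domino B 1 \<union> domino B 2) = domino B 1 \<union> domino B 2" unfolding B by auto
  moreover have "domino C 1 = prod.swap ` domino B 1" "domino C 2 = prod.swap ` domino B 2"
    unfolding B C by auto
  moreover have "basic X B" "basic X C"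
    unfolding basic_def B C unfolding X by auto
  moreover have "2 \<in> tau 2 B" "1 \<notin> tau 2 B" "1 \<in> tau 2 C" "2 \<notin> tau 2 C"
    by (simp_all add: tableau_explicit B(3,4) C(3,4) B(3)[simplified] C(3)[simplified])
  moreover have "shape C = shape B" using sh by simp
  ultimately have j: "joined 2 B C" "joined 2 C B"
    using joined_U_basic[OF B(1) C(1)] by blast+
  have "mixed (Suc 1) (diagram_of_rows [3, 1, 1])"
    using B C sh j by (intro mixedI[of 1 C _ B]) (simp_all add: numeral_2_eq_2 tableau_explicit)
  then show ?thesis by (simp add: numeral_2_eq_2)
qed

text \<open>Dominos are listed from the largest label to the smallest one, so that label \<open>k\<close> sits at
  index \<open>n - k\<close>. The lists \<open>ds\<close>, \<open>cs\<close>, \<open>es\<close> describe a basic tableau, its image under the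
  transposition of the dominos 1 and 2, and the result of moving through the cycle \<open>{2, n}\<close>.\<close>

lemma mixed_U_closed:
  assumes v: "valid X ds" "valid X cs" "valid X es"
    and len: "length ds = n" "length cs = n" "length es = n" "3 \<le> n"
    and A: "cells X ds = A" "cells X cs = A" "cells X es = A"
    and basic: "basic X (build X ds)" "\<not> basic X (build X es)"
    and ab: "{a, b} = {1, 2}" and tau: "b \<in> tau n (build X ds)" "a \<notin> tau n (build X ds)"
      "a \<in> tau n (build X es)" "b \<notin> tau n (build X es)"
    and stable: "prod.swap ` (ds ! (n - 1) \<union> ds ! (n - 2)) = ds ! (n - 1) \<union> ds ! (n - 2)"
    and cs: "cs ! (n - 1) = prod.swap ` (ds ! (n - 1))" "cs ! (n - 2) = prod.swap ` (ds ! (n - 2))"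
      "take (n - 2) cs = take (n - 2) ds"
    and es: "es ! (n - 1) = cs ! (n - 1)" "take (n - 3) (tl es) = take (n - 3) (tl cs)"
    and odd: "odd (i + j)"
    and box: "cs ! (n - 2) = {(i, j), (i, j + 1)} \<and> cs ! 0 = {(i + 1, j), (i + 1, j + 1)} \<and>
        es ! (n - 2) = {(i, j), (i + 1, j)} \<and> es ! 0 = {(i, j + 1), (i + 1, j + 1)} \<or>
      cs ! (n - 2) = {(i, j), (i + 1, j)} \<and> cs ! 0 = {(i, j + 1), (i + 1, j + 1)} \<and>
        es ! (n - 2) = {(i, j), (i, j + 1)} \<and> es ! 0 = {(i + 1, j), (i + 1, j + 1)}"
    and lab: "label (build X cs) (i - 1, j + 1) < 2" "label (build X cs) (i + 1, j - 1) < 2"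
      "enat n < label (build X cs) (i, j + 2)" "enat n < label (build X cs) (i + 2, j)"
  shows "mixed n A"
proof -
  let ?B = "build X ds" and ?C = "build X cs" and ?E = "build X es"
  have tab: "domino_tableau X n ?B" "domino_tableau X n ?C" "domino_tableau X n ?E"
    "shape ?B = A" "shape ?C = A" "shape ?E = A"
    using build(1,2)[OF v(1)] build(1,2)[OF v(2)] build(1,2)[OF v(3)] len A by simp_all
  have D: "domino ?B k = ds ! (n - k)" "domino ?C k = cs ! (n - k)" "domino ?E k = es ! (n - k)"
    if "1 \<le> k" "k \<le> n" for k
    using build(3)[OF v(1), of k] build(3)[OF v(2), of k] build(3)[OF v(3), of k] that len by simp_all
  note D12 = D[of 1] D[of 2] D[of n]
  have C3: "domino ?C k = domino ?B k" if "3 \<le> k" "k \<le> n" for k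
  proof -
    have "n - k < n - 2" using that by auto
    then have "cs ! (n - k) = ds ! (n - k)" using cs(3) by (metis nth_take)
    then show ?thesis using D[of k] that by simp
  qed
  have E: "domino ?E k = domino ?C k" if "1 \<le> k" "k \<le> n" "k \<noteq> 2" "k \<noteq> n" for k
  proof (cases "k = 1")
    case False
    then have k: "n - k - 1 < n - 3" "n - k = Suc (n - k - 1)" using that by auto
    then have "tl es ! (n - k - 1) = tl cs ! (n - k - 1)" using es(2) by (metis nth_take)
    then have "es ! (n - k) = cs ! (n - k)" using k that len by (simp add: nth_tl)
    then show ?thesis using D[of k] that by simp
  qed (use D12 es(1) len in simp)
  have j: "joined n ?B ?E" "joined n ?E ?B"
    by (rule joined_U_closed[OF tab(1-3) _ _ len(4) order_refl basic ab tau _ _ _ C3 odd _ E lab];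
        use D12 tab stable cs(1,2) box len(4) in simp)+
  obtain m where m: "n = Suc m" using len(4) by (cases n) auto
  have "cs ! 0 = ds ! 0" using cs(3) len(4) nth_take[of 0 "n - 2" cs] nth_take[of 0 "n - 2" ds] by simp
  then have top: "domino ?B n = cs ! 0" "domino ?E n = es ! 0" using D12 len(4) by simp_all
  from box show ?thesis
  proof (elim disjE conjE)
    assume "cs ! 0 = {(i + 1, j), (i + 1, j + 1)}" "es ! 0 = {(i, j + 1), (i + 1, j + 1)}"
    then show ?thesis using tab j top horizontal_pair vertical_pair unfolding m by (intro mixedI[of m ?B A ?E]) simp_all
  next
    assume "cs ! 0 = {(i, j + 1), (i + 1, j + 1)}" "es ! 0 = {(i + 1, j), (i + 1, j + 1)}"
    then show ?thesis using tab j top horizontal_pair vertical_pair unfolding m by (intro mixedI[of m ?E A ?B]) simp_all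
  qed
qed

lemma mixed_331:
  assumes X: "X = TypeB"
  shows "mixed 3 (diagram_of_rows [3, 3, 1])"
proof (rule mixed_U_closed[where a = 1 and b = 2 and i = 1 and j = 2 and
      ds = "[{(2, 2), (2, 3)}, {(2, 1), (3, 1)}, {(1, 2), (1, 3)}]" and
      cs = "[{(2, 2), (2, 3)}, {(1, 2), (1, 3)}, {(2, 1), (3, 1)}]" and
      es = "[{(1, 3), (2, 3)}, {(1, 2), (2, 2)}, {(2, 1), (3, 1)}]"])
qed (unfold X,
    simp_all add: valid_explicit build(3) tableau_explicit numeral_3_eq_3[symmetric],
    simp_all add: build.simps label_def place_def numeral_eq_enat one_enat_def zero_enat_def,
    simp_all add: diagram_explicit,
    auto simp: doubleton_eq_iff set_eq_subset)

lemma mixed_322: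
  assumes X: "X = TypeB"
  shows "mixed 3 (diagram_of_rows [3, 2, 2])"
proof (rule mixed_U_closed[where a = 2 and b = 1 and i = 2 and j = 1 and
      ds = "[{(2, 2), (3, 2)}, {(1, 2), (1, 3)}, {(2, 1), (3, 1)}]" and
      cs = "[{(2, 2), (3, 2)}, {(2, 1), (3, 1)}, {(1, 2), (1, 3)}]" and
      es = "[{(3, 1), (3, 2)}, {(2, 1), (2, 2)}, {(1, 2), (1, 3)}]"])
qed (unfold X,
    simp_all add: valid_explicit build(3) tableau_explicit numeral_3_eq_3[symmetric],
    simp_all add: build.simps label_def place_def numeral_eq_enat one_enat_def zero_enat_def,
    simp_all add: diagram_explicit,
    auto simp: doubleton_eq_iff set_eq_subset)

text \<open>The domino 3 in the first row takes no part: after the transposition the cycle is {2,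
  4}, in the box with upper left square (2, 1).\<close>

lemma mixed_422:
  assumes X: "X = TypeC"
  shows "mixed 4 (diagram_of_rows [4, 2, 2])"
proof (rule mixed_U_closed[where a = 2 and b = 1 and i = 2 and j = 1 and
      ds = "[{(3, 1), (3, 2)}, {(1, 3), (1, 4)}, {(1, 2), (2, 2)}, {(1, 1), (2, 1)}]" and
      cs = "[{(3, 1), (3, 2)}, {(1, 3), (1, 4)}, {(2, 1), (2, 2)}, {(1, 1), (1, 2)}]" and
      es = "[{(2, 2), (3, 2)}, {(1, 3), (1, 4)}, {(2, 1), (3, 1)}, {(1, 1), (1, 2)}]"])
qed (unfold X,
    simp_all add: valid_explicit build(3) tableau_explicit numeral_3_eq_3[symmetric],
    simp_all add: build.simps label_def place_def numeral_eq_enat one_enat_def zero_enat_def,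
    simp_all add: diagram_explicit,
    auto simp: doubleton_eq_iff set_eq_subset)

lemma mixed_3311:
  assumes X: "X = TypeC"
  shows "mixed 4 (diagram_of_rows [3, 3, 1, 1])"
proof (rule mixed_U_closed[where a = 1 and b = 2 and i = 1 and j = 2 and
      ds = "[{(1, 3), (2, 3)}, {(3, 1), (4, 1)}, {(2, 1), (2, 2)}, {(1, 1), (1, 2)}]" and
      cs = "[{(1, 3), (2, 3)}, {(3, 1), (4, 1)}, {(1, 2), (2, 2)}, {(1, 1), (2, 1)}]" and
      es = "[{(2, 2), (2, 3)}, {(3, 1), (4, 1)}, {(1, 2), (1, 3)}, {(1, 1), (2, 1)}]"])
qed (unfold X,
    simp_all add: valid_explicit build(3) tableau_explicit numeral_3_eq_3[symmetric],
    simp_all add: build.simps label_def place_def numeral_eq_enat one_enat_def zero_enat_def,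
    simp_all add: diagram_explicit,
    auto simp: doubleton_eq_iff set_eq_subset)

end

section \<open>Connecting all positions of the largest domino\<close>

lemma card_shape:
  assumes "domino_tableau X n T"
  shows "card (shape T) = 2 * n + (if X = TypeB then 1 else 0)"
  using assms
proof (induction n arbitrary: T)
  case 0
  then show ?case using shape_rank_0[OF 0] by (cases X) auto
next
  case (Suc n)
  have d: "is_domino (domino T (Suc n))" using tableau_domino[OF Suc.prems, of "Suc n"] by simp
  then have "card (domino T (Suc n)) = 2" by (cases rule: is_domino_cases) auto
  moreover have "card (shape T) = card (shape T - domino T (Suc n)) + card (domino T (Suc n))"
    using young_finite[OF tableau_young[OF Suc.prems]] domino_subset[of T "Suc n"]
    by (metis card_Diff_subset card_mono finite_subset le_add_diff_inverse2)
  moreover have "card (shape T - domino T (Suc n)) = 2 * n + (if X = TypeB then 1 else 0)"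
    using Suc.IH[OF restrict_tableau[OF Suc.prems]] shape_restrict_top[OF Suc.prems] by simp
  ultimately show ?case by simp
qed

lemma rank_unique:
  "domino_tableau X n T \<Longrightarrow> domino_tableau X m T' \<Longrightarrow> shape T = shape T' \<Longrightarrow> n = m"
  using card_shape[of X n T] card_shape[of X m T'] by simp

lemma depth_swap:
  assumes A: "young_diagram A"
  shows "depth (prod.swap ` A) c = depth A (- c) - c"
proof -
  have "filled (prod.swap ` A) i j \<longleftrightarrow> filled A j i" for i j
    by (auto simp: filled_def mem_swap_image)
  then show ?thesis
    by (intro depth_eqI[OF young_swap[OF A]]) (simp_all add: filled_iff[OF A])
qed

text \<open>Transposition reads the boundary word backwards and exchanges east and north
  steps.\<close>

lemma north_swap:
  assumes A: "young_diagram A"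
  shows "north (prod.swap ` A) t \<longleftrightarrow> \<not> north A (- 1 - t)"
proof -
  have "depth A (- t) = depth A (- 1 - t) - (if north A (- 1 - t) then 1 else 0)"
    using depth_Suc[OF A, of "- 1 - t"] by simp
  moreover have "- (t + 1) = - 1 - t" by simp
  ultimately show ?thesis unfolding north_def[of "prod.swap ` A"] depth_swap[OF A]
    by (simp only:) (auto split: if_splits)
qed

text \<open>The two exchanged steps at \<open>t\<close> and \<open>t + 2\<close> correspond to those
  at \<open>- 1 - t\<close> and \<open>- 3 - t\<close>, and the latter comes first.\<close>

lemma removable_swap:
  assumes A: "young_diagram A"
  shows "removable (prod.swap ` A) t \<longleftrightarrow> removable A (- 3 - t)"
proof -
  have e: "- 1 - (t + 2) = - 3 - t" "- 3 - t + 2 = - 1 - t" by simp_all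
  show ?thesis unfolding removable_def north_swap[OF A] e by blast
qed

lemma swap_diagram_422: "prod.swap ` diagram_of_rows [4, 2, 2] = diagram_of_rows [3, 3, 1, 1]"
proof -
  have "diagram_of_rows [4, 2, 2] = {(1, 1), (1, 2), (1, 3), (1, 4), (2, 1), (2, 2), (3, 1), (3, 2)}"
    by (auto simp: diagram_explicit)
  moreover have "diagram_of_rows [3, 3, 1, 1] = {(1, 1), (1, 2), (1, 3), (2, 1), (2, 2), (2, 3), (3, 1), (4, 1)}"
    by (auto simp: diagram_explicit)
  ultimately show ?thesis by (simp only:) auto
qed

lemma mu_shape_C_1: "mu_shape TypeC 1 = diagram_of_rows [4, 2, 2]"
  unfolding mu_shape_def by (simp add: upt_rec numeral_2_eq_2)

lemma quasi_staircase_tops: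
  "vertical (lambda_V X k)" "vertical (mu_V X k)" "horizontal (lambda_H X k)" "horizontal (mu_H X k)"
  unfolding lambda_V_def mu_V_def lambda_H_def mu_H_def Let_def
  by (cases X; simp add: vertical_pair_iff horizontal_pair_iff)+

lemma quasi_staircase_size: "2 \<le> k \<Longrightarrow> 2 \<le> lambda_size k" "2 \<le> k \<Longrightarrow> 2 \<le> mu_size X k"
  by (cases X; simp add: lambda_size_def mu_size_def power2_eq_square)+

context operator_family
begin

text \<open>Only the orientations of the two largest dominos of the fixed tableau enter. The
  removable position \<open>s + 1\<close> is the only vertical one, and after its removal
  \<open>s + 4\<close> is the only horizontal position left, so interchanging the labels bridges the
  two.\<close>

lemma mixed_S:
  assumes B: "domino_tableau X n B" "2 \<le> n" "shape B = A"
    and top: "vertical (domino B n)" "horizontal (domino B (n - 1))"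
    and only: "\<And>r. removable A r \<longleftrightarrow> r = s \<or> r = s + 1 \<or> r = s + 4"
    and w: "north A (s - 1)" "\<not> north A (s + 5)"
    and st: "\<And>N T. n \<le> N \<Longrightarrow> restrict_labels n T \<in> {B, interchange (n - 1) n B} \<Longrightarrow>
      step N T (interchange (n - 1) n T)"
  shows "mixed n A"
proof -
  note A = tableau_young[OF B(1), unfolded B(3)]
  obtain m where m: "n = Suc (Suc m)" using B(2) by (metis Suc_le_D numeral_2_eq_2 Suc_le_mono)
  have rs: "removable A s" "removable A (s + 1)" "removable A (s + 4)" using only by auto
  have ws: "\<not> north A (s + 1)" "north A (s + 2)" "north A (s + 3)" "\<not> north A (s + 4)" "north A (s + 6)"
    using rs unfolding removable_def by (simp_all add: add.assoc)
  obtain x where x: "removable A x" "domino B n = rim A x" "shape (restrict_labels (Suc m) B) = A - rim A x"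
    using top_domino[OF B(1)[unfolded m]] unfolding m B(3) by metis
  have "north A (x + 1)" using top(1) x(2) vertical_rim[OF A] by simp
  then have xs: "x = s + 1" using x(1) ws w only by (auto simp: add.assoc)
  have B1: "domino_tableau X (Suc m) (restrict_labels (Suc m) B)"
    using restrict_tableau[OF B(1)] m by simp
  obtain r where r: "removable (A - rim A x) r" "domino (restrict_labels (Suc m) B) (Suc m) = rim (A - rim A x) r"
    using top_domino[OF B1] unfolding x(3) by metis
  have top2: "domino B (n - 1) = rim (A - rim A x) r" using r(2) domino_restrict[of "Suc m" "Suc m" B] m by simp
  have nr: "\<not> north (A - rim A x) (r + 1)"
    using top(2) unfolding top2 horizontal_rim[OF young_remove[OF A x(1)]] .
  note nth = north_remove[OF A rs(2)]
  \<comment> \<open>The removal can create new removable positions only at \<open>s - 1\<close> and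
    \<open>s + 3\<close>, and both are ruled out by \<open>w\<close>. At \<open>s\<close> the domino
    has become vertical.\<close>
  have r4: "r = s + 4"
  proof (rule ccontr)
    assume "r \<noteq> s + 4"
    then have "\<not> removable A r \<or> r = s \<or> r = s + 1" using only by blast
    moreover have "r \<noteq> s" "r \<noteq> s + 1" "r \<noteq> s + 3" "r \<noteq> s - 1"
      using nr r(1) ws w unfolding xs removable_def nth by (auto simp: add.assoc)
    ultimately show False using r(1) unfolding xs removable_def nth by (auto simp: add.assoc split: if_splits)
  qed
  have "rim (A - rim A x) r = rim A (s + 4)"
    unfolding xs r4 by (rule rim_remove[OF A rs(2)]) simp
  then have "top_joined n (shape B) (s + 1) (s + 4)"
    using x(2) xs rs(3) top2 B(3) by (intro top_joined_S[OF B(1,2)] st) simp_all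
  then show ?thesis unfolding mixed_def
    using rs ws w top_joined_sym B(3) by (intro exI[of _ "s + 4"] exI[of _ "s + 1"]) (simp add: add.assoc)
qed

text \<open>Mirror image of \<open>mixed_S\<close>: the largest domino is now the horizontal one at
  \<open>s\<close> and the next the vertical one at \<open>s - 3\<close>; the new positions to be
  excluded are \<open>s - 2\<close> and \<open>s + 2\<close>.\<close>

lemma mixed_transposed_S:
  assumes B: "domino_tableau X n B" "2 \<le> n" "shape B = A"
    and top: "horizontal (domino B n)" "vertical (domino B (n - 1))"
    and only: "\<And>r. removable A r \<longleftrightarrow> r = s - 3 \<or> r = s \<or> r = s + 1"
    and w: "north A (s - 2)" "\<not> north A (s + 4)"
    and st: "\<And>N T. n \<le> N \<Longrightarrow> restrict_labels n T \<in> {B, interchange (n - 1) n B} \<Longrightarrow>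
      step N T (interchange (n - 1) n T)"
  shows "mixed n A"
proof -
  note A = tableau_young[OF B(1), unfolded B(3)]
  obtain m where m: "n = Suc (Suc m)" using B(2) by (metis Suc_le_D numeral_2_eq_2 Suc_le_mono)
  have rs: "removable A s" "removable A (s + 1)" "removable A (s - 3)" using only by auto
  have ws: "\<not> north A s" "\<not> north A (s + 1)" "north A (s + 2)" "north A (s + 3)" "\<not> north A (s - 3)" "north A (s - 1)"
    using rs unfolding removable_def by (simp_all add: add.assoc)
  obtain x where x: "removable A x" "domino B n = rim A x" "shape (restrict_labels (Suc m) B) = A - rim A x"
    using top_domino[OF B(1)[unfolded m]] unfolding m B(3) by metis
  have "\<not> north A (x + 1)" using top(1) x(2) horizontal_rim[OF A] by simp
  then have xs: "x = s" using x(1) ws w only by (auto simp: add.assoc)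
  have B1: "domino_tableau X (Suc m) (restrict_labels (Suc m) B)"
    using restrict_tableau[OF B(1)] m by simp
  obtain r where r: "removable (A - rim A x) r" "domino (restrict_labels (Suc m) B) (Suc m) = rim (A - rim A x) r"
    using top_domino[OF B1] unfolding x(3) by metis
  have top2: "domino B (n - 1) = rim (A - rim A x) r" using r(2) domino_restrict[of "Suc m" "Suc m" B] m by simp
  have nr: "north (A - rim A x) (r + 1)"
    using top(2) unfolding top2 vertical_rim[OF young_remove[OF A x(1)]] .
  note nth = north_remove[OF A rs(1)]
  have r4: "r = s - 3"
  proof (rule ccontr)
    assume "r \<noteq> s - 3"
    then have "\<not> removable A r \<or> r = s \<or> r = s + 1" using only by blast
    moreover have "r \<noteq> s" "r \<noteq> s + 1" "r \<noteq> s + 2" "r \<noteq> s - 2"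
      using nr r(1) ws w unfolding xs removable_def nth by (auto simp: add.assoc)
    ultimately show False using r(1) unfolding xs removable_def nth by (auto simp: add.assoc split: if_splits)
  qed
  have "rim (A - rim A x) r = rim A (s - 3)"
    unfolding xs r4 by (rule rim_remove[OF A rs(1)]) simp
  then have "top_joined n (shape B) s (s - 3)"
    using x(2) xs rs(3) top2 B(3) by (intro top_joined_S[OF B(1,2)] st) simp_all
  then show ?thesis unfolding mixed_def
    using rs ws w B(3) by (intro exI[of _ s] exI[of _ "s - 3"]) (simp add: add.assoc)
qed

lemma mixed_tableau:
  assumes "mixed n A"
  obtains B where "domino_tableau X n B" "shape B = A"
  using assms unfolding mixed_def top_joined_def by blast

text \<open>The exceptional shapes come with explicit ranks; the number of squares identifies them
  with the rank at hand.\<close>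

lemma mixed_rank:
  assumes "domino_tableau X n C" "shape C = A" "mixed m A"
  shows "mixed n A"
  using mixed_tableau[OF assms(3)] rank_unique[OF assms(1)] assms(2,3) by metis

context
  assumes quasi: "quasi_staircase_choice X Q Q'"
begin

lemma quasi_staircase_lambda:
  assumes "2 \<le> k"
  shows "domino_tableau X (lambda_size k) (Q k)" "2 \<le> lambda_size k" "shape (Q k) = lambda_shape X k"
    "vertical (domino (Q k) (lambda_size k))" "horizontal (domino (Q k) (lambda_size k - 1))"
  using quasi assms quasi_staircase_tops quasi_staircase_size unfolding quasi_staircase_choice_def by simp_all

lemma quasi_staircase_mu:
  assumes "2 \<le> k"
  shows "domino_tableau X (mu_size X k) (Q' k)" "2 \<le> mu_size X k" "shape (Q' k) = mu_shape X k"
    "vertical (domino (Q' k) (mu_size X k))" "horizontal (domino (Q' k) (mu_size X k - 1))"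
  using quasi assms quasi_staircase_tops quasi_staircase_size unfolding quasi_staircase_choice_def by simp_all

lemma apply_S_eq:
  "apply_op X N Q Q' (Op_S k) = S_op X N (lambda_size k) (Q k)"
  "apply_op X N Q Q' (Op_S' k) = S_op X N (mu_size X k) (Q' k)"
  "apply_op X N Q Q' (Op_tS k) = transposed_op (S_op X N (lambda_size k) (Q k))"
  "apply_op X N Q Q' (Op_tS' k) = transposed_op (S_op X N (mu_size X k) (Q' k))"
  by (rule ext, simp)+

lemma mixed_three_removables:
  assumes C: "domino_tableau X n C" "shape C = A"
    and only: "\<And>r. removable A r \<longleftrightarrow> r = s \<or> r = s + 1 \<or> r = s + 4"
    and w: "north A (s - 1)" "\<not> north A (s + 5)"
  shows "mixed n A"
proof -
  have "mixed (lambda_size k) A" if k: "2 \<le> k" "A = lambda_shape X k" for k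
    using k quasi_staircase_lambda(3)[OF k(1)] by (intro mixed_S[OF quasi_staircase_lambda(1,2) _ _ _ only w]
      step_S[OF _ apply_S_eq(1)] quasi_staircase_lambda(4,5)) simp_all
  moreover have "mixed (mu_size X k) A" if k: "2 \<le> k" "A = mu_shape X k" for k
    using k quasi_staircase_mu(3)[OF k(1)] by (intro mixed_S[OF quasi_staircase_mu(1,2) _ _ _ only w]
      step_S[OF _ apply_S_eq(2)] quasi_staircase_mu(4,5)) simp_all
  ultimately show ?thesis
    using three_removables_shape[OF C only w] mixed_422 mixed_rank[OF C] unfolding mu_shape_C_1 by blast
qed

lemma mixed_three_removables_transposed:
  assumes C: "domino_tableau X n C" "shape C = A"
    and only: "\<And>r. removable A r \<longleftrightarrow> r = s - 3 \<or> r = s \<or> r = s + 1"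
    and w: "north A (s - 2)" "\<not> north A (s + 4)"
  shows "mixed n A"
proof -
  note A = tableau_young[OF C(1), unfolded C(2)]
  let ?A = "prod.swap ` A"
  have A_eq: "prod.swap ` B = A" if "?A = B" for B using that swap_swap_image by metis
  have C': "domino_tableau X n (transpose_tableau C)" "shape (transpose_tableau C) = ?A"
    using transpose_tableau_tableau[OF C(1)] C(2) by (simp_all only: shape_transpose)
  \<comment> \<open>Under r to -3 - r the positions s + 1, s, s - 3 become -4 - s, -3 - s, -s, which
    is the untransposed pattern based at -4 - s.\<close>
  have only': "removable ?A r \<longleftrightarrow> r = (- 4 - s) \<or> r = (- 4 - s) + 1 \<or> r = (- 4 - s) + 4" for r
    unfolding removable_swap[OF A] only by auto
  have w': "north ?A ((- 4 - s) - 1)" "\<not> north ?A ((- 4 - s) + 5)"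
    unfolding north_swap[OF A] using w by (simp_all add: algebra_simps)
  have S: "mixed n A" if B: "domino_tableau X N0 B" "2 \<le> N0" "?A = shape B"
      "vertical (domino B N0)" "horizontal (domino B (N0 - 1))"
    and op: "\<And>N. admissible N \<sigma>" "\<And>N. apply_op X N Q Q' \<sigma> = transposed_op (S_op X N N0 B)" for N0 B \<sigma>
  proof (rule mixed_rank[OF C], rule mixed_transposed_S[OF transpose_tableau_tableau[OF B(1)] B(2) _ _ _ only w])
    show "shape (transpose_tableau B) = A" unfolding shape_transpose by (rule A_eq[OF B(3)])
  qed (use B(4,5) step_transposed_S[OF op] in \<open>simp_all add: domino_transpose horizontal_swap vertical_swap\<close>)
  have "mixed n A" if k: "2 \<le> k" "?A = lambda_shape X k" for k
    using k quasi_staircase_lambda[OF k(1)] by (intro S[OF _ _ _ _ _ _ apply_S_eq(3)]) simp_all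
  moreover have "mixed n A" if k: "2 \<le> k" "?A = mu_shape X k" for k
    using k quasi_staircase_mu[OF k(1)] by (intro S[OF _ _ _ _ _ _ apply_S_eq(4)]) simp_all
  moreover have "mixed n A" if "X = TypeC" "?A = mu_shape TypeC 1"
    using mixed_rank[OF C] mixed_3311[OF that(1)] A_eq[OF that(2)] unfolding mu_shape_C_1 swap_diagram_422 by simp
  ultimately show ?thesis using three_removables_shape[OF C' only' w'] by blast
qed

lemma mixed_two_removables:
  assumes C: "domino_tableau X n C" "shape C = A" and s: "removable A s" and t: "removable A t"
    and only: "\<And>r. removable A r \<Longrightarrow> r = s \<or> r = t" and st: "s < t" "odd (t - s)"
    and w: "\<not> north A (s + 4)" "north A (t - 2)"
  shows "mixed n A"
  using two_removables_shape[OF C s t only st w] mixed_rank[OF C]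
    mixed_22 mixed_311 mixed_331 mixed_322 by blast

text \<open>If no bridge exists, take two removable positions of different parity at minimal
  distance. If they do not overlap, the gap statements leave no room for a third one. If they
  overlap, their dominos lie in a 2 x 2 box, at most one further removable position exists, and it
  is \<open>u + 4\<close> or \<open>u - 3\<close>. All these patterns belong to exceptional shapes,
  which do have a bridge.\<close>

lemma exists_odd_top_joined:
  assumes C: "domino_tableau X n C" "shape C = A" and s: "removable A s" and t: "removable A t"
    and odd: "odd (t - s)"
  shows "\<exists>x y. removable A x \<and> removable A y \<and> odd (y - x) \<and> top_joined n A x y"
proof (rule ccontr)
  assume "\<not> ?thesis"
  then have nj: "\<not> top_joined n A x y" if "removable A x" "removable A y" "odd (y - x)" for x y
    using that by blast
  define P where "P d \<longleftrightarrow> odd d \<and> (\<exists>x. removable A x \<and> removable A (x + int d))" for d :: nat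
  have "P (nat \<bar>t - s\<bar>)"
  proof (cases "s \<le> t")
    case True
    then show ?thesis using s t odd by (auto simp: P_def even_nat_iff intro!: exI[of _ s])
  next
    case False
    then show ?thesis using s t odd by (auto simp: P_def even_nat_iff intro!: exI[of _ t])
  qed
  define d where "d = (LEAST d. P d)"
  have "P d" unfolding d_def by (rule LeastI) fact
  then obtain u v where uv: "removable A u" "removable A v" "v = u + int d" and dodd: "odd d"
    unfolding P_def by blast
  then have odd_uv: "odd (v - u)" and lt: "u < v" by (auto intro: Nat.gr0I)
  have minimal: "v - u \<le> y - x" if "removable A x" "removable A y" "odd (y - x)" "x < y" for x y
  proof -
    have "P (nat (y - x))" using that by (auto simp: P_def even_nat_iff intro!: exI[of _ x])
    then have "d \<le> nat (y - x)" unfolding d_def by (rule Least_le)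
    then show ?thesis using uv(3) that(4) by simp
  qed
  note gap = not_top_joined_gap[OF C]
  have wu: "\<not> north A u" "north A (u + 2)" "\<not> north A v" "north A (v + 2)"
    using uv unfolding removable_def by auto
  show False
  proof (cases "v = u + 1")
    case False
    then have uv3: "u + 3 \<le> v" using lt odd_uv by presburger
    note g = gap[OF uv(1,2) uv3 odd_uv nj[OF uv(1,2) odd_uv]]
    have only: "r = u \<or> r = v" if r: "removable A r" for r
    proof (rule ccontr)
      assume ne: "\<not> (r = u \<or> r = v)"
      have wr: "\<not> north A r" "north A (r + 2)" using r unfolding removable_def by auto
      consider "r < u" | "u < r" "r < v" | "v < r" using ne by linarith
      then show False
      proof cases
        case 1
        show False
        proof (cases "odd (u - r)")
          case True
          have r3: "r + 3 \<le> u" using minimal[OF r uv(1) True 1] uv3 by linarith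
          note g' = gap[OF r uv(1) r3 True nj[OF r uv(1) True]]
          \<comment> \<open>The position \<open>u + 1\<close> lies on the runner of
            \<open>v\<close>, hence north for the pair (u, v), and on the runner of
            \<open>r\<close>, hence east for the pair (r, u).\<close>
          show False using r3 g(1)[of "u + 1"] g'(2)[of "u + 1"] uv3 odd_uv True 1 by auto
        next
          case False
          then have o: "odd (v - r)" using odd_uv by presburger
          have "r + 3 \<le> v" using 1 uv3 by linarith
          note g' = gap[OF r uv(2) this o nj[OF r uv(2) o]]
          show False using g'(2)[of "u + 2"] wu uv3 False 1 by auto
        qed
      next
        case 2
        then show False using minimal[OF uv(1) r] minimal[OF r uv(2)] odd_uv by (cases "odd (r - u)") auto
      next
        case 3
        show False
        proof (cases "odd (r - v)")
          case True
          have r3: "v + 3 \<le> r" using minimal[OF uv(2) r True 3] uv3 by linarith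
          note g' = gap[OF uv(2) r r3 True nj[OF uv(2) r True]]
          show False using r3 g(2)[of "v + 1"] g'(1)[of "v + 1"] uv3 odd_uv True 3 by auto
        next
          case False
          then have o: "odd (r - u)" using odd_uv by presburger
          have "u + 3 \<le> r" using 3 uv3 by linarith
          note g' = gap[OF uv(1) r this o nj[OF uv(1) r o]]
          show False using g'(1)[of v] wu lt False 3 by auto
        qed
      qed
    qed
    have "mixed n A"
      using g(2)[of "u + 4"] g(1)[of "v - 2"] uv3 lt odd_uv
      by (intro mixed_two_removables[OF C uv(1,2) only lt odd_uv]) auto
    then obtain x y where xy: "removable A x" "removable A y" "top_joined n A x y" "\<not> north A (x + 1)" "north A (y + 1)"
      unfolding mixed_def by blast
    then have "x \<noteq> y" by auto
    then have "odd (y - x)" using only[OF xy(1)] only[OF xy(2)] odd_uv by auto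
    then show False using nj xy by blast
  next
    case True
    then have u1: "removable A (u + 1)" using uv by simp
    have wv: "\<not> north A (u + 1)" "north A (u + 3)" using wu True by (simp_all add: add.assoc)
    have o1: "odd ((u + 1) - u)" "odd (u - (u + 1))" by simp_all
    \<comment> \<open>Otherwise the box extends to a 2 x 3 box and an F-type interchange is a
      bridge; likewise a north step at \<open>u + 4\<close> would give a 3 x 2 box.\<close>
    have w1: "north A (u - 1)"
      using top_joined_2x3[OF C uv(1) u1] nj[OF u1 uv(1) o1(2)] by blast
    have w4: "\<not> north A (u + 4)"
      using top_joined_3x2[OF C uv(1) u1] nj[OF u1 uv(1) o1(2)] by blast
    have above: "r = u + 4 \<and> \<not> north A (u + 5)" if r: "removable A r" "u + 1 < r" for r
    proof -
      have wr: "\<not> north A r" "north A (r + 2)" using r unfolding removable_def by auto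
      have "r \<noteq> u + 2" "r \<noteq> u + 3" using wr wu wv by auto
      then have r4: "u + 4 \<le> r" using r(2) by linarith
      have ev: "even (r - u)"
      proof (rule ccontr)
        assume o: "odd (r - u)"
        have "u + 3 \<le> r" using r4 by simp
        note g = gap[OF uv(1) r(1) this o nj[OF uv(1) r(1) o]]
        show False using g(1)[of "u + 1"] r4 o wv by auto
      qed
      then have o: "odd (r - (u + 1))" by presburger
      have "u + 1 + 3 \<le> r" using r4 by simp
      note g = gap[OF u1 r(1) this o nj[OF u1 r(1) o]]
      \<comment> \<open>Beyond \<open>u + 4\<close> the gap statement for the pair (u + 1, r) would
        force a north step at \<open>u + 4\<close>, against \<open>w4\<close>.\<close>
      have "\<not> u + 4 < r" using g(1)[of "u + 4"] w4 ev by auto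
      then have "r = u + 4" using r4 by simp
      \<comment> \<open>Here u + 5 = r + 1 is the last position that the gap statement
        reaches.\<close>
      moreover have "\<not> north A (u + 5)" using g(2)[of "u + 5"] r4 by auto
      ultimately show ?thesis by simp
    qed
    have below: "r = u - 3 \<and> north A (u - 2)" if r: "removable A r" "r < u" for r
    proof -
      have wr: "\<not> north A r" "north A (r + 2)" using r unfolding removable_def by auto
      have "r \<noteq> u - 1" "r \<noteq> u - 2" using wr wu w1 by auto
      then have r3: "r + 3 \<le> u" using r(2) by linarith
      have o: "odd (u - r)"
      proof (rule ccontr)
        assume "\<not> odd (u - r)"
        then have o: "odd (u + 1 - r)" and ev: "even (u - r)" by simp_all
        have "r + 3 \<le> u + 1" using r3 by simp
        note g = gap[OF r(1) u1 this o nj[OF r(1) u1 o]]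
        show False using g(2)[of "u + 2"] r3 ev wu by auto
      qed
      note g = gap[OF r(1) uv(1) r3 o nj[OF r(1) uv(1) o]]
      have "\<not> r + 2 < u - 1" using g(2)[of "u - 1"] w1 o by auto
      then have "r = u - 3" using r3 by simp
      moreover have "north A (u - 2)" using g(1)[of "u - 2"] r3 by auto
      ultimately show ?thesis by simp
    qed
    \<comment> \<open>The gap between \<open>u - 3\<close> and \<open>u + 4\<close> would make the
      step at \<open>u + 3\<close> east, although it belongs to the box corner.\<close>
    have not_both: False if r: "removable A (u - 3)" "removable A (u + 4)"
    proof -
      have o: "odd ((u + 4) - (u - 3))" by simp
      have "u - 3 + 3 \<le> u + 4" by simp
      note g = gap[OF r this o nj[OF r o]]
      show False using g(2)[of "u + 3"] wv by auto
    qed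
    have "\<exists>x y. removable A x \<and> removable A y \<and> odd (y - x) \<and> top_joined n A x y"
    proof (cases "removable A (u + 4)")
      case 4: True
      have only: "removable A r \<longleftrightarrow> r = u \<or> r = u + 1 \<or> r = u + 4" for r
      proof
        assume r: "removable A r"
        consider "r < u" | "r = u" | "r = u + 1" | "u + 1 < r" by linarith
        then show "r = u \<or> r = u + 1 \<or> r = u + 4"
          using below[OF r] above[OF r] not_both 4 r by cases auto
      qed (use uv(1) u1 4 in auto)
      have w5: "\<not> north A (u + 5)" using above[OF 4] by simp
      obtain x y where xy: "removable A x" "removable A y" "top_joined n A x y" "\<not> north A (x + 1)" "north A (y + 1)"
        using mixed_three_removables[OF C only w1 w5] unfolding mixed_def by blast
      \<comment> \<open>Horizontal removable positions are \<open>u\<close> and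
        \<open>u + 4\<close>, the vertical one is \<open>u + 1\<close>; so a change of orientation
        is a change of parity.\<close>
      have "x = u \<or> x = u + 4" using xy(1,4) only wu by (auto simp: add.assoc)
      moreover have "y = u + 1" using xy(2,5) only wv w5 by (auto simp: add.assoc)
      ultimately have "odd (y - x)" by auto
      then show ?thesis using xy by blast
    next
      case no4: False
      show ?thesis
      proof (cases "removable A (u - 3)")
        case 3: True
        have only: "removable A r \<longleftrightarrow> r = u - 3 \<or> r = u \<or> r = u + 1" for r
        proof
          assume r: "removable A r"
          consider "r < u" | "r = u" | "r = u + 1" | "u + 1 < r" by linarith
          then show "r = u - 3 \<or> r = u \<or> r = u + 1"
            using below[OF r] above[OF r] no4 r by cases auto
        qed (use uv(1) u1 3 in auto)
        have w2: "north A (u - 2)" using below[OF 3] by simp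
        obtain x y where xy: "removable A x" "removable A y" "top_joined n A x y" "\<not> north A (x + 1)" "north A (y + 1)"
          using mixed_three_removables_transposed[OF C only w2 w4] unfolding mixed_def by blast
        have "x = u" using xy(1,4) only wu w2 by (auto simp: add.assoc)
        moreover have "y = u - 3 \<or> y = u + 1" using xy(2,5) only wv by (auto simp: add.assoc)
        ultimately have "odd (y - x)" by auto
        then show ?thesis using xy by blast
      next
        case no3: False
        have only: "r = u \<or> r = u + 1" if r: "removable A r" for r
        proof -
          consider "r < u" | "r = u" | "r = u + 1" | "u + 1 < r" by linarith
          then show ?thesis using below[OF r] above[OF r] no4 no3 r by cases auto
        qed
        have "mixed n A"
          using w1 w4 by (intro mixed_two_removables[OF C uv(1) u1 only]) simp_all
        then obtain x y where xy: "removable A x" "removable A y" "top_joined n A x y" "\<not> north A (x + 1)" "north A (y + 1)"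
          unfolding mixed_def by blast
        then have "x \<noteq> y" by auto
        then have "odd (y - x)" using only[OF xy(1)] only[OF xy(2)] by auto
        then show ?thesis using xy by blast
      qed
    qed
    then show False using nj by blast
  qed
qed

end

end

section \<open>The induction on the rank\<close>

context operator_family
begin

context
  assumes quasi: "quasi_staircase_choice X Q Q'"
begin

text \<open>Each parity class is connected directly, so one bridge of odd length suffices; it is
  crossed in whichever direction the parity of the starting position requires.\<close>

lemma top_joined_connected:
  assumes C: "domino_tableau X n C" "shape C = A" and s: "removable A s" and t: "removable A t"
  defines "J \<equiv> (\<lambda>x y. removable A x \<and> removable A y \<and> top_joined n A x y)"
  shows "J\<^sup>*\<^sup>* s t"
proof -
  have even_case: "J\<^sup>*\<^sup>* x y" if "removable A x" "removable A y" "even (y - x)" for x y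
  proof -
    consider "x = y" | "x < y" | "y < x" by linarith
    then show ?thesis
    proof cases
      case 2
      then have "J x y" using top_joined_same_parity[OF C that(1,2)] that unfolding J_def by blast
      then show ?thesis by blast
    next
      case 3
      have "even (x - y)" using that(3) by simp
      then have "J x y" using 3 top_joined_same_parity[OF C that(2,1)] that top_joined_sym unfolding J_def by blast
      then show ?thesis by blast
    qed simp
  qed
  show ?thesis
  proof (cases "even (t - s)")
    case True
    then show ?thesis using even_case s t by blast
  next
    case False
    then obtain x y where xy: "removable A x" "removable A y" "odd (y - x)" "top_joined n A x y"
      using exists_odd_top_joined[OF quasi C s t] by blast
    then have J: "J x y" "J y x" using top_joined_sym unfolding J_def by blast+
    show ?thesis
    proof (cases "even (x - s)")
      case True
      then have "even (t - y)" using xy(3) False by presburger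
      then show ?thesis using even_case[OF s xy(1) True] J(1) even_case[OF xy(2) t]
        by (meson rtranclp.rtrancl_into_rtrancl rtranclp_trans)
    next
      case odd: False
      then have e: "even (y - s)" "even (t - x)" using xy(3) False by presburger+
      then show ?thesis using even_case[OF s xy(2) e(1)] J(2) even_case[OF xy(1) t e(2)]
        by (meson rtranclp.rtrancl_into_rtrancl rtranclp_trans)
    qed
  qed
qed

text \<open>Moves for the labels up to \<open>n\<close> apply to every larger tableau, hence also
  with the common domino \<open>n + 1\<close> left in place.\<close>

lemma joined_same_top:
  assumes B: "domino_tableau X (Suc n) B" "domino_tableau X (Suc n) B'" "shape B' = shape B"
    and top: "domino B (Suc n) = domino B' (Suc n)"
    and j: "joined n (restrict_labels n B) (restrict_labels n B')"
  shows "joined (Suc n) B B'"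
  unfolding joined_def
proof (intro allI impI)
  fix N T assume N: "Suc n \<le> N" "domino_tableau X N T" "restrict_labels (Suc n) T = B"
  have "restrict_labels n T = restrict_labels n B"
    using restrict_restrict[of n "Suc n" T] N(3) by simp
  then have "(move N)\<^sup>*\<^sup>* T (T ++ restrict_labels n B')" using j N(1,2) unfolding joined_def by simp
  moreover have "T ++ restrict_labels n B' = T ++ B'"
  proof (rule ext)
    fix s
    show "(T ++ restrict_labels n B') s = (T ++ B') s"
    proof (cases "B' s")
      case None
      then have "restrict_labels n B' s = None" by (simp add: restrict_labels_apply)
      then show ?thesis using None by (simp add: map_add_def)
    next
      case (Some k)
      show ?thesis
      proof (cases "k \<le> n")
        case True
        then have "restrict_labels n B' s = Some k" using Some by (simp add: restrict_labels_eq_Some)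
        then show ?thesis using Some by (simp add: map_add_def)
      next
        case False
        then have k: "k = Suc n" using tableau_label_le[OF B(2) Some] by simp
        have r: "restrict_labels n B' s = None" using False Some by (simp add: restrict_labels_apply)
        have "s \<in> domino B (Suc n)" using Some k top by (simp add: mem_domino)
        then have "restrict_labels (Suc n) T s = Some k" using N(3) k by (simp add: mem_domino)
        then have "T s = Some k" by (simp add: restrict_labels_eq_Some)
        then show ?thesis using Some r by (simp add: map_add_def)
      qed
    qed
  qed
  ultimately show "(move N)\<^sup>*\<^sup>* T (T ++ B')" by simp
qed

text \<open>The tableau \<open>B\<close> is led along a chain of positions of the largest domino. At
  each link the induction hypothesis first carries it to the witness of \<open>top_joined\<close>
  with its current largest domino, and the witness is then moved to the next position.\<close>

lemma same_shape_joined: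
  assumes "domino_tableau X n B" "domino_tableau X n B'" "shape B' = shape B"
  shows "joined n B B'"
  using assms
proof (induction n arbitrary: B B')
  case 0
  have "domino B 0 = domino B' 0" using tableau_zero[OF 0(1)] tableau_zero[OF 0(2)] by simp
  then have "B = B'" using tableau_eqI_le[OF 0(1,2)] by simp
  then show ?case using joined_refl by simp
next
  case (Suc n)
  define A where "A = shape B"
  have sh: "shape B = A" "shape B' = A" using Suc.prems(3) by (simp_all add: A_def)
  have same: "joined (Suc n) C C'"
    if C: "domino_tableau X (Suc n) C" "domino_tableau X (Suc n) C'" "shape C = A" "shape C' = A"
      "domino C (Suc n) = domino C' (Suc n)" for C C'
  proof (rule joined_same_top[OF C(1,2) _ C(5)])
    show "joined n (restrict_labels n C) (restrict_labels n C')"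
      using C by (intro Suc.IH restrict_tableau[OF C(1)] restrict_tableau[OF C(2)])
        (simp_all only: shape_restrict_top[OF C(1)] shape_restrict_top[OF C(2)] le_SucI order_refl)
  qed (use C in simp)
  obtain s where s: "removable A s" "domino B (Suc n) = rim A s"
    using top_domino[OF Suc.prems(1)] unfolding sh by metis
  obtain t where t: "removable A t" "domino B' (Suc n) = rim A t"
    using top_domino[OF Suc.prems(2)] unfolding sh by metis
  \<comment> \<open>The claim covers every tableau \<open>C\<close> with its largest domino at the
    current position, since the witnesses for successive links need not match.\<close>
  have "\<forall>C. domino_tableau X (Suc n) C \<longrightarrow> shape C = A \<longrightarrow> domino C (Suc n) = rim A t \<longrightarrow> joined (Suc n) B C"
    using top_joined_connected[OF Suc.prems(1) sh(1) s(1) t(1)]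
  proof (induction rule: rtranclp_induct)
    case base
    then show ?case using same Suc.prems(1) sh(1) s(2) by simp
  next
    case (step y z)
    then obtain C1 C2 where C: "domino_tableau X (Suc n) C1" "domino_tableau X (Suc n) C2"
      "shape C1 = A" "shape C2 = A" "domino C1 (Suc n) = rim A y" "domino C2 (Suc n) = rim A z"
      "joined (Suc n) C1 C2" unfolding top_joined_def by blast
    show ?case
    proof (intro allI impI)
      fix D assume D: "domino_tableau X (Suc n) D" "shape D = A" "domino D (Suc n) = rim A z"
      have "joined (Suc n) B C1" using step.IH C by blast
      then have "joined (Suc n) B C2"
        using joined_trans[OF Suc.prems(1) C(1) _ _ _ C(7)] C(3,4) sh(1) by simp
      moreover have "joined (Suc n) C2 D" using same[OF C(2) D(1) C(4) D(2)] C(6) D(3) by simp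
      ultimately show "joined (Suc n) B D"
        using joined_trans[OF Suc.prems(1) C(2)] C(4) D(2) sh(1) by simp
    qed
  qed
  then show ?case using Suc.prems(2) sh(2) t(2) by blast
qed

end

lemma moves_T_seq:
  assumes "(move N)\<^sup>*\<^sup>* T T'" "(T, T2) \<in> tableau_pairs X N"
  shows "\<exists>\<Sigma>. (\<forall>\<sigma>\<in>set \<Sigma>. admissible N \<sigma>) \<and> (T', T2) \<in> T_seq X N Q Q' \<Sigma> (T, T2)"
  using assms
proof (induction rule: converse_rtranclp_induct)
  case base
  show ?case by (intro exI[of _ "[]"]) simp
next
  case (step T U)
  have "(U, T2) \<in> tableau_pairs X N" using step.hyps(1) step.prems by (simp add: move_def tableau_pairs_def)
  then obtain \<Sigma> where \<Sigma>: "\<forall>\<sigma>\<in>set \<Sigma>. admissible N \<sigma>" "(T', T2) \<in> T_seq X N Q Q' \<Sigma> (U, T2)"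
    using step.IH by blast
  obtain \<sigma> where "admissible N \<sigma>" "(U, T2) \<in> apply_op X N Q Q' \<sigma> (T, T2)"
    using step.hyps(1) step.prems unfolding move_def step_def by blast
  then show ?case using \<Sigma> by (intro exI[of _ "\<sigma> # \<Sigma>"]) auto
qed

end

theorem theorem1:
  fixes X :: cartan_type and n :: nat
    and Q Q' :: "nat \<Rightarrow> tableau"
    and T1 T2 T1' T2' :: tableau
  assumes "n \<ge> 1"
    and "quasi_staircase_choice X Q Q'"
    and "(T1, T2) \<in> tableau_pairs X n"
    and "(T1', T2') \<in> tableau_pairs X n"
    and "T2 = T2'"
  shows "\<exists>\<Sigma>. (\<forall>\<sigma>\<in>set \<Sigma>. admissible n \<sigma>) \<and> (T1', T2') \<in> T_seq X n Q Q' \<Sigma> (T1, T2)"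
proof -
  interpret operator_family X Q Q' .
  have T: "domino_tableau X n T1" "domino_tableau X n T1'" "shape T1' = shape T1"
    using assms(3-5) by (auto simp: tableau_pairs_def)
  \<comment> \<open>The result is used with no extra dominos, so overriding replaces the whole
    tableau.\<close>
  have "T1 ++ T1' = T1'"
  proof (rule ext)
    fix s
    have "s \<in> shape T1 \<longleftrightarrow> s \<in> shape T1'" using T(3) by simp
    then show "(T1 ++ T1') s = T1' s" by (auto simp: map_add_def split: option.splits)
  qed
  moreover have "(move n)\<^sup>*\<^sup>* T1 (T1 ++ T1')"
    using same_shape_joined[OF assms(2) T] T(1) restrict_all[OF T(1)] unfolding joined_def by blast
  ultimately have "(move n)\<^sup>*\<^sup>* T1 T1'" by simp
  then show ?thesis using moves_T_seq assms(3,5) by blast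
qed

end
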